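(* Let $0 < \alpha < \beta < \infty$, let $\gamma$ be a Gaussian measure on $\mathbb{R}^n$, let $X$ be an $\mathbb{R}^n$-valued random variable whose law has a log-concave density with respect to $\gamma$, and let $Z \sim \gamma$. Then $$D_\beta(X\|Z) \leq \frac{\beta}{\alpha}\, D_\alpha(X\|Z),$$ with equality if and only if $X$ is (in law) a translation of $Z$.
   Context: A Gaussian measure is the law of an affine image of a standard Gaussian vector. A density $\frac{d\mu}{d\gamma}$ is log-concave if it equals $e^{f}$ for a concave function $f:\mathbb{R}^n\to\mathbb{R}\cup\{-\infty\}$. For random variables $X\sim\mu$ and $Y\sim\nu$ with $\mu\ll\nu$ and $\alpha\in(0,1)\cup(1,\infty)$, the $\alpha$-Rényi divergence is $$D_\alpha(X\|Y) = \frac{1}{\alpha-1}\log\int\left(\frac{d\mu}{d\nu}\right)^{\alpha} d\nu,$$ with natural logarithm, and $D_1(X\|Y)=\lim_{\alpha\to1}D_\alpha(X\|Y) = \int \log\left(\frac{d\mu}{d\nu}\right)d\mu$ is the Kullback-Leibler divergence. *)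

theory Defs
  imports "HOL-Probability.Probability"
begin

text \<open>
  Every affine map from \<open>m\<close>-dimensional to \<open>n\<close>-dimensional space has the form
  \<open>x \<mapsto> b + (\<Sum>i<m. x i *\<^sub>R a i)\<close>, where the \<open>a i\<close> are the columns of its matrix. The
  standard Gaussian vector is a family of \<open>m\<close> independent standard normal variables. The dimension
  \<open>m\<close> is arbitrary and the map need not be surjective, so degenerate Gaussian measures are included.
\<close>

definition gaussian_measure :: "(real^'n) measure \<Rightarrow> bool" where
  "gaussian_measure \<gamma> \<longleftrightarrow>
     (\<exists>(m::nat) (a :: nat \<Rightarrow> real^'n) (b :: real^'n).
        \<gamma> = distr (PiM {..<m} (\<lambda>_. std_normal_distribution)) borel
               (\<lambda>x. b + (\<Sum>i<m. x i *\<^sub>R a i)))"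

text \<open>
  Concavity for functions with values in \<open>\<real> \<union> {-\<infinity>}\<close>. Since \<open>\<infinity>\<close> is excluded, the left-hand side
  of the inequality is never of the form \<open>\<infinity> - \<infinity>\<close>; at the end points of the segment,
  \<open>0 * (-\<infinity>) = 0\<close> makes it trivial.
\<close>

definition ext_concave :: "('a::real_vector \<Rightarrow> ereal) \<Rightarrow> bool" where
  "ext_concave f \<longleftrightarrow>
     (\<forall>x. f x \<noteq> \<infinity>) \<and>
     (\<forall>x y. \<forall>t\<in>{0..1}.
        ereal (1 - t) * f x + ereal t * f y \<le> f ((1 - t) *\<^sub>R x + t *\<^sub>R y))"

definition exp_ereal :: "ereal \<Rightarrow> ennreal" where
  "exp_ereal x =
     (if x = -\<infinity> then 0 else if x = \<infinity> then \<infinity> else ennreal (exp (real_of_ereal x)))"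

definition ln_ennreal :: "ennreal \<Rightarrow> ereal" where
  "ln_ennreal x =
     (if x = 0 then -\<infinity> else if x = \<infinity> then \<infinity> else ereal (ln (enn2real x)))"

text \<open>
  The density is determined only almost everywhere, so it suffices that one version of it is the
  exponential of a concave function. That function need not be Borel measurable.
\<close>

definition log_concave_density :: "'a::real_vector measure \<Rightarrow> 'a measure \<Rightarrow> bool" where
  "log_concave_density \<gamma> \<mu> \<longleftrightarrow>
     sets \<mu> = sets \<gamma> \<and> absolutely_continuous \<gamma> \<mu> \<and>
     (\<exists>f. ext_concave f \<and> (AE x in \<gamma>. RN_deriv \<gamma> \<mu> x = exp_ereal (f x)))"

text \<open>
  The divergence of \<open>\<mu>\<close> from \<open>\<nu>\<close>, for probability measures with \<open>\<mu>\<close> absolutely continuous with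
  respect to \<open>\<nu>\<close>; the definition is not meaningful otherwise. It can be infinite. For \<open>\<alpha> = 1\<close>
  the negative part of the integrand is always \<open>\<mu>\<close>-integrable, so that a non-integrable integrand
  means divergence \<open>\<infinity>\<close>; note that \<open>KL_divergence\<close> takes its arguments in the opposite order.
\<close>

definition renyi_divergence :: "real \<Rightarrow> 'a measure \<Rightarrow> 'a measure \<Rightarrow> ereal" where
  "renyi_divergence \<alpha> \<mu> \<nu> =
     (if \<alpha> = 1 then
        (if integrable \<mu> (entropy_density (exp 1) \<nu> \<mu>)
         then ereal (KL_divergence (exp 1) \<nu> \<mu>) else \<infinity>)
      else
        ereal (1 / (\<alpha> - 1)) *
        ln_ennreal (\<integral>\<^sup>+ x. ennreal (enn2real (RN_deriv \<nu> \<mu> x) powr \<alpha>) \<partial>\<nu>))"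

end

theory Submission
  imports Defs
begin

text \<open>
  If \<open>g\<close> is the log-concave density and \<open>G a = ln (\<integral> g\<^sup>a d\<gamma>) / a\<close>, then \<open>G 1 = 0\<close> and
  \<open>D\<^sub>a / a = G a / (a - 1)\<close> is the slope of a chord of \<open>G\<close>, so that the inequality says that \<open>G\<close> is
  concave on \<open>{0<..}\<close>. Concavity of \<open>G\<close> is a Prekopa-type inequality: if
  \<open>g0 x powr p * g1 y powr q \<le> g (p x + q y)\<close>, then the means with exponents \<open>a\<close>, \<open>b\<close> and
  \<open>p a + q b\<close> satisfy the analogous inequality. It tensorizes, so it suffices to treat dimension one.
  There, let \<open>x \<mapsto> x + u x\<close> be the monotone map that transports the Gaussian measure to the normalized
  \<open>g\<^sup>a \<gamma>\<close>. Taking logarithms in the change of variables formula and integrating by parts gives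
  \<open>G a = \<integral> ln g (x + u x) - (u\<^sup>2 / 2 + h (- u')) / a d\<gamma>\<close> with \<open>h v = - v - ln (1 - v)\<close>. Since
  \<open>g\<close> is log-concave, the map is a contraction, so \<open>0 \<le> - u' < 1\<close>, and on this range
  \<open>(v, a) \<mapsto> h v / a\<close> is jointly convex. Hence interpolating the two transport maps and Jensen's
  inequality yield the claim. Equality forces \<open>u' = 0\<close>, that is, an exponential \<open>g\<close>, and an
  exponential density with respect to a Gaussian measure is a translation. The case of exponent 1 is
  the limit of the others, and strictness survives in it because the slopes are monotone.
\<close>

section \<open>Joint convexity of the logarithmic defect\<close>

text \<open>The formula for \<open>G a\<close> is one half of a variational principle. For every
  sufficiently regular increasing map the right-hand side is a lower bound of \<open>G a\<close>, by
  Jensen's inequality, and the transport map attains it. Hence equality is used at the two exponents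
  \<open>a\<close> and \<open>b\<close>, and only the bound at \<open>p * a + q * b\<close>, where
  the interpolated map need not be optimal. The contraction property is what makes this work: joint
  convexity of \<open>h v / a\<close> amounts to convexity of the square root of \<open>h\<close>,
  and this fails for small negative \<open>v\<close>. Three functions are needed because of the
  induction on the dimension: integrating out a coordinate with the exponents \<open>a\<close>,
  \<open>b\<close> and \<open>p * a + q * b\<close> turns a single \<open>g\<close> into three
  different functions. Degenerate Gaussian measures are handled by working in the coordinates of the
  standard Gaussian vector. The price is that the coordinates of a point are not unique, so that for
  the converse direction the tilts have to be written as functions of the point.\<close>

text \<open>After clearing the denominator the defect is the explicit square
  \<open>p * q * (x * b - y * a)\<^sup>2 / (a * b)\<close>, which also settles the equality
  case.\<close>

lemma bergstrom:
  fixes p q a b x y :: real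
  assumes "0 \<le> p" "0 \<le> q" "p + q = 1" "0 < a" "0 < b"
  shows "(p * x + q * y)\<^sup>2 / (p * a + q * b) \<le> p * x\<^sup>2 / a + q * y\<^sup>2 / b"
proof -
  have pos: "0 < p * a + q * b"
    using assms by (cases "p = 0") (auto intro!: add_pos_nonneg)
  have "(p * x\<^sup>2 / a + q * y\<^sup>2 / b) * (p * a + q * b) - (p * x + q * y)\<^sup>2
      = p * q * (x * b - y * a)\<^sup>2 / (a * b)"
    using assms(4,5) by (simp add: field_simps power2_eq_square)
  moreover have "\<dots> \<ge> 0" using assms by simp
  ultimately show ?thesis using pos by (simp add: pos_divide_le_eq)
qed

lemma bergstrom_eq_imp:
  fixes p q a b x y :: real
  assumes "0 < p" "0 < q" "p + q = 1" "0 < a" "0 < b"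
    and "(p * x + q * y)\<^sup>2 / (p * a + q * b) = p * x\<^sup>2 / a + q * y\<^sup>2 / b"
  shows "x * b = y * a"
proof -
  have pos: "0 < p * a + q * b" using assms(1,2,4,5) by (simp add: add_pos_pos)
  have "(p * x\<^sup>2 / a + q * y\<^sup>2 / b) * (p * a + q * b) - (p * x + q * y)\<^sup>2
      = p * q * (x * b - y * a)\<^sup>2 / (a * b)"
    using assms(4,5) by (simp add: field_simps power2_eq_square)
  moreover have "(p * x\<^sup>2 / a + q * y\<^sup>2 / b) * (p * a + q * b) - (p * x + q * y)\<^sup>2 = 0"
    using assms(6)[symmetric] pos by simp
  ultimately have "p * q * (x * b - y * a)\<^sup>2 / (a * b) = 0" by simp
  thus ?thesis using assms(1,2,4,5) by simp
qed

text \<open>Convexity of the power on positive numbers; when an argument is zero, what remains is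
  \<open>r powr c \<le> r\<close> for \<open>r\<close> in the unit interval, as in
  \<open>scale\<close>.\<close>

lemma powr_weighted_le:
  fixes p q x y c :: real
  assumes "0 \<le> p" "0 \<le> q" "p + q = 1" "0 \<le> x" "0 \<le> y" "1 \<le> c"
  shows "(p * x + q * y) powr c \<le> p * x powr c + q * y powr c"
proof -
  have scale: "(r * z) powr c \<le> r * z powr c" if "0 \<le> r" "r \<le> 1" "0 \<le> z" for r z :: real
  proof (cases "r = 0")
    case False
    have "r powr c \<le> r powr 1" using that False assms by (intro powr_mono') auto
    then show ?thesis using that False by (auto simp: powr_mult intro!: mult_right_mono)
  qed simp
  consider "x = 0" | "y = 0" | "0 < x" "0 < y" using assms by linarith
  then show ?thesis
  proof cases
    case 1 then show ?thesis using assms scale[of q y] by simp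
  next
    case 2 then show ?thesis using assms scale[of p x] by simp
  next
    case 3
    then show ?thesis
      using convex_onD[OF powr_convex[OF assms(6)], of q x y] assms
      by (simp add: eq_diff_eq[symmetric, of p q 1])
  qed
qed

text \<open>The power splits as \<open>v ^ k = (v powr (k / 2))\<^sup>2\<close>, a square of a convex function.\<close>
lemma power_bergstrom:
  fixes p q a b x y :: real
  assumes "0 \<le> p" "0 \<le> q" "p + q = 1" "0 < a" "0 < b" "0 \<le> x" "0 \<le> y" "2 \<le> k"
  shows "(p * x + q * y) ^ k / (p * a + q * b) \<le> p * x ^ k / a + q * y ^ k / b"
proof -
  have sq: "(z powr (k / 2))\<^sup>2 = z ^ k" if "0 \<le> z" for z :: real
    using that assms(8)
    by (cases "z = 0") (auto simp: powr_realpow[symmetric] powr_powr)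
  have pos: "0 < p * a + q * b"
    using assms by (cases "p = 0") (auto intro!: add_pos_nonneg)
  have "((p * x + q * y) powr (k / 2))\<^sup>2 \<le> (p * x powr (k / 2) + q * y powr (k / 2))\<^sup>2"
    using assms by (intro power_mono powr_weighted_le) auto
  hence "(p * x + q * y) ^ k / (p * a + q * b)
      \<le> (p * x powr (k / 2) + q * y powr (k / 2))\<^sup>2 / (p * a + q * b)"
    using assms pos by (subst (asm) sq) (auto intro!: divide_right_mono)
  also have "\<dots> \<le> p * x ^ k / a + q * y ^ k / b"
    using bergstrom[of p q a b "x powr (k/2)" "y powr (k/2)"] assms sq by auto
  finally show ?thesis .
qed

lemma neg_ln_series:
  fixes v :: real
  assumes "0 \<le> v" "v < 1"
  shows "(\<lambda>n. v ^ (n + 2) / real (n + 2)) sums (- v - ln (1 - v))"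
proof -
  have "(\<lambda>n. - ((- (- v)) ^ n) / of_nat n) sums ln (1 + - v)"
    using assms by (intro ln_series') auto
  hence "(\<lambda>n. - (- (v ^ n) / real n)) sums (- ln (1 - v))"
    by (intro sums_minus) simp
  hence "(\<lambda>n. v ^ n / real n) sums (- ln (1 - v))" by simp
  \<comment> \<open>The two dropped terms are \<open>1 / 0 = 0\<close> for \<open>n = 0\<close> and
    \<open>v\<close> for \<open>n = 1\<close>.\<close>
  from sums_split_initial_segment[OF this, of 2]
  have "(\<lambda>n. v ^ (n + 2) / real (n + 2)) sums (- ln (1 - v) - v)"
    by (simp add: numeral_2_eq_2 add_ac)
  moreover have "- ln (1 - v) - v = - v - ln (1 - v)" by simp
  ultimately show ?thesis by (simp only:)
qed

text \<open>
  By the series, \<open>h v / a\<close> is the sum of the jointly convex terms \<open>v ^ k / (k * a)\<close> with \<open>k \<ge> 2\<close>.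
  Equality in the term \<open>k = 2\<close> makes \<open>v\<close> proportional to \<open>a\<close>, and then \<open>k = 3\<close> leaves only \<open>v = 0\<close>.
\<close>
lemma log_defect_convex:
  fixes p q a b x y :: real
  assumes "0 < p" "0 < q" "p + q = 1" "0 < a" "0 < b" "0 \<le> x" "x < 1" "0 \<le> y" "y < 1"
  defines "h \<equiv> \<lambda>v. - v - ln (1 - v) :: real"
  shows "h (p * x + q * y) / (p * a + q * b) \<le> p * h x / a + q * h y / b"
    and "h (p * x + q * y) / (p * a + q * b) = p * h x / a + q * h y / b \<Longrightarrow> a \<noteq> b
      \<Longrightarrow> x = 0 \<and> y = 0"
proof -
  define z where "z = p * x + q * y"
  define c where "c = p * a + q * b"
  have "z < p * 1 + q * 1" unfolding z_def
    using assms by (intro add_strict_mono mult_strict_left_mono) auto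
  hence z: "0 \<le> z" "z < 1" using assms by (auto simp: z_def)
  have c: "c > 0" using assms by (simp add: c_def add_pos_pos)
  define d where "d = (\<lambda>n. (p * (x ^ (n + 2) / real (n + 2)) / a + q * (y ^ (n + 2) / real (n + 2)) / b)
      - z ^ (n + 2) / real (n + 2) / c)"
  have d: "d sums (p * h x / a + q * h y / b - h z / c)"
    unfolding d_def h_def
    by (intro sums_diff sums_add sums_divide sums_mult neg_ln_series assms z)
  have d': "d n = (p * x ^ (n + 2) / a + q * y ^ (n + 2) / b - z ^ (n + 2) / c) / real (n + 2)" for n
    unfolding d_def by (simp add: add_divide_distrib diff_divide_distrib mult.commute)
  have nonneg: "0 \<le> d n" for n
    unfolding d' z_def c_def using power_bergstrom[of p q a b x y "n + 2"] assms by simp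
  show le: "h (p * x + q * y) / (p * a + q * b) \<le> p * h x / a + q * h y / b"
    using sums_le[OF _ sums_zero d] nonneg by (simp add: z_def c_def)
  assume eq: "h (p * x + q * y) / (p * a + q * b) = p * h x / a + q * h y / b" and ab: "a \<noteq> b"
  have "d sums 0" using d eq by (simp add: z_def c_def)
  hence d0: "d n = 0" for n
    using suminf_eq_zero_iff[of d] nonneg by (auto simp: sums_iff)
  have k2: "x * b = y * a"
    using d0[of 0] bergstrom_eq_imp[of p q a b x y] assms
    unfolding d' z_def c_def by (simp add: power2_eq_square)
  define s where "s = x / a"
  have xs: "x = s * a" "y = s * b" using k2 assms by (auto simp: s_def field_simps)
  have zs: "z = s * c" by (simp add: z_def c_def xs algebra_simps)
  have "p * x ^ 3 / a + q * y ^ 3 / b = z ^ 3 / c"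
    using d0[of 1] by (simp add: d' eval_nat_numeral)
  hence "s ^ 3 * (p * a\<^sup>2 + q * b\<^sup>2 - c\<^sup>2) = 0"
    unfolding xs zs using assms c by (simp add: field_simps power2_eq_square power3_eq_cube)
  moreover have "p * a\<^sup>2 + q * b\<^sup>2 - c\<^sup>2 = p * q * (a - b)\<^sup>2"
  proof -
    have q: "q = 1 - p" using assms by simp
    show ?thesis unfolding c_def q by (simp add: algebra_simps power2_eq_square)
  qed
  ultimately have "s = 0" using assms ab by simp
  thus "x = 0 \<and> y = 0" by (simp add: xs)
qed

section \<open>Monotone transport of the Gaussian measure\<close>

text \<open>On an open interval \<open>U\<close> where the density is continuous and positive, the
  distribution function is a differentiable bijection onto the open unit interval with nonzero
  derivative, so it can be inverted. The density may jump at the boundary of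
  \<open>U\<close>.\<close>

lemma cdf_density_properties:
  fixes w :: "real \<Rightarrow> real"
  assumes meas [measurable]: "w \<in> borel_measurable borel" and nonneg: "\<And>x. 0 \<le> w x"
    and mass: "(\<integral>\<^sup>+x. ennreal (w x) \<partial>lborel) = 1"
    and U: "open U" "convex U" and cont: "continuous_on U w"
    and pos: "\<And>x. x \<in> U \<Longrightarrow> 0 < w x" and zero: "\<And>x. x \<notin> U \<Longrightarrow> w x = 0"
  defines "F \<equiv> cdf (density lborel w)"
  shows cdf_density_deriv: "\<And>x. x \<in> U \<Longrightarrow> (F has_real_derivative w x) (at x)"
    and cdf_density_mono: "\<And>x y. x \<in> U \<Longrightarrow> y \<in> U \<Longrightarrow> x < y \<Longrightarrow> F x < F y"
    and cdf_density_surj: "\<And>u. 0 < u \<Longrightarrow> u < 1 \<Longrightarrow> \<exists>x\<in>U. F x = u"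
    and cdf_density_range: "\<And>x. x \<in> U \<Longrightarrow> 0 < F x \<and> F x < 1"
    and cdf_density_integral: "\<And>x. F x = (LINT t:{..x}|lborel. w t)"
proof -
  interpret prob_space "density lborel w"
    by (rule prob_spaceI) (simp add: emeasure_density mass)
  interpret real_distribution "density lborel w"
    by unfold_locales auto
  have int: "integrable lborel w"
    using mass nonneg by (intro integrableI_nonneg) auto
  have sint: "set_integrable lborel A w" if "A \<in> sets borel" for A
    using integrable_mult_indicator[OF _ int, of A] that by (simp add: set_integrable_def)
  show F: "F x = (LINT t:{..x}|lborel. w t)" for x
  proof -
    have "emeasure (density lborel w) {..x} = ennreal (LINT t:{..x}|lborel. w t)"
      using sint[of "{..x}"] nonneg
      by (simp add: emeasure_density set_lebesgue_integral_def set_integrable_def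
          nn_integral_eq_integral[symmetric] mult.commute)
        (auto intro!: nn_integral_cong split: split_indicator)
    moreover have "0 \<le> (LINT t:{..x}|lborel. w t)"
      using nonneg by (simp add: set_lebesgue_integral_def)
    ultimately show ?thesis unfolding F_def cdf_def measure_def by simp
  qed
  have diff: "F y - F x = integral {x..y} w" if "x \<le> y" for x y
  proof -
    have "(LINT t:{..y}|lborel. w t) = (LINT t:{..x}|lborel. w t) + (LINT t:{x<..y}|lborel. w t)"
      using that by (subst set_integral_Un[symmetric]) (auto intro: sint simp: ivl_disj_un)
    also have "(LINT t:{x<..y}|lborel. w t) = (LINT t:{x..y}|lborel. w t)"
      using that unfolding set_lebesgue_integral_def
      by (intro integral_cong_AE)
        (auto intro: AE_mp[OF AE_lborel_singleton[of x]] simp: indicator_def)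
    also have "\<dots> = integral {x..y} w"
      using sint by (intro set_borel_integral_eq_integral) auto
    finally show ?thesis by (simp add: F)
  qed
  show deriv: "(F has_real_derivative w x) (at x)" if x: "x \<in> U" for x
  proof -
    obtain e where e: "e > 0" "cball x e \<subseteq> U"
      using open_contains_cball U x by blast
    hence sub: "{x - e..x + e} \<subseteq> U" by (simp add: cball_eq_atLeastAtMost)
    have "((\<lambda>y. integral {x - e..y} w) has_real_derivative w x) (at x within {x - e..x + e})"
      using e by (intro integral_has_real_derivative continuous_on_subset[OF cont sub]) auto
    hence "((\<lambda>y. F (x - e) + integral {x - e..y} w) has_real_derivative w x)
        (at x within {x - e..x + e})"
      by (auto intro!: derivative_eq_intros)
    moreover have "F (x - e) + integral {x - e..y} w = F y" if "y \<in> {x - e..x + e}" for y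
      using diff[of "x - e" y] that by simp
    ultimately have "(F has_real_derivative w x) (at x within {x - e..x + e})"
      using e(1) by (elim has_field_derivative_transform_within[where d = 1]) auto
    moreover have "at x within {x - e..x + e} = at x"
      using e by (intro at_within_interior) auto
    ultimately show ?thesis by simp
  qed
  show mono: "F x < F y" if "x \<in> U" "y \<in> U" "x < y" for x y
  proof (rule DERIV_pos_imp_increasing[OF that(3)])
    fix z assume "x \<le> z" "z \<le> y"
    hence "z \<in> U" using U(2) that mem_is_interval_1_I[of U x y z]
      by (simp add: is_interval_convex_1)
    thus "\<exists>d. (F has_real_derivative d) (at z) \<and> 0 < d" using deriv pos by blast
  qed
  have zeroF: "F x = 0" if "U \<subseteq> {x<..}" for x
  proof -
    have "indicator {..x} t *\<^sub>R w t = 0" for t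
      using that zero[of t] by (cases "t \<in> U") (auto simp: indicator_def)
    hence "(\<lambda>t. indicator {..x} t *\<^sub>R w t) = (\<lambda>_. 0)" by blast
    thus ?thesis by (simp only: F set_lebesgue_integral_def) simp
  qed
  have oneF: "F x = 1" if "U \<subseteq> {..<x}" for x
  proof -
    have "indicator {..x} t *\<^sub>R w t = w t" for t
      using that zero[of t] by (cases "t \<in> U") (auto simp: indicator_def)
    hence "(\<lambda>t. indicator {..x} t *\<^sub>R w t) = w" by blast
    moreover have "integral\<^sup>L lborel w = 1"
      using nn_integral_eq_integral[OF int] nonneg mass by simp
    ultimately show ?thesis by (simp only: F set_lebesgue_integral_def)
  qed
  show "0 < F x \<and> F x < 1" if x: "x \<in> U" for x
  proof -
    obtain e where e: "e > 0" "cball x e \<subseteq> U"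
      using open_contains_cball U x by blast
    hence sub: "x - e \<in> U" "x + e \<in> U" by (auto simp: cball_eq_atLeastAtMost)
    have "0 \<le> F (x - e)" "F (x + e) \<le> 1"
      unfolding F_def by (auto intro: cdf_nonneg cdf_bounded_prob)
    with mono[OF sub(1) x] mono[OF x sub(2)] e show ?thesis by auto
  qed
  show "\<exists>x\<in>U. F x = u" if u: "0 < u" "u < 1" for u
  proof -
    have cF: "continuous_on UNIV F"
      unfolding continuous_on_eq_continuous_at[OF open_UNIV]
    proof
      fix x :: real
      have "emeasure (density lborel w) {x} = (\<integral>\<^sup>+t. ennreal (w t) * indicator {x} t \<partial>lborel)"
        by (simp add: emeasure_density)
      also have "\<dots> = 0"
      proof (subst nn_integral_0_iff_AE)
        show "AE t in lborel. ennreal (w t) * indicator {x} t = 0"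
          using AE_lborel_singleton[of x] by eventually_elim (simp add: indicator_def)
      qed measurable
      finally show "isCont F x" unfolding F_def isCont_cdf by (simp add: measure_def)
    qed
    obtain l where l: "F l < u"
      using order_tendstoD(2)[OF cdf_lim_at_bot u(1)] unfolding F_def eventually_at_bot_linorder by blast
    obtain r where r: "u < F r"
      using order_tendstoD(1)[OF cdf_lim_at_top_prob u(2)] unfolding F_def eventually_at_top_linorder by blast
    have "l \<le> r"
    proof (rule ccontr)
      assume "\<not> l \<le> r"
      hence "F r \<le> F l" unfolding F_def by (intro cdf_nondecreasing) auto
      with l r show False by simp
    qed
    then obtain x where x: "F x = u"
      using IVT'[of F l u r] l r continuous_on_subset[OF cF] by auto
    have "x \<in> U"
    proof (rule ccontr)
      assume "x \<notin> U"
      \<comment> \<open>An interval that misses \<open>x\<close> lies on one side of it, which would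
        make \<open>F x\<close> equal to 0 or 1.\<close>
      hence "U \<subseteq> {x<..} \<or> U \<subseteq> {..<x}"
        using U(2) mem_is_interval_1_I[of U _ _ x] unfolding is_interval_convex_1
        by (metis greaterThan_iff lessThan_iff linorder_le_less_linear subsetI)
      with zeroF oneF x u show False by auto
    qed
    with x show ?thesis by blast
  qed
qed

section \<open>Log-concave functions: measurability and growth\<close>

text \<open>In multiplicative form the zeros of \<open>g\<close> need no logarithm:
  \<open>0 powr t = 0\<close> makes the inequality trivial there.\<close>

definition logconc :: "('v::real_vector \<Rightarrow> real) \<Rightarrow> bool" where
  "logconc g \<longleftrightarrow> (\<forall>x. 0 \<le> g x) \<and>
     (\<forall>x y t. 0 < t \<longrightarrow> t < 1 \<longrightarrow>
        g x powr (1 - t) * g y powr t \<le> g ((1 - t) *\<^sub>R x + t *\<^sub>R y))"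

lemma logconc_nonneg: "logconc g \<Longrightarrow> 0 \<le> g x"
  by (simp add: logconc_def)

lemma logconcD:
  "logconc g \<Longrightarrow> 0 < t \<Longrightarrow> t < 1 \<Longrightarrow>
    g x powr (1 - t) * g y powr t \<le> g ((1 - t) *\<^sub>R x + t *\<^sub>R y)"
  by (simp add: logconc_def)

lemma logconc_powr:
  assumes "logconc g" "0 \<le> a"
  shows "logconc (\<lambda>x. g x powr a)"
  unfolding logconc_def
proof (intro conjI allI impI)
  fix x y and t :: real assume t: "0 < t" "t < 1"
  have "(g x powr a) powr (1 - t) * (g y powr a) powr t = (g x powr (1 - t) * g y powr t) powr a"
    using assms by (simp add: powr_powr powr_mult mult.commute logconc_nonneg)
  also have "\<dots> \<le> g ((1 - t) *\<^sub>R x + t *\<^sub>R y) powr a"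
    using assms t by (intro powr_mono2 logconcD) auto
  finally show "(g x powr a) powr (1 - t) * (g y powr a) powr t
      \<le> g ((1 - t) *\<^sub>R x + t *\<^sub>R y) powr a" .
qed simp

lemma logconc_line:
  assumes "logconc g"
  shows "logconc (\<lambda>x::real. g (z + x *\<^sub>R d))"
  unfolding logconc_def
proof (intro conjI allI impI)
  fix x y t :: real assume t: "0 < t" "t < 1"
  have "(1 - t) *\<^sub>R (z + x *\<^sub>R d) + t *\<^sub>R (z + y *\<^sub>R d)
      = z + ((1 - t) *\<^sub>R x + t *\<^sub>R y) *\<^sub>R d"
    by (simp add: algebra_simps)
  with logconcD[OF assms t, of "z + x *\<^sub>R d" "z + y *\<^sub>R d"]
  show "g (z + x *\<^sub>R d) powr (1 - t) * g (z + y *\<^sub>R d) powr t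
      \<le> g (z + ((1 - t) *\<^sub>R x + t *\<^sub>R y) *\<^sub>R d)"
    by simp
qed (simp add: logconc_nonneg assms)

lemma logconc_concave:
  assumes "logconc g"
  shows "convex {x. 0 < g x}" "convex_on {x. 0 < g x} (\<lambda>x. - ln (g x))"
proof -
  have *: "0 < g ((1 - t) *\<^sub>R x + t *\<^sub>R y) \<and>
      (1 - t) * ln (g x) + t * ln (g y) \<le> ln (g ((1 - t) *\<^sub>R x + t *\<^sub>R y))"
    if "0 < g x" "0 < g y" "0 < t" "t < 1" for x y t
  proof -
    have pos: "0 < g x powr (1 - t) * g y powr t" using that by simp
    moreover have le: "g x powr (1 - t) * g y powr t \<le> g ((1 - t) *\<^sub>R x + t *\<^sub>R y)"
      by (rule logconcD) fact+
    ultimately have "ln (g x powr (1 - t) * g y powr t) \<le> ln (g ((1 - t) *\<^sub>R x + t *\<^sub>R y))"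
      by (subst ln_le_cancel_iff) auto
    with less_le_trans[OF pos le] that show ?thesis by (simp add: ln_mult ln_powr)
  qed
  show cv: "convex {x. 0 < g x}"
    unfolding convex_alt
  proof (intro ballI allI impI)
    fix x y and u :: real
    assume "x \<in> {x. 0 < g x}" "y \<in> {x. 0 < g x}" "0 \<le> u \<and> u \<le> 1"
    thus "(1 - u) *\<^sub>R x + u *\<^sub>R y \<in> {x. 0 < g x}"
      using *[of x y u] by (cases "u = 0 \<or> u = 1") auto
  qed
  show "convex_on {x. 0 < g x} (\<lambda>x. - ln (g x))"
    by (rule convex_onI[OF _ cv]) (use * in fastforce)
qed

lemma logconc_three_points:
  fixes g :: "real \<Rightarrow> real"
  assumes "logconc g" "x < y" "y < z" "0 < g x" "0 < g z"
  shows "(z - y) * ln (g x) + (y - x) * ln (g z) \<le> (z - x) * ln (g y)"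
proof -
  define t where "t = (y - x) / (z - x)"
  have t: "0 < t" "t < 1" "1 - t = (z - y) / (z - x)"
    using assms by (auto simp: t_def field_simps)
  have "(1 - t) *\<^sub>R x + t *\<^sub>R z = x + t * (z - x)" by (simp add: algebra_simps)
  also have "\<dots> = y" using assms by (simp add: t_def)
  finally have "(1 - t) *\<^sub>R x + t *\<^sub>R z = y" .
  with convex_onD[OF logconc_concave(2)[OF assms(1)], of t x z] t assms
  have "(1 - t) * ln (g x) + t * ln (g z) \<le> ln (g y)" by simp
  hence "(z - x) * ((1 - t) * ln (g x) + t * ln (g z)) \<le> (z - x) * ln (g y)"
    using assms by (intro mult_left_mono) auto
  moreover have "(z - x) * (1 - t) = z - y" "(z - x) * t = y - x"
    using assms unfolding t(3) by (auto simp: t_def)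
  ultimately show ?thesis by (simp add: distrib_left mult.assoc[symmetric])
qed

text \<open>The superlevel sets are convex subsets of the line, that is, intervals.\<close>

lemma logconc_measurable [measurable_dest]:
  fixes g :: "real \<Rightarrow> real"
  assumes "logconc g"
  shows "g \<in> borel_measurable borel"
  unfolding borel_measurable_iff_greater
proof
  fix c :: real
  have "{x. c < g x} \<in> sets borel"
  proof (cases "c < 0")
    case True
    hence "{x. c < g x} = UNIV" using logconc_nonneg[OF assms] by (auto intro: less_le_trans)
    thus ?thesis by simp
  next
    case False
    show ?thesis
    proof (rule real_interval_borel_measurable)
      show "is_interval {x. c < g x}"
        unfolding is_interval_1
      proof (intro ballI allI impI)
        fix x z y assume *: "x \<in> {x. c < g x}" "z \<in> {x. c < g x}" "x \<le> y \<and> y \<le> z"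
        show "y \<in> {x. c < g x}"
        proof (cases "y = x \<or> y = z")
          case False
          hence xyz: "x < y" "y < z" using * by auto
          have pos: "0 < g x" "0 < g z" using * \<open>\<not> c < 0\<close> by auto
          have gy: "0 < g y"
            using logconc_concave(1)[OF assms] pos xyz mem_is_interval_1_I[of "{x. 0 < g x}" x z y]
            by (simp add: is_interval_convex_1)
          define m where "m = min (g x) (g z)"
          have m: "0 < m" "c < m" using pos * by (auto simp: m_def)
          have "(z - x) * ln m = (z - y) * ln m + (y - x) * ln m" by (simp add: algebra_simps)
          also have "\<dots> \<le> (z - y) * ln (g x) + (y - x) * ln (g z)"
            using xyz pos m by (intro add_mono mult_left_mono) (auto simp: m_def)
          also have "\<dots> \<le> (z - x) * ln (g y)"
            by (intro logconc_three_points assms xyz pos)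
          finally have "ln m \<le> ln (g y)" using xyz by simp
          hence "m \<le> g y" using m gy by simp
          with m show ?thesis by simp
        qed (use * in auto)
      qed
    qed
  qed
  thus "{x \<in> space borel. c < g x} \<in> sets borel" by simp
qed

text \<open>To the right of an intermediate point \<open>m\<close> the concave function
  \<open>ln g\<close> lies below the prolonged secant over \<open>{p..m}\<close>, and to the left of
  \<open>m\<close> below that over \<open>{m..q}\<close>; \<open>k\<close> bounds both slopes. If
  there are no two points of positivity, \<open>g\<close> is nonzero in at most one point and
  therefore bounded.\<close>

lemma logconc_growth:
  fixes g :: "real \<Rightarrow> real"
  assumes "logconc g"
  obtains C k where "\<And>x. g x \<le> C * exp (k * \<bar>x\<bar>)" "0 \<le> C" "0 \<le> k"
proof (cases "\<exists>p q. p < q \<and> 0 < g p \<and> 0 < g q")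
  case False
  have "\<exists>C\<ge>0. \<forall>x. g x \<le> C"
  proof (cases "\<exists>p. 0 < g p")
    case True
    then obtain p where p: "0 < g p" by blast
    have "g x \<le> g p" for x
      using False p by (metis linorder_neqE_linordered_idom not_le order.strict_trans order_refl)
    with p show ?thesis by (intro exI[of _ "g p"]) auto
  qed (auto simp: not_less)
  then obtain C where "C \<ge> 0" "\<And>x. g x \<le> C" by blast
  thus ?thesis by (intro that[of C 0]) auto
next
  case True
  then obtain p q where pq: "p < q" "0 < g p" "0 < g q" by blast
  define m where "m = (p + q) / 2"
  have m: "p < m" "m < q" using pq by (auto simp: m_def)
  define B1 B2 where "B1 = (ln (g m) - ln (g p)) / (m - p)" and "B2 = (ln (g q) - ln (g m)) / (q - m)"
  define k where "k = max \<bar>B1\<bar> \<bar>B2\<bar>"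
  define A where "A = \<bar>ln (g m)\<bar> + k * \<bar>m\<bar>"
  have k: "0 \<le> k" by (simp add: k_def)
  have lin: "ln (g m) + B * (z - m) \<le> A + k * \<bar>z\<bar>" if "\<bar>B\<bar> \<le> k" for B z
  proof -
    have "B * (z - m) \<le> \<bar>B\<bar> * \<bar>z - m\<bar>" by (metis abs_ge_self abs_mult)
    also have "\<dots> \<le> k * (\<bar>z\<bar> + \<bar>m\<bar>)" using that by (intro mult_mono) auto
    finally show ?thesis by (simp add: A_def algebra_simps)
  qed
  have "g z \<le> exp A * exp (k * \<bar>z\<bar>)" for z
  proof (cases "0 < g z")
    case gz: True
    consider "z = m" | "m < z" | "z < m" by linarith
    hence "ln (g z) \<le> A + k * \<bar>z\<bar>"
    proof cases
      case 1
      thus ?thesis using lin[of 0 m] k by simp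
    next
      case 2
      from logconc_three_points[OF assms m(1) 2 pq(2) gz]
      have "(m - p) * ln (g z) \<le> (m - p) * ln (g m) + (z - m) * (ln (g m) - ln (g p))"
        by (simp add: algebra_simps)
      also have "\<dots> = (m - p) * (ln (g m) + B1 * (z - m))"
        using m by (simp add: B1_def field_simps)
      finally have "ln (g z) \<le> ln (g m) + B1 * (z - m)" using m by simp
      with lin[of B1 z] show ?thesis by (simp add: k_def)
    next
      case 3
      from logconc_three_points[OF assms 3 m(2) gz pq(3)]
      have "(q - m) * ln (g z) \<le> (q - m) * ln (g m) + (z - m) * (ln (g q) - ln (g m))"
        by (simp add: algebra_simps)
      also have "\<dots> = (q - m) * (ln (g m) + B2 * (z - m))"
        using m by (simp add: B2_def field_simps)
      finally have "ln (g z) \<le> ln (g m) + B2 * (z - m)" using m by simp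
      with lin[of B2 z] show ?thesis by (simp add: k_def)
    qed
    hence "exp (ln (g z)) \<le> exp (A + k * \<bar>z\<bar>)" by simp
    thus ?thesis using gz by (simp add: exp_add)
  qed (auto intro: order_trans[of _ 0])
  with k show ?thesis by (intro that[of "exp A" k]) auto
qed

section \<open>Gaussian integrals of exponentials and of log-concave functions\<close>

lemma std_normal_density_exp:
  "std_normal_density x * exp (c * x) = exp (c\<^sup>2 / 2) * normal_density c 1 x"
proof -
  have "- x\<^sup>2 / 2 + c * x = c\<^sup>2 / 2 + - (x - c)\<^sup>2 / 2"
    by (simp add: power2_eq_square field_simps)
  hence "exp (- x\<^sup>2 / 2) * exp (c * x) = exp (c\<^sup>2 / 2) * exp (- (x - c)\<^sup>2 / 2)"
    unfolding exp_add[symmetric] by (simp only:)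
  thus ?thesis by (simp add: normal_density_def)
qed

lemma std_normal_integrable_iff:
  fixes f :: "real \<Rightarrow> real"
  assumes "f \<in> borel_measurable borel"
  shows "integrable std_normal_distribution f \<longleftrightarrow> integrable lborel (\<lambda>x. std_normal_density x * f x)"
  using assms by (subst integrable_density) auto

lemma std_normal_integral:
  fixes f :: "real \<Rightarrow> real"
  assumes "f \<in> borel_measurable borel"
  shows "(LINT x|std_normal_distribution. f x) = (LINT x|lborel. std_normal_density x * f x)"
  using assms by (subst integral_density) auto

lemma std_normal_exp:
  shows std_normal_exp_integrable: "integrable std_normal_distribution (\<lambda>x. exp (c * x))"
    and std_normal_exp_integral: "(LINT x|std_normal_distribution. exp (c * x)) = exp (c\<^sup>2 / 2)"
  by (simp_all add: std_normal_integrable_iff std_normal_integral std_normal_density_exp)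

lemma std_normal_exp_abs_integrable:
  "integrable std_normal_distribution (\<lambda>x. exp (k * \<bar>x\<bar>))"
proof (rule Bochner_Integration.integrable_bound)
  show "integrable std_normal_distribution (\<lambda>x. exp (k * x) + exp ((- k) * x))"
    by (intro Bochner_Integration.integrable_add std_normal_exp_integrable)
  have "exp (k * \<bar>x\<bar>) \<le> exp (k * x) + exp ((- k) * x)" for x
    by (cases "0 \<le> x") simp_all
  thus "AE x in std_normal_distribution. norm (exp (k * \<bar>x\<bar>)) \<le> norm (exp (k * x) + exp ((- k) * x))"
    by (intro AE_I2) (simp add: abs_of_pos add_pos_pos)
qed simp

lemma logconc_integrable:
  fixes g :: "real \<Rightarrow> real"
  assumes "logconc g"
  shows "integrable std_normal_distribution g"
proof -
  obtain C k where Ck: "\<And>x. g x \<le> C * exp (k * \<bar>x\<bar>)" "0 \<le> C" "0 \<le> k"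
    using logconc_growth[OF assms] by blast
  have "integrable std_normal_distribution (\<lambda>x. C * exp (k * \<bar>x\<bar>))"
    by (intro integrable_mult_right std_normal_exp_abs_integrable)
  thus ?thesis
    by (rule Bochner_Integration.integrable_bound)
       (use logconc_measurable[OF assms] logconc_nonneg[OF assms] Ck in auto)
qed

lemma std_normal_density_pos: "0 < std_normal_density x"
  by (simp add: normal_density_pos)

lemma ln_std_normal_density: "ln (std_normal_density x) = - ln (sqrt (2 * pi)) - x\<^sup>2 / 2"
  by (simp add: std_normal_density_def ln_mult ln_div)

lemma std_normal_cdf_props:
  defines "F \<equiv> cdf std_normal_distribution"
  shows "(F has_real_derivative std_normal_density x) (at x)" "0 < F x" "F x < 1"
    and "F x = (LINT t:{..x}|lborel. std_normal_density t)"
proof -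
  have c: "continuous_on UNIV std_normal_density"
    unfolding std_normal_density_def by (intro continuous_intros) auto
  have m: "(\<integral>\<^sup>+x. ennreal (std_normal_density x) \<partial>lborel) = 1"
    using nn_integral_eq_integral[OF integrable_normal_density[of 1 0]] by simp
  note p = cdf_density_properties[OF _ _ m open_UNIV convex_UNIV c]
  show "(F has_real_derivative std_normal_density x) (at x)" "0 < F x" "F x < 1"
    "F x = (LINT t:{..x}|lborel. std_normal_density t)"
    unfolding F_def using p(1,4,5)[of x] std_normal_density_pos by auto
qed

section \<open>The transport map and its contraction property\<close>

text \<open>\<open>T\<close> matches quantiles: it is the inverse distribution function of the
  normalized target after the Gaussian distribution function. The last formula is the logarithm of
  the change of variables identity \<open>w (T x) * T' x = std_normal_density x\<close>.\<close>

lemma logconc_transport: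
  fixes g :: "real \<Rightarrow> real"
  assumes g: "logconc g" and Zpos: "0 < (LINT x|std_normal_distribution. g x)"
  obtains T T' :: "real \<Rightarrow> real"
  where "\<And>x. (T has_real_derivative T' x) (at x)" "continuous_on UNIV T'"
    "\<And>x. 0 < T' x" "\<And>x. T' x \<le> 1" "\<And>x. 0 < g (T x)"
    "\<And>x. ln (g (T x)) = ln (LINT x|std_normal_distribution. g x) + (T x)\<^sup>2 / 2 - x\<^sup>2 / 2 - ln (T' x)"
proof -
  define Z where "Z = (LINT x|std_normal_distribution. g x)"
  \<comment> \<open>A log-concave function may jump at the ends of its support. Passing to the
    interior removes only the frontier of a convex set, which is a null set.\<close>
  define U where "U = interior {x. 0 < g x}"
  define w where "w = (\<lambda>x. indicator U x * (g x * std_normal_density x / Z))"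
  define F where "F = cdf (density lborel w)"
  define G where "G = cdf std_normal_distribution"
  have Z: "0 < Z" using Zpos by (simp add: Z_def)
  have [measurable]: "g \<in> borel_measurable borel" using g by (rule logconc_measurable)
  have U: "open U" "convex U" "U \<subseteq> {x. 0 < g x}"
    unfolding U_def using logconc_concave(1)[OF g] interior_subset[of "{x. 0 < g x}"]
    by (auto intro: convex_interior)
  hence [measurable]: "U \<in> sets borel" by simp
  have wmeas [measurable]: "w \<in> borel_measurable borel"
    unfolding w_def by measurable
  have g0: "0 \<le> g x" for x by (rule logconc_nonneg[OF g])
  have w0: "0 \<le> w x" for x using g0 Z by (simp add: w_def)
  have "frontier {x. 0 < g x} \<in> null_sets lebesgue"
    using negligible_convex_frontier[OF logconc_concave(1)[OF g]]
    by (simp add: negligible_iff_null_sets)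
  hence "frontier {x. 0 < g x} \<in> null_sets lborel"
    by (simp add: null_sets_completion_iff)
  hence AEU: "AE x in lborel. g x = 0 \<or> x \<in> U"
  proof (rule AE_I', intro subsetI)
    fix x assume "x \<in> {x \<in> space lborel. \<not> (g x = 0 \<or> x \<in> U)}"
    with g0[of x] show "x \<in> frontier {x. 0 < g x}"
      using closure_subset[of "{x. 0 < g x}"] by (auto simp: frontier_def U_def)
  qed
  have "integrable lborel (\<lambda>x. std_normal_density x * g x)"
    using logconc_integrable[OF g] by (subst (asm) std_normal_integrable_iff) auto
  hence int: "integrable lborel (\<lambda>x. std_normal_density x * g x / Z)" by simp
  have mass: "(\<integral>\<^sup>+x. ennreal (w x) \<partial>lborel) = 1"
  proof -
    have "(\<integral>\<^sup>+x. ennreal (w x) \<partial>lborel) = (\<integral>\<^sup>+x. ennreal (std_normal_density x * g x / Z) \<partial>lborel)"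
      by (rule nn_integral_cong_AE, rule AE_mp[OF AEU]) (auto simp: w_def indicator_def mult.commute)
    also have "\<dots> = ennreal (LINT x|lborel. std_normal_density x * g x / Z)"
      using g0 Z by (intro nn_integral_eq_integral int) auto
    also have "(LINT x|lborel. std_normal_density x * g x / Z) = Z / Z"
      by (simp add: Z_def std_normal_integral)
    finally show ?thesis using Z by simp
  qed
  have "continuous_on U (\<lambda>x. - ln (g x))"
    using convex_on_subset[OF logconc_concave(2)[OF g] U(3) U(2)] U by (intro convex_on_continuous) auto
  hence "continuous_on U (\<lambda>x. exp (- (- ln (g x))))"
    by (rule continuous_on_exp[OF continuous_on_minus])
  moreover have "exp (- (- ln (g x))) = g x" if "x \<in> U" for x using that U by auto
  ultimately have gcont: "continuous_on U g" by (rule continuous_on_eq)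
  have "continuous_on U (\<lambda>x. g x * std_normal_density x / Z)"
    unfolding std_normal_density_def using Z by (intro continuous_intros gcont) auto
  hence wcont: "continuous_on U w"
    by (rule continuous_on_eq) (simp add: w_def)
  have wU: "w x = g x * std_normal_density x / Z" "0 < w x" if "x \<in> U" for x
    using that U Z std_normal_density_pos[of x] by (auto simp: w_def)
  have wnU: "w x = 0" if "x \<notin> U" for x using that by (simp add: w_def)
  note P = cdf_density_properties[OF wmeas w0 mass U(1,2) wcont wU(2) wnU, folded F_def]
  note N = std_normal_cdf_props[folded G_def]
  have injF: "inj_on F U"
    using P(2) by (intro inj_onI) (metis less_irrefl linorder_neqE_linordered_idom)
  define T where "T = (\<lambda>x. inv_into U F (G x))"
  define T' where "T' = (\<lambda>x. std_normal_density x / w (T x))"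
  have GF: "G x \<in> F ` U" for x using P(3)[of "G x"] N(2,3)[of x] by (metis imageI)
  have TU: "T x \<in> U" for x unfolding T_def by (rule inv_into_into[OF GF])
  have FT: "F (T x) = G x" for x unfolding T_def by (rule f_inv_into_f[OF GF])
  have Fcont: "continuous_on U F"
    using P(1) by (intro continuous_at_imp_continuous_on ballI DERIV_isCont) blast
  have DT: "(T has_real_derivative T' x) (at x)" for x
  proof -
    have "(F has_derivative (*) (w (T x))) (at (T x))"
      using P(1)[of "T x"] TU by (simp add: has_field_derivative_def)
    hence "(inv_into U F has_derivative (*) (inverse (w (T x)))) (at (F (T x)))"
      using wU(2)[OF TU, of x] U(1) TU Fcont injF
      by (intro has_derivative_inverse_strong[where S = U and f = F]) (auto simp: fun_eq_iff)
    hence "(inv_into U F has_real_derivative inverse (w (T x))) (at (F (T x)))"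
      by (simp add: has_field_derivative_def)
    hence "(inv_into U F has_real_derivative inverse (w (T x))) (at (G x))"
      by (simp add: FT)
    from DERIV_chain2[OF this N(1)]
    show ?thesis by (simp add: T_def[symmetric] T'_def field_simps)
  qed
  have Tcont: "continuous_on UNIV T"
    using DT by (intro continuous_at_imp_continuous_on ballI DERIV_isCont) blast
  have T'cont: "continuous_on UNIV T'"
  proof -
    have "continuous_on UNIV (w \<circ> T)"
      using TU by (intro continuous_on_compose Tcont continuous_on_subset[OF wcont]) auto
    moreover have "w (T x) \<noteq> 0" for x using wU(2)[OF TU, of x] by simp
    ultimately show ?thesis
      unfolding T'_def std_normal_density_def
      by (intro continuous_on_divide continuous_intros) (auto simp: o_def)
  qed
  have T'pos: "0 < T' x" for x
    unfolding T'_def using wU(2)[OF TU[of x]] std_normal_density_pos by simp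
  \<comment> \<open>After translating \<open>T x\<close> to \<open>x\<close>, the logarithm of the ratio of the two densities is concave. If it
    were negative at \<open>x\<close>, it would be negative on one side of \<open>x\<close>, but both measures give that side the
    same mass.\<close>
  have T'le: "T' x \<le> 1" for x
  proof (rule ccontr)
    assume "\<not> T' x \<le> 1"
    define q where "q = T x"
    have q: "q \<in> U" by (simp add: q_def TU)
    have wq: "w q < std_normal_density x"
      using \<open>\<not> T' x \<le> 1\<close> wU(2)[OF q] by (simp add: T'_def q_def field_simps)
    \<comment> \<open>This is the value that \<open>ln (g q)\<close> would have if the two densities
      agreed, that is, if \<open>T' x\<close> were 1.\<close>
    define A where "A = ln Z + q\<^sup>2 / 2 - x\<^sup>2 / 2"
    have gq: "0 < g q" using q U by auto
    have lq: "ln (g q) < A"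
    proof -
      have "ln (w q) < ln (std_normal_density x)" using wq wU(2)[OF q] by simp
      also have "ln (w q) = ln (g q) + ln (std_normal_density q) - ln Z"
        using gq Z std_normal_density_pos[of q] by (simp add: wU(1)[OF q] ln_mult ln_div)
      finally show ?thesis by (simp add: A_def ln_std_normal_density)
    qed
    \<comment> \<open>The quadratic terms in \<open>z\<close> cancel, so that comparing the two
      densities means comparing the concave function \<open>ln (g (q + z))\<close> with an affine
      function of \<open>z\<close>.\<close>
    have big: "0 < g (q + z) \<and> A + z * (q - x) \<le> ln (g (q + z))"
      if "std_normal_density (x + z) \<le> w (q + z)" for z
    proof -
      have "0 < w (q + z)" using that std_normal_density_pos[of "x + z"] by linarith
      hence qz: "q + z \<in> U" using wnU by force
      hence gp: "0 < g (q + z)" using U by auto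
      have "ln (std_normal_density (x + z)) \<le> ln (w (q + z))"
        using that std_normal_density_pos[of "x + z"] by simp
      also have "ln (w (q + z)) = ln (g (q + z)) + ln (std_normal_density (q + z)) - ln Z"
        using gp Z std_normal_density_pos[of "q + z"] by (simp add: wU(1)[OF qz] ln_mult ln_div)
      finally have "ln Z + (q + z)\<^sup>2 / 2 - (x + z)\<^sup>2 / 2 \<le> ln (g (q + z))"
        by (simp add: ln_std_normal_density)
      moreover have "ln Z + (q + z)\<^sup>2 / 2 - (x + z)\<^sup>2 / 2 = A + z * (q - x)"
        by (simp add: A_def power2_eq_square field_simps)
      ultimately show ?thesis using gp by simp
    qed
    have "(\<forall>z>0. w (q + z) < std_normal_density (x + z)) \<or> (\<forall>z<0. w (q + z) < std_normal_density (x + z))"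
    proof (rule ccontr)
      assume "\<not> ?thesis"
      then obtain z y where zy: "0 < z" "y < 0"
        and "std_normal_density (x + z) \<le> w (q + z)" "std_normal_density (x + y) \<le> w (q + y)"
        by (auto simp: not_less)
      hence b: "0 < g (q + z)" "A + z * (q - x) \<le> ln (g (q + z))"
        "0 < g (q + y)" "A + y * (q - x) \<le> ln (g (q + y))" using big by auto
      have "(z - y) * A = z * (A + y * (q - x)) + (- y) * (A + z * (q - x))"
        by (simp add: algebra_simps)
      also have "\<dots> \<le> z * ln (g (q + y)) + (- y) * ln (g (q + z))"
        using zy b by (intro add_mono mult_left_mono) auto
      also have "\<dots> \<le> (z - y) * ln (g q)"
        using logconc_three_points[OF g, of "q + y" q "q + z"] zy b by (simp add: algebra_simps)
      finally show False using lq zy by simp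
    qed
    moreover
    have shift: "integrable lborel (\<lambda>z. f (c + z))" "(LINT z|lborel. f (c + z)) = integral\<^sup>L lborel f"
      if "integrable lborel f" for f :: "real \<Rightarrow> real" and c
      using lborel_integrable_real_affine[OF that, of 1 c] lborel_integral_real_affine[of 1 f c] by auto
    have wint: "integrable lborel w"
      using mass w0 by (intro integrableI_nonneg) auto
    have intw: "integral\<^sup>L lborel w = 1"
      using nn_integral_eq_integral[OF wint] w0 mass by simp
    \<comment> \<open>The interval \<open>{l..u}\<close> guarantees that \<open>B\<close> has
      positive measure, which makes the inequality strict.\<close>
    have less: "(LINT z|lborel. indicator B z * w (q + z)) < (LINT z|lborel. indicator B z * std_normal_density (x + z))"
      if B: "\<And>z. z \<in> B \<Longrightarrow> w (q + z) < std_normal_density (x + z)" "B \<in> sets borel"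
        and lu: "{l..u} \<subseteq> B" "l < u" for B l u
    proof (rule ccontr)
      define f where "f = (\<lambda>z. indicator B z * std_normal_density (x + z) - indicator B z * w (q + z))"
      have i: "integrable lborel (\<lambda>z. indicator B z * w (q + z))"
        "integrable lborel (\<lambda>z. indicator B z * std_normal_density (x + z))"
        using integrable_mult_indicator[OF _ shift(1)[OF wint, of q], of B] B(2)
          integrable_mult_indicator[OF _ shift(1)[OF integrable_normal_density[of 1 0], of x], of B]
        by simp_all
      hence fi: "integrable lborel f" by (simp add: f_def)
      have f0: "0 \<le> f z" for z using B(1)[of z] by (auto simp: f_def indicator_def)
      assume "\<not> ?thesis"
      hence "integral\<^sup>L lborel f \<le> 0" unfolding f_def using i by simp
      moreover have "0 \<le> integral\<^sup>L lborel f" using f0 by simp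
      ultimately have "AE z in lborel. f z = 0"
        using integral_nonneg_eq_0_iff_AE[OF fi] f0 by simp
      hence "AE z in lborel. z \<notin> {l..u}"
        by eventually_elim (use B lu in \<open>force simp: f_def\<close>)
      hence "emeasure lborel {l..u} = 0"
        by (subst (asm) AE_iff_measurable[of "{l..u}"]) auto
      thus False using lu(2) by simp
    qed
    have left: "(LINT z|lborel. indicator {..<0} z * f (c + z)) = (LINT t:{..c}|lborel. f t)"
      if f: "integrable lborel f" for f :: "real \<Rightarrow> real" and c
    proof -
      have "integrable lborel (\<lambda>t. indicator {..c} t * f t)"
        using integrable_mult_indicator[OF _ f, of "{..c}"] by simp
      from shift(2)[OF this, of c]
      have "(LINT t:{..c}|lborel. f t) = (LINT z|lborel. indicator {..c} (c + z) * f (c + z))"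
        by (simp add: set_lebesgue_integral_def)
      also have "\<dots> = (LINT z|lborel. indicator {..<0} z * f (c + z))"
        using f shift(1)[OF f, of c, THEN borel_measurable_integrable]
        by (intro integral_cong_AE) (auto intro: AE_mp[OF AE_lborel_singleton[of 0]] simp: indicator_def)
      finally show ?thesis by simp
    qed
    have right: "(LINT z|lborel. indicator {0<..} z * f (c + z)) = integral\<^sup>L lborel f - (LINT t:{..c}|lborel. f t)"
      if f: "integrable lborel f" for f :: "real \<Rightarrow> real" and c
    proof -
      have "integral\<^sup>L lborel f = (LINT z|lborel. f (c + z))" by (simp add: shift(2)[OF f])
      also have "\<dots> = (LINT z|lborel. indicator {0<..} z * f (c + z) + indicator {..<0} z * f (c + z))"
        using shift(1)[OF f, of c, THEN borel_measurable_integrable]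
        by (intro integral_cong_AE) (auto intro: AE_mp[OF AE_lborel_singleton[of 0]] simp: indicator_def)
      also have "\<dots> = (LINT z|lborel. indicator {0<..} z * f (c + z)) + (LINT z|lborel. indicator {..<0} z * f (c + z))"
        using integrable_mult_indicator[OF _ shift(1)[OF f, of c], of "{0<..}"]
          integrable_mult_indicator[OF _ shift(1)[OF f, of c], of "{..<0}"]
        by (intro Bochner_Integration.integral_add) auto
      finally show ?thesis by (simp add: left[OF f])
    qed
    have eq: "(LINT t:{..q}|lborel. w t) = (LINT t:{..x}|lborel. std_normal_density t)"
      using FT[of x] by (simp add: P(5)[symmetric] N(4)[symmetric] q_def)
    ultimately show False
    proof (elim disjE)
      assume "\<forall>z>0. w (q + z) < std_normal_density (x + z)"
      hence "(LINT z|lborel. indicator {0<..} z * w (q + z)) < (LINT z|lborel. indicator {0<..} z * std_normal_density (x + z))"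
        by (intro less[of _ 1 2]) auto
      thus False using eq by (simp add: right[OF wint] right[OF integrable_normal_density] intw)
    next
      assume "\<forall>z<0. w (q + z) < std_normal_density (x + z)"
      hence "(LINT z|lborel. indicator {..<0} z * w (q + z)) < (LINT z|lborel. indicator {..<0} z * std_normal_density (x + z))"
        by (intro less[of _ "-2" "-1"]) auto
      thus False using eq by (simp add: left[OF wint] left[OF integrable_normal_density])
    qed
  qed
  have ln_g: "ln (g (T x)) = ln Z + (T x)\<^sup>2 / 2 - x\<^sup>2 / 2 - ln (T' x)" for x
  proof -
    have gp: "0 < g (T x)" using TU U by auto
    have "ln (T' x) = ln (std_normal_density x) - ln (w (T x))"
      using wU(2)[OF TU[of x]] std_normal_density_pos[of x] by (simp add: T'_def ln_div)
    also have "ln (w (T x)) = ln (g (T x)) + ln (std_normal_density (T x)) - ln Z"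
      using gp Z std_normal_density_pos[of "T x"] by (simp add: wU(1)[OF TU] ln_mult ln_div)
    finally show ?thesis by (simp add: ln_std_normal_density)
  qed
  show ?thesis
    by (rule that[of T T']) (use DT T'cont T'pos T'le ln_g TU U(3) Z_def in blast)+
qed

section \<open>Gaussian integration by parts\<close>

lemma lipschitz_linear_growth:
  fixes D :: "real \<Rightarrow> real"
  assumes "\<And>x. (D has_real_derivative D' x) (at x)" "\<And>x. \<bar>D' x\<bar> \<le> 1"
  shows "\<bar>D x\<bar> \<le> \<bar>D 0\<bar> + \<bar>x\<bar>"
proof -
  have "norm (D x - D 0) \<le> 1 * norm (x - 0)"
    by (rule field_differentiable_bound[of UNIV D D']) (use assms in auto)
  thus ?thesis by simp
qed

lemma std_normal_integrable_quadratic: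
  fixes f :: "real \<Rightarrow> real"
  assumes "f \<in> borel_measurable borel" "\<And>x. \<bar>f x\<bar> \<le> A + B * x\<^sup>2"
  shows "integrable std_normal_distribution f"
proof (rule Bochner_Integration.integrable_bound)
  have "integrable std_normal_distribution (\<lambda>x. A * x ^ 0 + B * x\<^sup>2)"
    by (intro Bochner_Integration.integrable_add integrable_mult_right
        integrable_std_normal_distribution_moment)
  thus "integrable std_normal_distribution (\<lambda>x. A + B * x\<^sup>2)" by simp
  show "AE x in std_normal_distribution. norm (f x) \<le> norm (A + B * x\<^sup>2)"
    using assms(2) by (intro AE_I2) (auto intro: order_trans abs_ge_self)
qed (use assms in simp)

lemma abs_le_one_plus_square: "\<bar>x\<bar> \<le> 1 + (x::real)\<^sup>2"
  using zero_le_power2[of "\<bar>x\<bar> - 1/2"] by (simp add: power2_eq_square algebra_simps)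

text \<open>With the density as factor, the difference of the two integrands is the derivative of
  \<open>- (D x * std_normal_density x)\<close>. A bounded derivative allows at most linear growth
  of \<open>D\<close>, so this product vanishes at both ends. For the displacement of a transport
  map it says that \<open>x * u x + v x\<close> has mean zero.\<close>

lemma std_normal_integration_by_parts:
  fixes D :: "real \<Rightarrow> real"
  assumes D: "\<And>x. (D has_real_derivative D' x) (at x)" and cont: "continuous_on UNIV D'"
    and bd: "\<And>x. \<bar>D' x\<bar> \<le> 1"
  shows "integrable std_normal_distribution (\<lambda>x. x * D x)"
    and "integrable std_normal_distribution D'"
    and "integrable std_normal_distribution (\<lambda>x. (D x)\<^sup>2)"
    and "(LINT x|std_normal_distribution. x * D x) = (LINT x|std_normal_distribution. D' x)"
proof -
  have growth: "\<bar>D x\<bar> \<le> \<bar>D 0\<bar> + \<bar>x\<bar>" for x by (rule lipschitz_linear_growth) fact+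
  have contD: "continuous_on UNIV D"
    using D by (intro continuous_at_imp_continuous_on ballI DERIV_isCont) blast
  have [measurable]: "D \<in> borel_measurable borel" "D' \<in> borel_measurable borel"
    using contD cont by (auto intro: borel_measurable_continuous_onI)
  show i1: "integrable std_normal_distribution (\<lambda>x. x * D x)"
  proof (rule std_normal_integrable_quadratic[where A = "\<bar>D 0\<bar>" and B = "\<bar>D 0\<bar> + 1"])
    fix x
    have "\<bar>x * D x\<bar> \<le> \<bar>x\<bar> * (\<bar>D 0\<bar> + \<bar>x\<bar>)" using growth[of x] by (simp add: abs_mult mult_left_mono)
    also have "\<dots> = \<bar>D 0\<bar> * \<bar>x\<bar> + x\<^sup>2" by (simp add: algebra_simps power2_eq_square)
    also have "\<dots> \<le> \<bar>D 0\<bar> * (1 + x\<^sup>2) + x\<^sup>2"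
      by (intro add_mono mult_left_mono abs_le_one_plus_square) auto
    finally show "\<bar>x * D x\<bar> \<le> \<bar>D 0\<bar> + (\<bar>D 0\<bar> + 1) * x\<^sup>2" by (simp add: algebra_simps)
  qed simp
  show i2: "integrable std_normal_distribution D'"
    using bd by (intro std_normal_integrable_quadratic[where A = 1 and B = 0]) auto
  show "integrable std_normal_distribution (\<lambda>x. (D x)\<^sup>2)"
  proof (rule std_normal_integrable_quadratic[where A = "2 * \<bar>D 0\<bar>\<^sup>2" and B = 2])
    fix x
    have "(D x)\<^sup>2 \<le> (\<bar>D 0\<bar> + \<bar>x\<bar>)\<^sup>2" using growth[of x] by (simp add: abs_le_square_iff[symmetric])
    also have "\<dots> \<le> 2 * \<bar>D 0\<bar>\<^sup>2 + 2 * \<bar>x\<bar>\<^sup>2"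
      using zero_le_power2[of "\<bar>D 0\<bar> - \<bar>x\<bar>"] by (simp add: power2_eq_square algebra_simps)
    finally show "\<bar>(D x)\<^sup>2\<bar> \<le> 2 * \<bar>D 0\<bar>\<^sup>2 + 2 * x\<^sup>2" by simp
  qed simp
  define f where "f = (\<lambda>x. x * D x * std_normal_density x - D' x * std_normal_density x)"
  define F where "F = (\<lambda>x. - (D x * std_normal_density x))"
  have dF: "(F has_real_derivative f x) (at x)" for x
    unfolding F_def f_def std_normal_density_def
    by (rule derivative_eq_intros D refl | simp add: power2_eq_square field_simps)+
  have int: "integrable lborel (\<lambda>x. x * D x * std_normal_density x)"
    "integrable lborel (\<lambda>x. D' x * std_normal_density x)"
    using i1 i2 by (simp_all add: std_normal_integrable_iff mult.commute mult.left_commute)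
  have lim: "((\<lambda>x. (\<bar>D 0\<bar> + \<bar>x\<bar>) * std_normal_density x) \<longlongrightarrow> 0) at_top"
    "((\<lambda>x. (\<bar>D 0\<bar> + \<bar>x\<bar>) * std_normal_density x) \<longlongrightarrow> 0) at_bot"
    unfolding std_normal_density_def by real_asymp+
  have bF: "\<bar>F x\<bar> \<le> (\<bar>D 0\<bar> + \<bar>x\<bar>) * std_normal_density x" for x
    unfolding F_def using growth[of x] by (simp add: abs_mult mult_right_mono)
  have F0: "(F \<longlongrightarrow> 0) at_top" "(F \<longlongrightarrow> 0) at_bot"
    by (rule Lim_null_comparison[OF _ lim(1)] Lim_null_comparison[OF _ lim(2)],
        rule always_eventually, simp add: bF)+
  have "(LBINT x=-\<infinity>..\<infinity>. f x) = 0 - 0"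
  proof (rule interval_integral_FTC_integrable[where F = F])
    show "(F has_vector_derivative f x) (at x)" for x
      using dF by (simp add: has_real_derivative_iff_has_vector_derivative)
    show "isCont f x" for x
      using contD cont unfolding f_def std_normal_density_def
      by (auto simp: continuous_on_eq_continuous_at intro!: continuous_intros)
    show "set_integrable lborel (einterval (- \<infinity>) \<infinity>) f"
      using int by (simp add: f_def set_integrable_def)
    show "((F \<circ> real_of_ereal) \<longlongrightarrow> 0) (at_right (- \<infinity>))" "((F \<circ> real_of_ereal) \<longlongrightarrow> 0) (at_left \<infinity>)"
      using F0 by (simp_all add: ereal_tendsto_simps)
  qed auto
  hence "integral\<^sup>L lborel f = 0" by (simp add: interval_lebesgue_integral_def set_lebesgue_integral_def)
  thus "(LINT x|std_normal_distribution. x * D x) = (LINT x|std_normal_distribution. D' x)"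
    using int by (simp add: f_def std_normal_integral mult.commute mult.left_commute)
qed

lemma AE_std_normal_iff: "(AE x in std_normal_distribution. P x) \<longleftrightarrow> (AE x in lborel. P x)"
  using std_normal_density_pos by (subst AE_density) auto

text \<open>The Gaussian measure charges every nonempty open set.\<close>

lemma AE_continuous_zero:
  fixes f :: "real \<Rightarrow> real"
  assumes "continuous_on UNIV f" "AE x in std_normal_distribution. f x = 0"
  shows "f x = 0"
proof (rule ccontr)
  assume "f x \<noteq> 0"
  define S where "S = f -` (- {0})"
  have "open S" unfolding S_def using assms(1) by (intro continuous_open_vimage) (auto simp: continuous_on_eq_continuous_at)
  moreover have "x \<in> S" using \<open>f x \<noteq> 0\<close> by (simp add: S_def)
  ultimately have "\<not> negligible S" by (metis empty_iff open_not_negligible)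
  moreover have "AE x in lborel. x \<notin> S"
    using assms(2) unfolding AE_std_normal_iff by eventually_elim (simp add: S_def)
  hence "S \<in> null_sets lborel"
    using \<open>open S\<close> by (subst (asm) AE_iff_null_sets[symmetric]) auto
  hence "negligible S"
    by (simp add: negligible_iff_null_sets null_sets_completionI)
  ultimately show False by simp
qed

lemma logconc_continuous:
  fixes g :: "real \<Rightarrow> real"
  assumes "logconc g" "\<And>x. 0 < g x"
  shows "continuous_on UNIV g"
proof -
  have "{x. 0 < g x} = UNIV" using assms by auto
  hence "continuous_on UNIV (\<lambda>x. - ln (g x))"
    using logconc_concave(2)[OF assms(1)] by (intro convex_on_continuous) auto
  hence "continuous_on UNIV (\<lambda>x. exp (- (- ln (g x))))"
    by (rule continuous_on_exp[OF continuous_on_minus])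
  thus ?thesis using assms(2) by simp
qed

text \<open>
  The transport map is written as \<open>x \<mapsto> x + u x\<close> with \<open>u' = - v\<close>; the bounds \<open>0 \<le> v < 1\<close> say that
  it is an increasing contraction.
\<close>
lemma logconc_transport_displacement:
  fixes g :: "real \<Rightarrow> real"
  defines "h \<equiv> \<lambda>v. - v - ln (1 - v) :: real"
  assumes g: "logconc g" and Zpos: "0 < (LINT x|std_normal_distribution. g x)"
  obtains u v :: "real \<Rightarrow> real"
  where "\<And>x. (u has_real_derivative - v x) (at x)" "continuous_on UNIV v"
    "\<And>x. 0 \<le> v x" "\<And>x. v x < 1" "\<And>x. 0 < g (x + u x)"
    "\<And>x. ln (g (x + u x)) = ln (LINT x|std_normal_distribution. g x)
        + (x * u x + v x) + ((u x)\<^sup>2 / 2 + h (v x))"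
    "integrable std_normal_distribution (\<lambda>x. (u x)\<^sup>2 / 2 + h (v x))"
    "integrable std_normal_distribution (\<lambda>x. x * u x + v x)"
    "(LINT x|std_normal_distribution. x * u x + v x) = 0"
proof -
  obtain T T' where T: "\<And>x. (T has_real_derivative T' x) (at x)" "continuous_on UNIV T'"
    "\<And>x. 0 < T' x" "\<And>x. T' x \<le> 1" "\<And>x. 0 < g (T x)"
    "\<And>x. ln (g (T x)) = ln (LINT x|std_normal_distribution. g x) + (T x)\<^sup>2 / 2 - x\<^sup>2 / 2 - ln (T' x)"
    using logconc_transport[OF g Zpos] by blast
  define Z where "Z = (LINT x|std_normal_distribution. g x)"
  define u where "u = (\<lambda>x. T x - x)"
  define v where "v = (\<lambda>x. 1 - T' x)"
  have u: "(u has_real_derivative - v x) (at x)" for x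
    unfolding u_def v_def by (auto intro!: derivative_eq_intros T(1))
  have v: "0 \<le> v x" "v x < 1" for x using T(3,4)[of x] by (auto simp: v_def)
  have vc: "continuous_on UNIV v" unfolding v_def by (intro continuous_intros T)
  have Tu: "T x = x + u x" for x by (simp add: u_def)
  have eq: "ln (g (x + u x)) = ln Z + (x * u x + v x) + ((u x)\<^sup>2 / 2 + h (v x))" for x
    using T(6)[of x] unfolding Tu Z_def[symmetric] h_def by (simp add: v_def power2_eq_square field_simps)
  have vb: "\<bar>- v x\<bar> \<le> 1" for x using v[of x] by simp
  note ibp = std_normal_integration_by_parts[OF u continuous_on_minus[OF vc] vb]
  have iv: "integrable std_normal_distribution v"
    using ibp(2) by simp
  have uc: "continuous_on UNIV u"
    using u by (intro continuous_at_imp_continuous_on ballI DERIV_isCont) blast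
  have [measurable]: "u \<in> borel_measurable borel" "v \<in> borel_measurable borel"
    using uc vc by (auto intro: borel_measurable_continuous_onI)
  have ih: "integrable std_normal_distribution (\<lambda>x. h (v x))"
  proof -
    obtain C k where Ck: "\<And>x. g x \<le> C * exp (k * \<bar>x\<bar>)" "0 \<le> C" "0 \<le> k"
      using logconc_growth[OF g] by blast
    have "C \<noteq> 0" using Ck(1)[of "T 0"] T(5)[of 0] by auto
    hence C: "0 < C" using Ck by simp
    \<comment> \<open>The singularity of \<open>h\<close> at 1 is controlled indirectly: the
      transport identity is solved for \<open>h (v x)\<close>, and \<open>ln g\<close> grows at most
      linearly.\<close>
    have up: "h (v x) \<le> (\<bar>ln C\<bar> + k + \<bar>ln Z\<bar> + k * \<bar>u 0\<bar>) + 2 * k * \<bar>x\<bar> + \<bar>x * u x\<bar>" for x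
    proof -
      have "ln (g (x + u x)) \<le> ln (C * exp (k * \<bar>x + u x\<bar>))"
        using Ck(1)[of "x + u x"] T(5)[of x] C by (simp add: Tu)
      also have "\<dots> = ln C + k * \<bar>x + u x\<bar>" using C by (simp add: ln_mult)
      finally have "h (v x) \<le> ln C + k * \<bar>x + u x\<bar> - ln Z - x * u x - v x - (u x)\<^sup>2 / 2"
        by (simp add: eq)
      moreover have "k * \<bar>x + u x\<bar> \<le> k * (\<bar>u 0\<bar> + 2 * \<bar>x\<bar>)"
        using lipschitz_linear_growth[OF u vb, of x] Ck by (intro mult_left_mono) auto
      moreover have "0 \<le> (u x)\<^sup>2 / 2" by simp
      moreover have "- (x * u x) \<le> \<bar>x * u x\<bar>" "- ln Z \<le> \<bar>ln Z\<bar>" "ln C \<le> \<bar>ln C\<bar>" by auto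
      moreover have "k * (\<bar>u 0\<bar> + 2 * \<bar>x\<bar>) = k * \<bar>u 0\<bar> + 2 * k * \<bar>x\<bar>" by (simp add: algebra_simps)
      ultimately show ?thesis using v(1)[of x] Ck(3) by linarith
    qed
    have lo: "0 \<le> h (v x)" for x
      using ln_add_one_self_le_self2[of "- v x"] v[of x] by (simp add: h_def)
    have ix: "integrable std_normal_distribution (\<lambda>x. \<bar>x\<bar>)"
      using integrable_std_normal_distribution_moment[of 1] by simp
    have "integrable std_normal_distribution
        (\<lambda>x. (\<bar>ln C\<bar> + k + \<bar>ln Z\<bar> + k * \<bar>u 0\<bar>) * x ^ 0 + 2 * k * \<bar>x\<bar> + \<bar>x * u x\<bar>)"
      by (intro Bochner_Integration.integrable_add integrable_mult_right integrable_abs ix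
          integrable_std_normal_distribution_moment ibp)
    thus ?thesis
    proof (rule Bochner_Integration.integrable_bound)
      show "(\<lambda>x. h (v x)) \<in> borel_measurable std_normal_distribution"
        unfolding h_def by measurable
    qed (use up lo in \<open>auto intro!: AE_I2 order_trans[OF up abs_ge_self]\<close>)
  qed
  show ?thesis
  proof (rule that[of u v])
    show "integrable std_normal_distribution (\<lambda>x. (u x)\<^sup>2 / 2 + h (v x))"
      using ibp(3) ih by simp
    show "integrable std_normal_distribution (\<lambda>x. x * u x + v x)"
      using ibp(1) iv by simp
    show "(LINT x|std_normal_distribution. x * u x + v x) = 0"
      using ibp(1,4) iv by simp
  qed (use u vc v T(5) eq Tu Z_def in \<open>auto simp del: add_uminus_conv_diff\<close>)
qed

section \<open>The one-dimensional inequality\<close>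

text \<open>With the exponent \<open>1 / a\<close> this is the Lebesgue norm of exponent
  \<open>a\<close> (only a quasi-norm for \<open>a < 1\<close>), so that integrating out the
  coordinates one after the other composes to the mean over all of them.\<close>

definition gauss_mean :: "real \<Rightarrow> (real \<Rightarrow> real) \<Rightarrow> real" where
  "gauss_mean a g = (LINT x|std_normal_distribution. g x powr a) powr (1 / a)"

text \<open>The change of variables gives the integral of \<open>f\<close> over the range of
  \<open>T\<close>. The range may be a proper interval, and the nonnegative \<open>f\<close> can
  only gain outside of it.\<close>

lemma integral_transport_le:
  fixes f T :: "real \<Rightarrow> real"
  assumes T: "\<And>x. (T has_real_derivative T' x) (at x)" and pos: "\<And>x. 0 < T' x"
    and f: "integrable lborel f" "\<And>x. 0 \<le> f x"
    and e: "e \<in> borel_measurable borel" "\<And>x. 0 \<le> e x" "\<And>x. e x \<le> T' x * f (T x)"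
  shows "integrable lborel e" "integral\<^sup>L lborel e \<le> integral\<^sup>L lborel f"
proof -
  have "strict_mono T"
  proof (rule strict_monoI)
    fix x y :: real assume "x < y"
    thus "T x < T y" by (rule DERIV_pos_imp_increasing) (use T pos in blast)
  qed
  hence inj: "inj T" by (rule strict_mono_imp_inj_on)
  have Tc: "continuous_on UNIV T"
    using T by (meson DERIV_isCont continuous_at_imp_continuous_on)
  have "is_interval (T ` UNIV)"
    using Tc by (simp add: is_interval_connected_1 connected_continuous_image)
  hence R: "range T \<in> sets borel" by (rule real_interval_borel_measurable)
  have fa: "f absolutely_integrable_on UNIV"
    using f by (simp add: integrable_completion absolutely_integrable_on_def set_integrable_def)
    have fR: "f absolutely_integrable_on range T"
    using set_integrable_subset[OF fa, of "range T"] R by simp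
  have "(\<lambda>x. \<bar>T' x\<bar> * f (T x)) absolutely_integrable_on UNIV \<and>
      integral UNIV (\<lambda>x. \<bar>T' x\<bar> * f (T x)) = integral (range T) f"
    using has_absolute_integral_change_of_variables_1'[of UNIV T T' f "integral (range T) f"] T inj fR
    by auto
  moreover have "\<bar>T' x\<bar> = T' x" for x using pos[of x] by simp
  ultimately have Tf: "(\<lambda>x. T' x * f (T x)) absolutely_integrable_on UNIV"
    "integral UNIV (\<lambda>x. T' x * f (T x)) = integral (range T) f" by simp_all
  have Tfi: "integrable lebesgue (\<lambda>x. T' x * f (T x))"
    using Tf(1) by (simp add: set_integrable_def)
  have ei: "integrable lebesgue e"
    by (rule Bochner_Integration.integrable_bound[OF Tfi])
       (use e in \<open>auto intro!: AE_I2 measurable_completion order_trans[OF _ abs_ge_self]\<close>)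
  thus "integrable lborel e" using e(1) by (simp add: integrable_completion)
  have "integral\<^sup>L lborel e = integral\<^sup>L lebesgue e"
    using e(1) by (simp add: integral_completion)
  also have "\<dots> \<le> (LINT x|lebesgue. T' x * f (T x))"
    by (rule integral_mono[OF ei Tfi e(3)])
  also have "\<dots> = integral (range T) f"
    using set_lebesgue_integral_eq_integral(2)[OF Tf(1)] Tf(2)
    by (simp add: set_lebesgue_integral_def)
  also have "\<dots> = (LINT x:range T|lebesgue. f x)"
    using set_lebesgue_integral_eq_integral(2)[OF fR] by simp
  also have "\<dots> \<le> (LINT x|lebesgue. f x)"
    unfolding set_lebesgue_integral_def
    using fR fa f(2) by (intro integral_mono) (auto simp: set_integrable_def indicator_def)
  also have "\<dots> = integral\<^sup>L lborel f"
    using borel_measurable_integrable[OF f(1)] by (simp add: integral_completion)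
  finally show "integral\<^sup>L lborel e \<le> integral\<^sup>L lborel f" .
qed

lemma prekopa_1d:
  fixes g0 g1 g :: "real \<Rightarrow> real"
  assumes g: "logconc g0" "logconc g1" "logconc g"
    and pq: "0 < p" "0 < q" "p + q = 1" and ab: "0 < a" "0 < b"
    and le: "\<And>x y. g0 x powr p * g1 y powr q \<le> g (p * x + q * y)"
  shows "gauss_mean a g0 powr p * gauss_mean b g1 powr q \<le> gauss_mean (p * a + q * b) g"
    and "gauss_mean a g0 powr p * gauss_mean b g1 powr q = gauss_mean (p * a + q * b) g \<Longrightarrow>
      0 < gauss_mean a g0 \<Longrightarrow> 0 < gauss_mean b g1 \<Longrightarrow> a \<noteq> b \<Longrightarrow>
      \<exists>k d0 d1. \<forall>x. g0 x = exp (k * x + d0) \<and> g1 x = exp (k * x + d1)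
        \<and> g x = exp (k * x + (p * d0 + q * d1))"
proof -
  define c where "c = p * a + q * b"
  have c: "0 < c" using pq ab by (simp add: c_def add_pos_pos)
  define Z0 Z1 Z where "Z0 = (LINT x|std_normal_distribution. g0 x powr a)"
    and "Z1 = (LINT x|std_normal_distribution. g1 x powr b)"
    and "Z = (LINT x|std_normal_distribution. g x powr c)"
  have Z_nonneg: "0 \<le> Z0" "0 \<le> Z1" "0 \<le> Z" by (simp_all add: Z0_def Z1_def Z_def)
  have means: "gauss_mean a g0 = Z0 powr (1 / a)" "gauss_mean b g1 = Z1 powr (1 / b)"
    "gauss_mean (p * a + q * b) g = Z powr (1 / c)"
    by (simp_all add: gauss_mean_def Z0_def Z1_def Z_def c_def)
  have main: "p / a * ln Z0 + q / b * ln Z1 \<le> 1 / c * ln Z \<and> 0 < Z \<and>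
      (p / a * ln Z0 + q / b * ln Z1 = 1 / c * ln Z \<longrightarrow> a \<noteq> b \<longrightarrow>
       (\<exists>k d0 d1. \<forall>x. g0 x = exp (k * x + d0) \<and> g1 x = exp (k * x + d1)
        \<and> g x = exp (k * x + (p * d0 + q * d1))))"
    if Zp: "0 < Z0" "0 < Z1"
  proof -
    define h where "h = (\<lambda>v. - v - ln (1 - v) :: real)"
    have lc: "logconc (\<lambda>x. g0 x powr a)" "logconc (\<lambda>x. g1 x powr b)" "logconc (\<lambda>x. g x powr c)"
      using g ab c by (auto intro: logconc_powr)
    obtain u0 v0 where t0: "\<And>x. (u0 has_real_derivative - v0 x) (at x)" "continuous_on UNIV v0"
      "\<And>x. 0 \<le> v0 x" "\<And>x. v0 x < 1" "\<And>x. 0 < g0 (x + u0 x) powr a"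
      "\<And>x. ln (g0 (x + u0 x) powr a) = ln Z0 + (x * u0 x + v0 x) + ((u0 x)\<^sup>2 / 2 + h (v0 x))"
      "integrable std_normal_distribution (\<lambda>x. (u0 x)\<^sup>2 / 2 + h (v0 x))"
      "integrable std_normal_distribution (\<lambda>x. x * u0 x + v0 x)"
      "(LINT x|std_normal_distribution. x * u0 x + v0 x) = 0"
      using logconc_transport_displacement[OF lc(1)] Zp(1) unfolding Z0_def h_def by blast
    obtain u1 v1 where t1: "\<And>x. (u1 has_real_derivative - v1 x) (at x)" "continuous_on UNIV v1"
      "\<And>x. 0 \<le> v1 x" "\<And>x. v1 x < 1" "\<And>x. 0 < g1 (x + u1 x) powr b"
      "\<And>x. ln (g1 (x + u1 x) powr b) = ln Z1 + (x * u1 x + v1 x) + ((u1 x)\<^sup>2 / 2 + h (v1 x))"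
      "integrable std_normal_distribution (\<lambda>x. (u1 x)\<^sup>2 / 2 + h (v1 x))"
      "integrable std_normal_distribution (\<lambda>x. x * u1 x + v1 x)"
      "(LINT x|std_normal_distribution. x * u1 x + v1 x) = 0"
      using logconc_transport_displacement[OF lc(2)] Zp(2) unfolding Z1_def h_def by blast
    have gp: "0 < g0 (x + u0 x)" "0 < g1 (x + u1 x)" for x
      using t0(5)[of x] t1(5)[of x] logconc_nonneg[OF g(1), of "x + u0 x"]
        logconc_nonneg[OF g(2), of "x + u1 x"] by (auto simp: less_le)
    define u where "u = (\<lambda>x. p * u0 x + q * u1 x)"
    define v where "v = (\<lambda>x. p * v0 x + q * v1 x)"
    have uc: "continuous_on UNIV u0" "continuous_on UNIV u1" "continuous_on UNIV u"
    proof -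
      show c0: "continuous_on UNIV u0" and c1: "continuous_on UNIV u1"
        using t0(1) t1(1) by (meson DERIV_isCont continuous_at_imp_continuous_on)+
      show "continuous_on UNIV u" unfolding u_def by (intro continuous_intros c0 c1)
    qed
    have vc: "continuous_on UNIV v" unfolding v_def by (intro continuous_intros t0 t1)
    have [measurable]: "u0 \<in> borel_measurable borel" "u1 \<in> borel_measurable borel"
      "u \<in> borel_measurable borel" "v0 \<in> borel_measurable borel" "v1 \<in> borel_measurable borel"
      "v \<in> borel_measurable borel"
      using uc vc t0(2) t1(2) by (auto intro: borel_measurable_continuous_onI)
    have [measurable]: "h \<in> borel_measurable borel" unfolding h_def by measurable
    have v: "0 \<le> v x" "v x < 1" for x
    proof -
      show "0 \<le> v x" using t0(3) t1(3) pq by (simp add: v_def)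
      have "v x < p * 1 + q * 1" unfolding v_def
        using pq t0(4) t1(4) by (intro add_strict_mono mult_strict_left_mono) auto
      thus "v x < 1" using pq by simp
    qed
    have h0: "0 \<le> h t" if "0 \<le> t" "t < 1" for t
      using ln_add_one_self_le_self2[of "- t"] that by (simp add: h_def)
    \<comment> \<open>The two parts of the cost are compared separately: the displacement, which may
      have either sign, by the quadratic inequality, and \<open>v\<close>, which stays in the unit
      interval, by the convexity of the logarithmic defect.\<close>
    define du where "du x = p * (u0 x)\<^sup>2 / a + q * (u1 x)\<^sup>2 / b - (u x)\<^sup>2 / c" for x
    define dh where "dh x = p * h (v0 x) / a + q * h (v1 x) / b - h (v x) / c" for x
    have du: "0 \<le> du x" for x
      using bergstrom[of p q a b "u0 x" "u1 x"] pq ab by (simp add: du_def u_def c_def)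
    have dh: "0 \<le> dh x" for x
      using log_defect_convex(1)[OF pq ab t0(3,4) t1(3,4), of x x] by (simp add: dh_def h_def v_def c_def)
    define E0 E1 E where "E0 = (\<lambda>x. (u0 x)\<^sup>2 / 2 + h (v0 x))" and "E1 = (\<lambda>x. (u1 x)\<^sup>2 / 2 + h (v1 x))"
      and "E = (\<lambda>x. (u x)\<^sup>2 / 2 + h (v x))"
    define L0 L1 where "L0 = (\<lambda>x. x * u0 x + v0 x)" and "L1 = (\<lambda>x. x * u1 x + v1 x)"
    have dE: "du x / 2 + dh x = p / a * E0 x + q / b * E1 x - E x / c" for x
      by (simp add: du_def dh_def E0_def E1_def E_def add_divide_distrib diff_divide_distrib algebra_simps)
    have iE: "integrable std_normal_distribution E0" "integrable std_normal_distribution E1"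
      using t0(7) t1(7) by (simp_all add: E0_def E1_def)
    have Ebd: "0 \<le> E x" "E x \<le> c * (p / a * E0 x + q / b * E1 x)" for x
    proof -
      show "0 \<le> E x" using h0[OF v] by (simp add: E_def)
      have "E x / c \<le> p / a * E0 x + q / b * E1 x" using dE[of x] du[of x] dh[of x] by linarith
      thus "E x \<le> c * (p / a * E0 x + q / b * E1 x)" using c by (simp add: pos_divide_le_eq mult.commute)
    qed
    have iE': "integrable std_normal_distribution E"
    proof (rule Bochner_Integration.integrable_bound)
      show "integrable std_normal_distribution (\<lambda>x. c * (p / a * E0 x + q / b * E1 x))"
        by (intro integrable_mult_right Bochner_Integration.integrable_add iE)
      show "AE x in std_normal_distribution. norm (E x) \<le> norm (c * (p / a * E0 x + q / b * E1 x))"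
        using Ebd by (intro AE_I2) (auto intro: order_trans[OF _ abs_ge_self])
      show "E \<in> borel_measurable std_normal_distribution" unfolding E_def by measurable
    qed
    define \<delta> where "\<delta> = (\<lambda>x. du x / 2 + dh x)"
    have i\<delta>: "integrable std_normal_distribution \<delta>"
      unfolding \<delta>_def dE using iE iE' by simp
    define K where "K = c * (p / a * ln Z0 + q / b * ln Z1)"
    \<comment> \<open>\<open>\<xi>\<close> is what remains of the lower bound for
      \<open>c * ln (g (x + u x))\<close> after subtracting \<open>x * u x + v x + E x\<close>,
      which the change of variables absorbs. As \<open>L0\<close> and \<open>L1\<close> have mean
      zero, its mean is \<open>K\<close> plus the nonnegative gain from
      \<open>\<delta>\<close>.\<close>
    define \<xi> where "\<xi> = (\<lambda>x. K + (c * p / a - p) * L0 x + (c * q / b - q) * L1 x + c * \<delta> x)"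
    interpret std: real_distribution std_normal_distribution by (rule real_dist_normal_dist)
    have iL: "integrable std_normal_distribution L0" "integrable std_normal_distribution L1"
      "integral\<^sup>L std_normal_distribution L0 = 0" "integral\<^sup>L std_normal_distribution L1 = 0"
      using t0(8,9) t1(8,9) by (simp_all add: L0_def L1_def)
    have i\<xi>: "integrable std_normal_distribution \<xi>"
      unfolding \<xi>_def
      by (rule Bochner_Integration.integrable_add[OF Bochner_Integration.integrable_add[OF
            Bochner_Integration.integrable_add[OF std.integrable_const
              integrable_mult_right[OF iL(1)]] integrable_mult_right[OF iL(2)]]
            integrable_mult_right[OF i\<delta>]])
    have int_\<xi>: "integral\<^sup>L std_normal_distribution \<xi> = K + c * integral\<^sup>L std_normal_distribution \<delta>"
      using iL i\<delta> std.prob_space unfolding \<xi>_def by simp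
    have \<xi>_le: "\<xi> x + (x * u x + v x + E x) \<le> c * ln (g (x + u x)) \<and> 0 < g (x + u x)" for x
    proof -
      have "p * (x + u0 x) + q * (x + u1 x) = (p + q) * x + u x" by (simp add: u_def algebra_simps)
      hence xu: "p * (x + u0 x) + q * (x + u1 x) = x + u x" using pq by simp
      have pos: "0 < g0 (x + u0 x) powr p * g1 (x + u1 x) powr q" using gp[of x] by simp
      also have *: "\<dots> \<le> g (x + u x)" using le[of "x + u0 x" "x + u1 x"] by (simp only: xu)
      finally have gpos: "0 < g (x + u x)" .
      have "p * ln (g0 (x + u0 x)) + q * ln (g1 (x + u1 x)) \<le> ln (g (x + u x))"
        using * pos gpos gp[of x] by (subst (asm) ln_le_cancel_iff[symmetric]) (auto simp: ln_mult ln_powr)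
      hence "c * (p * ln (g0 (x + u0 x)) + q * ln (g1 (x + u1 x))) \<le> c * ln (g (x + u x))"
        using c by simp
      moreover have "ln (g0 (x + u0 x)) = (ln Z0 + L0 x + E0 x) / a"
        using t0(6)[of x] gp[of x] ab by (simp add: L0_def E0_def ln_powr field_simps)
      moreover have "ln (g1 (x + u1 x)) = (ln Z1 + L1 x + E1 x) / b"
        using t1(6)[of x] gp[of x] ab by (simp add: L1_def E1_def ln_powr field_simps)
      moreover have "x * u x + v x = p * L0 x + q * L1 x"
        by (simp add: u_def v_def L0_def L1_def algebra_simps)
      moreover have "\<xi> x + (p * L0 x + q * L1 x + E x)
          = c * (p * ((ln Z0 + L0 x + E0 x) / a) + q * ((ln Z1 + L1 x + E1 x) / b))"
      proof -
        define A B e where "A = p / a" and "B = q / b" and "e = E x / c"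
        have "E x = c * e" "c * p / a = c * A" "c * q / b = c * B"
          "p * ((ln Z0 + L0 x + E0 x) / a) = A * (ln Z0 + L0 x + E0 x)"
          "q * ((ln Z1 + L1 x + E1 x) / b) = B * (ln Z1 + L1 x + E1 x)"
          using c by (simp_all add: A_def B_def e_def)
        thus ?thesis unfolding \<xi>_def \<delta>_def dE K_def A_def[symmetric] B_def[symmetric] e_def[symmetric]
          by (simp only:) (simp add: algebra_simps)
      qed
      ultimately show ?thesis using gpos by simp
    qed
    have [measurable]: "g \<in> borel_measurable borel" using g(3) by (rule logconc_measurable)
    have [measurable]: "\<xi> \<in> borel_measurable borel"
      using borel_measurable_integrable[OF i\<xi>] by simp
    define f where "f = (\<lambda>y. std_normal_density y * g y powr c)"
    have f: "integrable lborel f" "integral\<^sup>L lborel f = Z"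
      using logconc_integrable[OF lc(3)] by (simp_all add: f_def Z_def std_normal_integrable_iff std_normal_integral)
    have ee: "integrable lborel (\<lambda>x. std_normal_density x * exp (\<xi> x))"
      "(LINT x|lborel. std_normal_density x * exp (\<xi> x)) \<le> integral\<^sup>L lborel f"
    proof -
      have T: "((\<lambda>x. x + u x) has_real_derivative 1 - v x) (at x)" for x
        unfolding u_def v_def by (auto intro!: derivative_eq_intros t0(1) t1(1) simp: algebra_simps)
      have le': "std_normal_density x * exp (\<xi> x) \<le> (1 - v x) * f (x + u x)" for x
      proof -
        have "ln (std_normal_density x * exp (\<xi> x)) = ln (std_normal_density x) + \<xi> x"
          using std_normal_density_pos[of x] by (simp add: ln_mult)
        also have "\<dots> \<le> ln (std_normal_density x) + (c * ln (g (x + u x)) - (x * u x + v x + E x))"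
          using \<xi>_le[of x] by simp
        \<comment> \<open>Completing the square moves the Gaussian density from \<open>x\<close> to
          \<open>x + u x\<close>, and \<open>- v - h v = ln (1 - v)\<close> produces the derivative
          of the interpolated map.\<close>
        also have "\<dots> = ln (1 - v x) + (ln (std_normal_density (x + u x)) + c * ln (g (x + u x)))"
          by (simp add: ln_std_normal_density E_def h_def power2_eq_square field_simps)
        also have "\<dots> = ln ((1 - v x) * f (x + u x))"
          using v(2)[of x] \<xi>_le[of x] std_normal_density_pos[of "x + u x"]
          by (simp add: f_def ln_mult ln_powr)
        finally show ?thesis
          using v(2)[of x] \<xi>_le[of x] std_normal_density_pos[of "x + u x"] std_normal_density_pos[of x]
          by (subst (asm) ln_le_cancel_iff) (auto simp: f_def)
      qed
      have side: "0 < 1 - v x" "0 \<le> f x" "0 \<le> std_normal_density x * exp (\<xi> x)" for x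
        using v(2)[of x] by (simp_all add: f_def)
      have m: "(\<lambda>x. std_normal_density x * exp (\<xi> x)) \<in> borel_measurable borel" by measurable
      note t = integral_transport_le[OF T side(1) f(1) side(2) m side(3) le']
      show "integrable lborel (\<lambda>x. std_normal_density x * exp (\<xi> x))" by (rule t(1))
      show "(LINT x|lborel. std_normal_density x * exp (\<xi> x)) \<le> integral\<^sup>L lborel f" by (rule t(2))
    qed
    define m where "m = integral\<^sup>L std_normal_distribution \<xi>"
    \<comment> \<open>Jensen's inequality for the exponential function, by means of its tangent at
      the mean \<open>m\<close>.\<close>
    have "exp m \<le> Z"
    proof -
      have "exp m = (LINT x|std_normal_distribution. exp m * (1 + (\<xi> x - m)))"
        using i\<xi> std.prob_space by (simp add: m_def)
      also have "\<dots> \<le> (LINT x|std_normal_distribution. exp (\<xi> x))"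
      proof (rule integral_mono)
        fix x
        have "exp m * (1 + (\<xi> x - m)) \<le> exp m * exp (\<xi> x - m)"
          by (intro mult_left_mono exp_ge_add_one_self) auto
        also have "\<dots> = exp (\<xi> x)" by (simp add: exp_add[symmetric])
        finally show "exp m * (1 + (\<xi> x - m)) \<le> exp (\<xi> x)" .
      qed (use i\<xi> ee in \<open>simp_all add: std_normal_integrable_iff\<close>)
      also have "\<dots> \<le> Z" using ee(2) f(2) by (simp add: std_normal_integral)
      finally show ?thesis .
    qed
    hence Zpos: "0 < Z" and mZ: "m \<le> ln Z"
      using less_le_trans[OF exp_gt_zero] ln_ge_iff[of Z m] by blast+
    have \<delta>0: "0 \<le> \<delta> x" for x using du[of x] dh[of x] by (simp add: \<delta>_def)
    have I\<delta>: "0 \<le> integral\<^sup>L std_normal_distribution \<delta>" using \<delta>0 by simp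
    have key: "p / a * ln Z0 + q / b * ln Z1 + integral\<^sup>L std_normal_distribution \<delta> \<le> 1 / c * ln Z"
    proof -
      have "c * (p / a * ln Z0 + q / b * ln Z1 + integral\<^sup>L std_normal_distribution \<delta>) \<le> ln Z"
        using mZ int_\<xi> by (simp add: m_def K_def distrib_left)
      thus ?thesis using c by (simp add: pos_le_divide_eq mult.commute)
    qed
    have "\<exists>k d0 d1. \<forall>x. g0 x = exp (k * x + d0) \<and> g1 x = exp (k * x + d1)
        \<and> g x = exp (k * x + (p * d0 + q * d1))"
      if eq: "p / a * ln Z0 + q / b * ln Z1 = 1 / c * ln Z" and neq: "a \<noteq> b"
    proof -
      have "integral\<^sup>L std_normal_distribution \<delta> = 0" using key eq I\<delta> by linarith
      hence "AE x in std_normal_distribution. \<delta> x = 0"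
        using integral_nonneg_eq_0_iff_AE[OF i\<delta>] \<delta>0 by simp
      \<comment> \<open>Continuity makes \<open>\<delta>\<close> vanish everywhere and not only
        almost everywhere, so that the derivatives of \<open>u0\<close> and \<open>u1\<close> vanish
        identically and both displacements are constant.\<close>
      moreover have "continuous_on UNIV \<delta>"
        unfolding \<delta>_def du_def dh_def h_def
        using v(2) t0(4) t1(4) ab c
        by (intro continuous_intros uc vc t0(2) t1(2)) (auto simp: less_imp_neq)
      ultimately have "\<delta> x = 0" for x using AE_continuous_zero by blast
      hence s: "du x / 2 + dh x = 0" for x unfolding \<delta>_def .
      hence z: "du x = 0" "dh x = 0" for x
        using du[of x] dh[of x] s[of x] by linarith+
      have vz: "v0 x = 0 \<and> v1 x = 0" for x
        using log_defect_convex(2)[OF pq ab t0(3,4) t1(3,4) _ neq, of x x] z(2)[of x]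
        by (simp add: dh_def h_def v_def c_def)
      have du0: "(u0 has_real_derivative 0) (at x)" for x using t0(1)[of x] vz[of x] by simp
      define k0 where "k0 = u0 0"
      have k0: "u0 x = k0" for x unfolding k0_def by (rule DERIV_isconst_all) (simp add: du0)
      have du1: "(u1 has_real_derivative 0) (at x)" for x using t1(1)[of x] vz[of x] by simp
      define k1 where "k1 = u1 0"
      have k1: "u1 x = k1" for x unfolding k1_def by (rule DERIV_isconst_all) (simp add: du1)
      \<comment> \<open>Equality in the quadratic part makes the displacements proportional to the
        exponents, which is why \<open>g0\<close> and \<open>g1\<close> share the slope
        \<open>k\<close>.\<close>
      have kk: "k0 * b = k1 * a"
        using bergstrom_eq_imp[OF pq ab, of k0 k1] z(1)[of 0] by (simp add: du_def u_def k0 k1 c_def)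
      define k where "k = k0 / a"
      have k: "k0 = k * a" "k1 = k * b" using kk ab by (auto simp: k_def field_simps)
      have kb: "k = k1 / b" using k(2) ab by simp
      define d0 d1 where "d0 = (ln Z0 - k0\<^sup>2 / 2) / a" and "d1 = (ln Z1 - k1\<^sup>2 / 2) / b"
      have g0: "g0 y = exp (k * y + d0)" for y
      proof -
        have "ln (g0 y) = k * y + d0"
          using t0(6)[of "y - k0"] gp(1)[of "y - k0"] ab vz
          by (simp add: k0 h_def ln_powr d0_def k_def power2_eq_square field_simps)
        moreover have "0 < g0 y" using gp(1)[of "y - k0"] by (simp add: k0)
        ultimately show ?thesis by (metis exp_ln)
      qed
      have g1: "g1 y = exp (k * y + d1)" for y
      proof -
        have "ln (g1 y) = k * y + d1"
          using t1(6)[of "y - k1"] gp(2)[of "y - k1"] ab vz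
          by (simp add: k1 h_def ln_powr d1_def kb power2_eq_square field_simps)
        moreover have "0 < g1 y" using gp(2)[of "y - k1"] by (simp add: k1)
        ultimately show ?thesis by (metis exp_ln)
      qed
      define d where "d = p * d0 + q * d1"
      have ge: "exp (k * y + d) \<le> g y" for y
      proof -
        have "g0 y powr p * g1 y powr q \<le> g (p * y + q * y)" by (rule le)
        moreover have "p * y + q * y = y" using pq by (simp add: distrib_right[symmetric])
        moreover have "p * (k * y + d0) + q * (k * y + d1) = (p + q) * (k * y) + d"
          by (simp add: d_def algebra_simps)
        ultimately show ?thesis using pq by (simp add: g0 g1 powr_def exp_add[symmetric])
      qed
      have gpos: "0 < g y" for y using less_le_trans[OF exp_gt_zero ge] .
      have lnZ: "ln Z = c * d + (c * k)\<^sup>2 / 2"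
      proof -
        have "ln Z = c * (p / a * ln Z0 + q / b * ln Z1)" using eq c by simp
        also have "ln Z0 = a * d0 + (k * a)\<^sup>2 / 2" using ab by (simp add: d0_def k)
        also have "ln Z1 = b * d1 + (k * b)\<^sup>2 / 2" using ab by (simp add: d1_def k)
        also have "c * (p / a * (a * d0 + (k * a)\<^sup>2 / 2) + q / b * (b * d1 + (k * b)\<^sup>2 / 2))
            = c * d + c * (k\<^sup>2 * (p * a + q * b)) / 2"
          using ab by (simp add: d_def field_simps power2_eq_square)
        finally show ?thesis unfolding c_def[symmetric] by (simp add: power2_eq_square mult_ac)
      qed
      \<comment> \<open>By hypothesis \<open>g\<close> dominates the interpolated exponential
        pointwise, and equality gives both the same moment of order \<open>c\<close>. Hence the
        continuous nonnegative difference \<open>r\<close> has integral zero.\<close>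
      define r where "r = (\<lambda>y. g y powr c - exp (c * d) * exp ((c * k) * y))"
      have ir: "integrable std_normal_distribution r"
        unfolding r_def
        by (intro Bochner_Integration.integrable_diff integrable_mult_right std_normal_exp_integrable
            logconc_integrable lc)
      have exps: "exp (c * d) * exp ((c * k) * y) = exp (k * y + d) powr c" for y
        by (simp add: powr_def exp_add[symmetric] algebra_simps)
      have r0: "0 \<le> r y" for y
        unfolding r_def exps using ge[of y] c by (simp add: powr_mono2)
      have "integral\<^sup>L std_normal_distribution r = Z - exp (c * d) * exp ((c * k)\<^sup>2 / 2)"
        unfolding r_def Z_def
        by (subst Bochner_Integration.integral_diff)
           (auto intro!: integrable_mult_right std_normal_exp_integrable logconc_integrable lc
            simp: std_normal_exp_integral)
      also have "\<dots> = 0" unfolding exp_add[symmetric] lnZ[symmetric] using Zpos by simp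
      finally have "AE y in std_normal_distribution. r y = 0"
        using integral_nonneg_eq_0_iff_AE[OF ir] r0 by simp
      moreover have "continuous_on UNIV r"
        unfolding r_def
        by (intro continuous_intros logconc_continuous[OF g(3) gpos])
          (auto simp: less_imp_neq[OF gpos, symmetric])
      ultimately have "r y = 0" for y using AE_continuous_zero by blast
      hence "g y powr c = exp (k * y + d) powr c" for y unfolding r_def exps by simp
      hence *: "g y powr c = exp (k * y + d) powr c" for y .
      have "g y = exp (k * y + d)" for y
      proof -
        have "(g y powr c) powr (1 / c) = (exp (k * y + d) powr c) powr (1 / c)" by (simp only: *)
        thus ?thesis using c gpos[of y] by (simp add: powr_powr)
      qed
      thus ?thesis using g0 g1 unfolding d_def by blast
    qed
    thus ?thesis using key I\<delta> Zpos by auto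
  qed
  have expm: "(Z0 powr (1 / a)) powr p * (Z1 powr (1 / b)) powr q = exp (p / a * ln Z0 + q / b * ln Z1)"
    if "0 < Z0" "0 < Z1" using that by (simp add: powr_powr powr_def exp_add mult.commute)
  have expZ: "Z powr (1 / c) = exp (1 / c * ln Z)" if "0 < Z" using that by (simp add: powr_def)
  show "gauss_mean a g0 powr p * gauss_mean b g1 powr q \<le> gauss_mean (p * a + q * b) g"
  proof (cases "Z0 = 0 \<or> Z1 = 0")
    case True
    thus ?thesis unfolding means by auto
  next
    case False
    hence "0 < Z0" "0 < Z1" using Z_nonneg by auto
    thus ?thesis using main expm expZ unfolding means by simp
  qed
  assume "gauss_mean a g0 powr p * gauss_mean b g1 powr q = gauss_mean (p * a + q * b) g"
    "0 < gauss_mean a g0" "0 < gauss_mean b g1" "a \<noteq> b"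
  moreover from this have Z: "0 < Z0" "0 < Z1" using Z_nonneg unfolding means by auto
  ultimately have "exp (p / a * ln Z0 + q / b * ln Z1) = exp (1 / c * ln Z)"
    using main[OF Z] expm[OF Z] expZ unfolding means by simp
  hence "p / a * ln Z0 + q / b * ln Z1 = 1 / c * ln Z" by (simp only: exp_inj_iff)
  with main[OF Z] \<open>a \<noteq> b\<close> show "\<exists>k d0 d1. \<forall>x. g0 x = exp (k * x + d0) \<and> g1 x = exp (k * x + d1)
        \<and> g x = exp (k * x + (p * d0 + q * d1))" by blast
qed

section \<open>Tensorization\<close>

lemma gauss_mean_nonneg: "0 \<le> gauss_mean a g"
  by (simp add: gauss_mean_def)

lemma gauss_mean_exp:
  assumes "0 < a"
  shows "gauss_mean a (\<lambda>x. exp (k * x + e)) = exp (a * k\<^sup>2 / 2 + e)"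
proof -
  have "exp (k * x + e) powr a = exp (a * e) * exp ((a * k) * x)" for x
    by (simp add: powr_def exp_add[symmetric] algebra_simps)
  hence "(LINT x|std_normal_distribution. exp (k * x + e) powr a) = exp (a * e) * exp ((a * k)\<^sup>2 / 2)"
    by (simp add: std_normal_exp_integral)
  also have "\<dots> = exp (a * (a * k\<^sup>2 / 2 + e))"
    by (simp add: exp_add[symmetric] power2_eq_square algebra_simps)
  finally show ?thesis using assms by (simp add: gauss_mean_def powr_def)
qed

lemma gauss_mean_nn_integral:
  assumes "logconc g" "0 < a"
  shows "(\<integral>\<^sup>+x. ennreal (g x powr a) \<partial>std_normal_distribution) = ennreal (gauss_mean a g powr a)"
proof -
  have "(\<integral>\<^sup>+x. ennreal (g x powr a) \<partial>std_normal_distribution)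
      = ennreal (LINT x|std_normal_distribution. g x powr a)"
    using assms by (intro nn_integral_eq_integral logconc_integrable logconc_powr) auto
  also have "(LINT x|std_normal_distribution. g x powr a) = gauss_mean a g powr a"
    using assms by (simp add: gauss_mean_def powr_powr)
  finally show ?thesis .
qed

text \<open>The base points \<open>z\<close> and \<open>z'\<close> are independent of each other:
  restricted to parallel lines through them, the functions satisfy the one-dimensional hypothesis,
  and the means satisfy it again as functions of the base points. This is what the induction
  consumes.\<close>

lemma prekopa_along:
  fixes g0 g1 g :: "'v::real_vector \<Rightarrow> real" and v :: 'v
  assumes g: "logconc g0" "logconc g1" "logconc g"
    and pq: "0 < p" "0 < q" "p + q = 1" and ab: "0 < a" "0 < b"
    and le: "\<And>x y. g0 x powr p * g1 y powr q \<le> g (p *\<^sub>R x + q *\<^sub>R y)"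
  defines "Q \<equiv> \<lambda>a g z. gauss_mean a (\<lambda>x. g (z + x *\<^sub>R v))"
  shows "Q a g0 z powr p * Q b g1 z' powr q \<le> Q (p * a + q * b) g (p *\<^sub>R z + q *\<^sub>R z')"
    and "Q a g0 z powr p * Q b g1 z' powr q = Q (p * a + q * b) g (p *\<^sub>R z + q *\<^sub>R z') \<Longrightarrow>
      0 < Q a g0 z \<Longrightarrow> 0 < Q b g1 z' \<Longrightarrow> a \<noteq> b \<Longrightarrow>
      \<exists>k d0 d1. \<forall>x. g0 (z + x *\<^sub>R v) = exp (k * x + d0) \<and> g1 (z' + x *\<^sub>R v) = exp (k * x + d1)
        \<and> g (p *\<^sub>R z + q *\<^sub>R z' + x *\<^sub>R v) = exp (k * x + (p * d0 + q * d1))"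
proof -
  have "g0 (z + x *\<^sub>R v) powr p * g1 (z' + y *\<^sub>R v) powr q
      \<le> g (p *\<^sub>R z + q *\<^sub>R z' + (p * x + q * y) *\<^sub>R v)" for x y
    using le[of "z + x *\<^sub>R v" "z' + y *\<^sub>R v"] by (simp add: algebra_simps)
  note P = prekopa_1d[OF logconc_line[OF g(1)] logconc_line[OF g(2)] logconc_line[OF g(3)] pq ab this]
  show "Q a g0 z powr p * Q b g1 z' powr q \<le> Q (p * a + q * b) g (p *\<^sub>R z + q *\<^sub>R z')"
    unfolding Q_def by (rule P(1))
  show "Q a g0 z powr p * Q b g1 z' powr q = Q (p * a + q * b) g (p *\<^sub>R z + q *\<^sub>R z') \<Longrightarrow>
      0 < Q a g0 z \<Longrightarrow> 0 < Q b g1 z' \<Longrightarrow> a \<noteq> b \<Longrightarrow>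
      \<exists>k d0 d1. \<forall>x. g0 (z + x *\<^sub>R v) = exp (k * x + d0) \<and> g1 (z' + x *\<^sub>R v) = exp (k * x + d1)
        \<and> g (p *\<^sub>R z + q *\<^sub>R z' + x *\<^sub>R v) = exp (k * x + (p * d0 + q * d1))"
    unfolding Q_def by (rule P(2))
qed

text \<open>Partial integration preserves log-concavity by the case of equal exponents and equal
  functions.\<close>

lemma logconc_gauss_mean_along:
  assumes "logconc g" "0 < a"
  shows "logconc (\<lambda>z. gauss_mean a (\<lambda>x. g (z + x *\<^sub>R v)))"
  unfolding logconc_def
proof (intro conjI allI impI gauss_mean_nonneg)
  fix x y and t :: real assume t: "0 < t" "t < 1"
  have "(1 - t) * a + t * a = a" by (simp add: algebra_simps)
  with prekopa_along(1)[OF assms(1) assms(1) assms(1), where p = "1 - t" and q = t and a = a and b = a and v = v and z = x and z' = y]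
  show "gauss_mean a (\<lambda>s. g (x + s *\<^sub>R v)) powr (1 - t) * gauss_mean a (\<lambda>s. g (y + s *\<^sub>R v)) powr t
      \<le> gauss_mean a (\<lambda>s. g ((1 - t) *\<^sub>R x + t *\<^sub>R y + s *\<^sub>R v))"
    using t assms logconcD[OF assms(1) t] by simp
qed

text \<open>
  Integrating out one direction after the other keeps all integrals one-dimensional, where log-concave
  functions are Borel measurable. In higher dimensions they need not be.
\<close>
primrec gauss_mean_iter :: "real \<Rightarrow> (nat \<Rightarrow> 'v::real_vector) \<Rightarrow> nat \<Rightarrow> ('v \<Rightarrow> real) \<Rightarrow> 'v \<Rightarrow> real" where
  "gauss_mean_iter a A 0 g = g"
| "gauss_mean_iter a A (Suc m) g = gauss_mean_iter a A m (\<lambda>z. gauss_mean a (\<lambda>x. g (z + x *\<^sub>R A m)))"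

lemma gauss_mean_iter_nonneg: "logconc g \<Longrightarrow> 0 < a \<Longrightarrow> 0 \<le> gauss_mean_iter a A m g z"
  by (induction m arbitrary: g) (auto simp: logconc_nonneg logconc_gauss_mean_along)

lemma prekopa_iter:
  fixes g0 g1 g :: "'v::real_vector \<Rightarrow> real"
  assumes "logconc g0" "logconc g1" "logconc g"
    and pq: "0 < p" "0 < q" "p + q = 1" and ab: "0 < a" "0 < b"
    and "\<And>x y. g0 x powr p * g1 y powr q \<le> g (p *\<^sub>R x + q *\<^sub>R y)"
  shows "gauss_mean_iter a A m g0 x powr p * gauss_mean_iter b A m g1 y powr q
    \<le> gauss_mean_iter (p * a + q * b) A m g (p *\<^sub>R x + q *\<^sub>R y)"
  using assms(1-3,9)
proof (induction m arbitrary: g0 g1 g)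
  case (Suc m)
  have "0 < p * a + q * b" using pq ab by (simp add: add_pos_pos)
  then show ?case
    unfolding gauss_mean_iter.simps
    using Suc.prems ab by (intro Suc.IH logconc_gauss_mean_along prekopa_along(1) pq) auto
qed auto

text \<open>By induction, the functions that remain after integrating out the direction
  \<open>A m\<close> are exponentials with a common linear part. For such exponentials equality
  holds at every pair of base points, so the one-dimensional equality case applies to every pair of
  fibres.\<close>

lemma prekopa_iter_eq:
  fixes g0 g1 g :: "'v::real_vector \<Rightarrow> real"
  assumes "logconc g0" "logconc g1" "logconc g"
    and pq: "0 < p" "0 < q" "p + q = 1" and ab: "0 < a" "0 < b" "a \<noteq> b"
    and "\<And>x y. g0 x powr p * g1 y powr q \<le> g (p *\<^sub>R x + q *\<^sub>R y)"
    and "gauss_mean_iter a A m g0 z powr p * gauss_mean_iter b A m g1 z powr q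
      = gauss_mean_iter (p * a + q * b) A m g z"
    and "0 < gauss_mean_iter a A m g0 z" "0 < gauss_mean_iter b A m g1 z"
  shows "\<exists>k d0 d1. \<forall>x. g0 (z + (\<Sum>i<m. x i *\<^sub>R A i)) = exp ((\<Sum>i<m. k i * x i) + d0)
      \<and> g1 (z + (\<Sum>i<m. x i *\<^sub>R A i)) = exp ((\<Sum>i<m. k i * x i) + d1)
      \<and> g (z + (\<Sum>i<m. x i *\<^sub>R A i)) = exp ((\<Sum>i<m. k i * x i) + (p * d0 + q * d1))"
  using assms(1-3,10-)
proof (induction m arbitrary: g0 g1 g)
  case 0
  have "exp (p * ln (g0 z) + q * ln (g1 z)) = g z"
    using 0 by (simp add: exp_add powr_def)
  with 0 show ?case by (intro exI[of _ undefined] exI[of _ "ln (g0 z)"] exI[of _ "ln (g1 z)"]) simp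
next
  case (Suc m)
  define c where "c = p * a + q * b"
  have c: "0 < c" using pq ab by (simp add: c_def add_pos_pos)
  define Q where "Q a g z = gauss_mean a (\<lambda>x. g (z + x *\<^sub>R A m))" for a g z
  define S where "S = (\<lambda>x :: nat \<Rightarrow> real. z + (\<Sum>i<m. x i *\<^sub>R A i))"
  define l where "l = (\<lambda>(k :: nat \<Rightarrow> real) x. \<Sum>i<m. k i * x i)"
  note along = prekopa_along[OF Suc.prems(1-3) pq ab(1,2) Suc.prems(4), where v = "A m"]
  have "\<exists>k d0 d1. \<forall>x. Q a g0 (S x) = exp (l k x + d0) \<and> Q b g1 (S x) = exp (l k x + d1)
      \<and> Q c g (S x) = exp (l k x + (p * d0 + q * d1))"
    unfolding S_def l_def
  proof (rule Suc.IH)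
    show "Q a g0 x powr p * Q b g1 y powr q \<le> Q c g (p *\<^sub>R x + q *\<^sub>R y)" for x y
      unfolding Q_def c_def by (rule along(1))
  qed (use Suc.prems ab c in \<open>simp_all add: Q_def[abs_def] c_def logconc_gauss_mean_along\<close>)
  then obtain k d0 d1 where IH: "\<And>x. Q a g0 (S x) = exp (l k x + d0)"
    "\<And>x. Q b g1 (S x) = exp (l k x + d1)" "\<And>x. Q c g (S x) = exp (l k x + (p * d0 + q * d1))"
    by blast
  have Scomb: "p *\<^sub>R S x + q *\<^sub>R S y = S (\<lambda>i. p * x i + q * y i)" for x y
  proof -
    have "p *\<^sub>R z + q *\<^sub>R z = z" using pq by (simp add: scaleR_left_distrib[symmetric])
    thus ?thesis
      by (simp add: S_def scaleR_right_distrib scaleR_left_distrib scaleR_sum_right sum.distrib)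
  qed
  have lcomb: "l k (\<lambda>i. p * x i + q * y i) = p * l k x + q * l k y" for x y
    by (simp add: l_def sum_distrib_left sum.distrib algebra_simps)
  have fibre: "\<exists>\<kappa> e0 e1. \<forall>s. g0 (S x + s *\<^sub>R A m) = exp (\<kappa> * s + e0)
      \<and> g1 (S y + s *\<^sub>R A m) = exp (\<kappa> * s + e1)
      \<and> g (p *\<^sub>R S x + q *\<^sub>R S y + s *\<^sub>R A m) = exp (\<kappa> * s + (p * e0 + q * e1))" for x y
  proof (rule along(2)[folded c_def Q_def])
    show "Q a g0 (S x) powr p * Q b g1 (S y) powr q = Q c g (p *\<^sub>R S x + q *\<^sub>R S y)"
      unfolding Scomb IH lcomb by (simp add: powr_def exp_add[symmetric] algebra_simps)
  qed (use IH ab in auto)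
  \<comment> \<open>In \<open>fibre\<close> the base points of \<open>g0\<close> and \<open>g1\<close> vary independently of each other but share the
    slope, which is therefore constant.\<close>
  have slope: "\<kappa> = \<kappa>'" if "\<And>s. exp (\<kappa> * s + e) = exp (\<kappa>' * s + e')" for \<kappa> \<kappa>' e e' :: real
    using that[of 0] that[of 1] by simp
  obtain \<kappa> e00 e10 where base: "\<And>s. g0 (S (\<lambda>_. 0) + s *\<^sub>R A m) = exp (\<kappa> * s + e00)"
    "\<And>s. g1 (S (\<lambda>_. 0) + s *\<^sub>R A m) = exp (\<kappa> * s + e10)"
    using fibre[of "\<lambda>_. 0" "\<lambda>_. 0"] by blast
  have f0: "\<exists>e. \<forall>s. g0 (S x + s *\<^sub>R A m) = exp (\<kappa> * s + e)" for x
  proof -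
    obtain \<kappa>' e0 e1 where *: "\<And>s. g0 (S x + s *\<^sub>R A m) = exp (\<kappa>' * s + e0)"
      "\<And>s. g1 (S (\<lambda>_. 0) + s *\<^sub>R A m) = exp (\<kappa>' * s + e1)"
      using fibre[of x "\<lambda>_. 0"] by blast
    have "\<kappa> = \<kappa>'" by (rule slope[of _ e10 _ e1]) (use base(2) *(2) in metis)
    with * show ?thesis by blast
  qed
  \<comment> \<open>The subtracted terms are what the fibre itself contributes to the mean of an
    exponential of slope \<open>\<kappa>\<close>.\<close>
  define d0' d1' where "d0' = d0 - a * \<kappa>\<^sup>2 / 2" and "d1' = d1 - b * \<kappa>\<^sup>2 / 2"
  have main: "g0 (S x + s *\<^sub>R A m) = exp (l k x + \<kappa> * s + d0')
      \<and> g1 (S x + s *\<^sub>R A m) = exp (l k x + \<kappa> * s + d1')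
      \<and> g (S x + s *\<^sub>R A m) = exp (l k x + \<kappa> * s + (p * d0' + q * d1'))" for x s
  proof -
    obtain \<kappa>' e0 e1 where *: "\<And>s. g0 (S x + s *\<^sub>R A m) = exp (\<kappa>' * s + e0)"
      "\<And>s. g1 (S x + s *\<^sub>R A m) = exp (\<kappa>' * s + e1)"
      "\<And>s. g (p *\<^sub>R S x + q *\<^sub>R S x + s *\<^sub>R A m) = exp (\<kappa>' * s + (p * e0 + q * e1))"
      using fibre[of x x] by blast
    obtain e where e: "\<And>s. g0 (S x + s *\<^sub>R A m) = exp (\<kappa> * s + e)" using f0[of x] by blast
    have "exp (\<kappa>' * s + e0) = exp (\<kappa> * s + e)" for s
      using *(1)[of s] e[of s] by simp
    hence \<kappa>: "\<kappa>' = \<kappa>" by (rule slope)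
    note * = *[unfolded \<kappa>]
    have "exp (a * \<kappa>\<^sup>2 / 2 + e0) = exp (l k x + d0)"
      using IH(1)[of x] gauss_mean_exp[OF ab(1), of \<kappa> e0] *(1) by (simp add: Q_def)
    hence e0: "e0 = l k x + d0'" by (simp add: d0'_def)
    have "exp (b * \<kappa>\<^sup>2 / 2 + e1) = exp (l k x + d1)"
      using IH(2)[of x] gauss_mean_exp[OF ab(2), of \<kappa> e1] *(2) by (simp add: Q_def)
    hence e1: "e1 = l k x + d1'" by (simp add: d1'_def)
    have pq1: "p *\<^sub>R S x + q *\<^sub>R S x = S x" using pq by (simp add: scaleR_left_distrib[symmetric])
    have "p * e0 + q * e1 = (p + q) * l k x + (p * d0' + q * d1')"
      by (simp add: e0 e1 algebra_simps)
    hence pe: "p * e0 + q * e1 = l k x + (p * d0' + q * d1')" using pq by simp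
    show ?thesis
      using *(1,2)[of s] *(3)[of s] unfolding pq1 pe by (simp add: e0 e1 add_ac)
  qed
  show ?case
  proof (rule exI[of _ "k(m := \<kappa>)"], rule exI[of _ d0'], rule exI[of _ d1'], rule allI)
    fix x :: "nat \<Rightarrow> real"
    have "z + (\<Sum>i<Suc m. x i *\<^sub>R A i) = S x + x m *\<^sub>R A m" by (simp add: S_def add_ac)
    moreover have "(\<Sum>i<Suc m. (k(m := \<kappa>)) i * x i) = l k x + \<kappa> * x m" by (simp add: l_def)
    ultimately show "g0 (z + (\<Sum>i<Suc m. x i *\<^sub>R A i)) = exp ((\<Sum>i<Suc m. (k(m := \<kappa>)) i * x i) + d0')
      \<and> g1 (z + (\<Sum>i<Suc m. x i *\<^sub>R A i)) = exp ((\<Sum>i<Suc m. (k(m := \<kappa>)) i * x i) + d1')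
      \<and> g (z + (\<Sum>i<Suc m. x i *\<^sub>R A i)) = exp ((\<Sum>i<Suc m. (k(m := \<kappa>)) i * x i) + (p * d0' + q * d1'))"
      using main[of x "x m"] by (simp only:)
  qed
qed

section \<open>Iterated means as integrals over the product measure\<close>

text \<open>Fubini for null sets. \<open>P\<close> may be non-measurable, so the argument runs
  through a measurable null set \<open>N\<close> that contains all failures.\<close>

lemma (in product_sigma_finite) AE_PiM_insert:
  assumes I: "finite I" "i \<notin> I" and ae: "AE x in Pi\<^sub>M (insert i I) M. P x"
  shows "AE x in Pi\<^sub>M I M. AE y in M i. P (x(i := y))"
proof -
  obtain N where N: "{x \<in> space (Pi\<^sub>M (insert i I) M). \<not> P x} \<subseteq> N"
    "emeasure (Pi\<^sub>M (insert i I) M) N = 0" "N \<in> sets (Pi\<^sub>M (insert i I) M)"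
    using ae by (rule AE_E)
  have upd: "(\<lambda>(x, y). x(i := y)) \<in> Pi\<^sub>M I M \<Otimes>\<^sub>M M i \<rightarrow>\<^sub>M Pi\<^sub>M (insert i I) M"
    by (rule measurable_add_dim)
  have ind: "(\<lambda>(x, y). indicator N (x(i := y)) :: ennreal) \<in> borel_measurable (Pi\<^sub>M I M \<Otimes>\<^sub>M M i)"
    using measurable_compose[OF upd borel_measurable_indicator[OF N(3)]] by (simp add: case_prod_beta')
  have "(\<integral>\<^sup>+x. (\<integral>\<^sup>+y. indicator N (x(i := y)) \<partial>M i) \<partial>Pi\<^sub>M I M) = 0"
    using product_nn_integral_insert[OF I, of "indicator N"] N by simp
  hence "AE x in Pi\<^sub>M I M. (\<integral>\<^sup>+y. indicator N (x(i := y)) \<partial>M i) = 0"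
    using M.borel_measurable_nn_integral[OF ind] by (subst (asm) nn_integral_0_iff_AE) auto
  with AE_space show ?thesis
  proof eventually_elim
    fix x assume x: "x \<in> space (Pi\<^sub>M I M)" and z: "(\<integral>\<^sup>+y. indicator N (x(i := y)) \<partial>M i) = 0"
    have "(\<lambda>y. indicator N (x(i := y)) :: ennreal) \<in> borel_measurable (M i)"
      using measurable_Pair2[OF ind x] by simp
    hence "AE y in M i. indicator N (x(i := y)) = (0 :: ennreal)"
      using z by (subst (asm) nn_integral_0_iff_AE) auto
    with AE_space show "AE y in M i. P (x(i := y))"
    proof eventually_elim
      fix y assume y: "y \<in> space (M i)" and "indicator N (x(i := y)) = (0 :: ennreal)"
      hence "x(i := y) \<notin> N" by (auto simp: indicator_def)
      moreover have "x(i := y) \<in> space (Pi\<^sub>M (insert i I) M)"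
        using x y by (auto simp: space_PiM PiE_def extensional_def)
      ultimately show "P (x(i := y))" using N(1) by blast
    qed
  qed
qed

lemma product_sigma_finite_std_normal: "product_sigma_finite (\<lambda>_. std_normal_distribution)"
proof -
  interpret real_distribution std_normal_distribution by (rule real_dist_normal_dist)
  show ?thesis by (simp add: product_sigma_finite_def sigma_finite_measure_axioms)
qed

text \<open>\<open>G\<close> is a measurable version of the pulled-back power of \<open>g\<close>.
  Fubini is applied to \<open>G\<close>, almost all of whose sections agree almost everywhere with
  restrictions of \<open>g\<close> to lines.\<close>

lemma gauss_mean_iter_nn_integral:
  fixes g :: "'v::real_vector \<Rightarrow> real"
  assumes "logconc g" "0 < a" "G \<in> borel_measurable (Pi\<^sub>M {..<m} (\<lambda>_. std_normal_distribution))"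
    and "AE x in Pi\<^sub>M {..<m} (\<lambda>_. std_normal_distribution).
      G x = ennreal (g (z + (\<Sum>i<m. x i *\<^sub>R A i)) powr a)"
  shows "(\<integral>\<^sup>+x. G x \<partial>Pi\<^sub>M {..<m} (\<lambda>_. std_normal_distribution))
    = ennreal (gauss_mean_iter a A m g z powr a)"
  using assms(1,3,4)
proof (induction m arbitrary: g G)
  case 0
  interpret product_sigma_finite "\<lambda>_ :: nat. std_normal_distribution"
    by (rule product_sigma_finite_std_normal)
  have "(\<integral>\<^sup>+x. G x \<partial>Pi\<^sub>M {..<0} (\<lambda>_. std_normal_distribution))
      = (\<integral>\<^sup>+x. ennreal (g z powr a) \<partial>Pi\<^sub>M {..<0 :: nat} (\<lambda>_. std_normal_distribution))"
    using 0(3) by (intro nn_integral_cong_AE) simp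
  also have "\<dots> = ennreal (g z powr a)" by (simp add: space_PiM_empty)
  finally show ?case by simp
next
  case (Suc m)
  let ?N = "std_normal_distribution"
  let ?P = "\<lambda>m. Pi\<^sub>M {..<m} (\<lambda>_ :: nat. ?N)"
  interpret product_sigma_finite "\<lambda>_ :: nat. ?N"
    by (rule product_sigma_finite_std_normal)
  define Q where "Q = (\<lambda>z. gauss_mean a (\<lambda>x. g (z + x *\<^sub>R A m)))"
  have ins: "{..<Suc m} = insert m {..<m}" by auto
  have "(\<lambda>(x, y). x(m := y)) \<in> ?P m \<Otimes>\<^sub>M ?N \<rightarrow>\<^sub>M ?P (Suc m)"
    unfolding ins by (rule measurable_add_dim)
  hence GG: "(\<lambda>(x, y). G (x(m := y))) \<in> borel_measurable (?P m \<Otimes>\<^sub>M ?N)"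
    using measurable_compose[OF _ Suc.prems(2)] by (simp add: case_prod_beta')
  have "AE x in ?P m. AE y in ?N. G (x(m := y)) = ennreal (g (z + (\<Sum>i<Suc m. (x(m := y)) i *\<^sub>R A i)) powr a)"
    using Suc.prems(3) unfolding ins by (intro AE_PiM_insert) auto
  hence "AE x in ?P m. (\<integral>\<^sup>+y. G (x(m := y)) \<partial>?N) = ennreal (Q (z + (\<Sum>i<m. x i *\<^sub>R A i)) powr a)"
  proof eventually_elim
    fix x :: "nat \<Rightarrow> real"
    assume ae: "AE y in ?N. G (x(m := y)) = ennreal (g (z + (\<Sum>i<Suc m. (x(m := y)) i *\<^sub>R A i)) powr a)"
    have "z + (\<Sum>i<Suc m. (x(m := y)) i *\<^sub>R A i) = z + (\<Sum>i<m. x i *\<^sub>R A i) + y *\<^sub>R A m" for y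
      by (simp add: add_ac)
    hence "(\<integral>\<^sup>+y. G (x(m := y)) \<partial>?N)
        = (\<integral>\<^sup>+y. ennreal (g (z + (\<Sum>i<m. x i *\<^sub>R A i) + y *\<^sub>R A m) powr a) \<partial>?N)"
      using ae by (intro nn_integral_cong_AE) (simp only:)
    thus "(\<integral>\<^sup>+y. G (x(m := y)) \<partial>?N) = ennreal (Q (z + (\<Sum>i<m. x i *\<^sub>R A i)) powr a)"
      unfolding Q_def by (simp only: gauss_mean_nn_integral[OF logconc_line[OF Suc.prems(1)] assms(2)])
  qed
  moreover have "logconc Q"
    unfolding Q_def by (rule logconc_gauss_mean_along[OF Suc.prems(1) assms(2)])
  ultimately have "(\<integral>\<^sup>+x. (\<integral>\<^sup>+y. G (x(m := y)) \<partial>?N) \<partial>?P m) = ennreal (gauss_mean_iter a A m Q z powr a)"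
    using M.borel_measurable_nn_integral[OF GG] by (intro Suc.IH)
  moreover have "(\<integral>\<^sup>+x. G x \<partial>?P (Suc m)) = (\<integral>\<^sup>+x. (\<integral>\<^sup>+y. G (x(m := y)) \<partial>?N) \<partial>?P m)"
    using Suc.prems(2) unfolding ins by (intro product_nn_integral_insert) auto
  ultimately show ?case by (simp add: Q_def)
qed

section \<open>Slopes of concave functions and the limit at exponent one\<close>

text \<open>\<open>E\<close> records a single equality in the concavity inequality with distinct
  points and positive weights, which is exactly the input of the equality case of the iterated
  inequality.\<close>

lemma concave_three_points:
  fixes G :: "real \<Rightarrow> real"
  assumes conc: "concave_on {0<..} G"
    and xyz: "0 < x" "x < y" "y < z"
  defines "E \<equiv> \<exists>x y p q. 0 < x \<and> 0 < y \<and> x \<noteq> y \<and> 0 < p \<and> 0 < q \<and> p + q = 1 \<and>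
      p * G x + q * G y = G (p * x + q * y)"
  shows "(z - y) * G x + (y - x) * G z \<le> (z - x) * G y"
    and "(z - y) * G x + (y - x) * G z = (z - x) * G y \<Longrightarrow> E"
proof -
  define p q where "p = (z - y) / (z - x)" and "q = (y - x) / (z - x)"
  have pq: "0 < p" "0 < q" "p + q = 1"
    using xyz by (auto simp: p_def q_def add_divide_distrib[symmetric])
  have m: "(z - x) * p = z - y" "(z - x) * q = y - x" using xyz by (auto simp: p_def q_def)
  have "(z - x) * (p * x + q * z) = ((z - x) * p) * x + ((z - x) * q) * z"
    by (simp add: algebra_simps)
  also have "\<dots> = (z - x) * y" unfolding m by (simp add: algebra_simps)
  finally have y: "p * x + q * z = y" using xyz by simp
  have s: "(z - y) * G x + (y - x) * G z = (z - x) * (p * G x + q * G z)"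
    unfolding m[symmetric] by (simp add: algebra_simps)
  have "p * G x + q * G z \<le> G y"
    using concave_onD[OF conc, of q x z] xyz pq y by (simp add: eq_diff_eq[symmetric, of p q 1])
  thus "(z - y) * G x + (y - x) * G z \<le> (z - x) * G y"
    unfolding s using xyz by (intro mult_left_mono) auto
  assume "(z - y) * G x + (y - x) * G z = (z - x) * G y"
  hence "p * G x + q * G z = G (p * x + q * z)" unfolding s y using xyz by simp
  thus E unfolding E_def using xyz pq
    by (intro exI[of _ x] exI[of _ z] exI[of _ p] exI[of _ q]) simp
qed

text \<open>Both slopes are taken from the point 1, where \<open>G\<close> vanishes, so this is the
  three point inequality for 1, \<open>\<alpha>\<close> and \<open>\<beta>\<close> in whichever
  order they stand; the sign of \<open>d\<close> accounts for the order.\<close>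

lemma concave_slope_antimono:
  fixes G :: "real \<Rightarrow> real"
  assumes conc: "concave_on {0<..} G"
    and G1: "G 1 = 0" and ab: "0 < \<alpha>" "\<alpha> < \<beta>" "\<alpha> \<noteq> 1" "\<beta> \<noteq> 1"
  defines "E \<equiv> \<exists>x y p q. 0 < x \<and> 0 < y \<and> x \<noteq> y \<and> 0 < p \<and> 0 < q \<and> p + q = 1 \<and>
      p * G x + q * G y = G (p * x + q * y)"
  shows "G \<beta> / (\<beta> - 1) \<le> G \<alpha> / (\<alpha> - 1)"
    and "G \<beta> / (\<beta> - 1) = G \<alpha> / (\<alpha> - 1) \<Longrightarrow> E"
proof -
  note T = concave_three_points[OF conc, folded E_def]
  define n where "n = G \<alpha> * (\<beta> - 1) - G \<beta> * (\<alpha> - 1)"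
  define d where "d = (\<alpha> - 1) * (\<beta> - 1)"
  have diff: "G \<alpha> / (\<alpha> - 1) - G \<beta> / (\<beta> - 1) = n / d"
    unfolding n_def d_def using ab by (intro diff_frac_eq) auto
  have d0: "d \<noteq> 0" using ab by (simp add: d_def)
  consider "1 < \<alpha>" | "\<alpha> < 1" "1 < \<beta>" | "\<beta> < 1" using ab by linarith
  hence n: "0 \<le> n / d \<and> (n = 0 \<longrightarrow> E)"
  proof cases
    case 1
    have "0 \<le> n" using T(1)[OF zero_less_one 1 ab(2)] unfolding n_def G1 by (simp add: mult.commute)
    moreover have "E" if "n = 0"
      by (rule T(2)[OF zero_less_one 1 ab(2)]) (use that in \<open>simp add: n_def G1 mult.commute\<close>)
    ultimately show ?thesis using 1 ab by (auto simp: d_def)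
  next
    case 2
    have "n \<le> 0" using T(1)[OF ab(1) 2] unfolding n_def G1 by (simp add: algebra_simps)
    moreover have "E" if "n = 0"
      by (rule T(2)[OF ab(1) 2]) (use that in \<open>simp add: n_def G1 algebra_simps\<close>)
    moreover have "d < 0" using 2 by (simp add: d_def mult_neg_pos)
    ultimately show ?thesis by (auto intro: divide_nonpos_neg)
  next
    case 3
    have "0 \<le> n" using T(1)[OF ab(1,2) 3] unfolding n_def G1 by (simp add: algebra_simps)
    moreover have "E" if "n = 0"
      by (rule T(2)[OF ab(1,2) 3]) (use that in \<open>simp add: n_def G1 algebra_simps\<close>)
    moreover have "0 < d" using 3 ab by (simp add: d_def mult_neg_neg)
    ultimately show ?thesis by auto
  qed
  show "G \<beta> / (\<beta> - 1) \<le> G \<alpha> / (\<alpha> - 1)" using n diff by linarith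
  assume "G \<beta> / (\<beta> - 1) = G \<alpha> / (\<alpha> - 1)"
  hence "n = 0" using diff d0 by simp
  with n show E by blast
qed

section \<open>Differentiating the moments at exponent one\<close>

text \<open>The exponent 1/4 is chosen so that multiplication by \<open>x powr a\<close> with
  \<open>1 / 2 \<le> a\<close> leaves only powers of positive order; the factor 4 is its
  reciprocal.\<close>

lemma abs_ln_le_powr:
  fixes x :: real
  assumes "0 < x"
  shows "\<bar>ln x\<bar> \<le> 4 * (x powr (1 / 4) + x powr (- (1 / 4)))"
proof -
  have b: "ln y \<le> 4 * y powr (1 / 4)" if "0 < y" for y :: real
  proof -
    have "ln (y powr (1 / 4)) \<le> y powr (1 / 4) - 1" using that by (intro ln_le_minus_one) simp
    thus ?thesis using that by (simp add: ln_powr)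
  qed
  have "ln x \<le> 4 * x powr (1 / 4)" by (rule b) fact
  moreover have "- ln x \<le> 4 * x powr (- (1 / 4))"
    using b[of "inverse x"] assms by (simp add: ln_inverse powr_minus inverse_powr)
  moreover have "0 \<le> x powr (1 / 4)" "0 \<le> x powr (- (1 / 4))" by simp_all
  ultimately show ?thesis unfolding abs_le_iff distrib_left by linarith
qed

lemma powr_le_powr_sum:
  fixes x :: real
  assumes "0 < x" "a \<le> c" "c \<le> b"
  shows "x powr c \<le> x powr a + x powr b"
proof (cases "1 \<le> x")
  case True
  hence "x powr c \<le> x powr b" using assms by (intro powr_mono) auto
  thus ?thesis by (simp add: add_increasing)
next
  case False
  hence "x powr c \<le> x powr a" using assms by (intro powr_mono') auto
  thus ?thesis by (simp add: add_increasing2)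
qed

text \<open>As a function of its exponent \<open>x powr a\<close> is convex, so the difference
  quotient between 1 and \<open>a\<close> lies between the derivatives at these two points. Minimum
  and maximum cover both orders of 1 and \<open>a\<close>.\<close>

lemma powr_diff_quotient_bounds:
  fixes x a :: real
  assumes "0 < x" "a \<noteq> 1"
  shows "min (x * ln x) (x powr a * ln x) \<le> (x powr a - x) / (a - 1)"
    and "(x powr a - x) / (a - 1) \<le> max (x * ln x) (x powr a * ln x)"
proof -
  have e: "x powr a = x * exp ((a - 1) * ln x)" "x = x powr a * exp ((1 - a) * ln x)"
    using assms by (simp_all add: powr_def exp_diff left_diff_distrib)
  have "x * (1 + (a - 1) * ln x) \<le> x powr a"
    unfolding e(1) using assms by (intro mult_left_mono exp_ge_add_one_self) auto
  hence lo: "(a - 1) * (x * ln x) \<le> x powr a - x" by (simp add: algebra_simps)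
  have "x powr a * (1 + (1 - a) * ln x) \<le> x powr a * exp ((1 - a) * ln x)"
    by (intro mult_left_mono exp_ge_add_one_self) auto
  hence hi: "x powr a - x \<le> (a - 1) * (x powr a * ln x)"
    unfolding e(2)[symmetric] by (simp add: algebra_simps)
  consider "0 < a - 1" | "a - 1 < 0" using assms by linarith
  hence "min (x * ln x) (x powr a * ln x) \<le> (x powr a - x) / (a - 1) \<and>
    (x powr a - x) / (a - 1) \<le> max (x * ln x) (x powr a * ln x)"
  proof cases
    case 1
    hence "x * ln x \<le> (x powr a - x) / (a - 1)" "(x powr a - x) / (a - 1) \<le> x powr a * ln x"
      using lo hi by (simp_all add: pos_le_divide_eq pos_divide_le_eq mult.commute)
    thus ?thesis by linarith
  next
    case 2
    hence "(x powr a - x) / (a - 1) \<le> x * ln x" "x powr a * ln x \<le> (x powr a - x) / (a - 1)"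
      using lo hi by (simp_all add: neg_le_divide_eq neg_divide_le_eq mult.commute)
    thus ?thesis by linarith
  qed
  thus "min (x * ln x) (x powr a * ln x) \<le> (x powr a - x) / (a - 1)"
    "(x powr a - x) / (a - 1) \<le> max (x * ln x) (x powr a * ln x)" by auto
qed

lemma powr_mult_ln_bound:
  fixes x :: real
  assumes "0 \<le> x" "1 / 2 \<le> a" "a \<le> 2"
  shows "\<bar>x powr a * ln x\<bar> \<le> 8 * (x powr (1 / 4) + x powr 3)"
proof (cases "x = 0")
  case False
  hence x: "0 < x" using assms by simp
  have "\<bar>x powr a * ln x\<bar> \<le> x powr a * (4 * (x powr (1 / 4) + x powr (- (1 / 4))))"
    unfolding abs_mult using abs_ln_le_powr[OF x] by (auto intro!: mult_mono)
  also have "\<dots> = 4 * (x powr (a + 1 / 4) + x powr (a - 1 / 4))"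
  proof -
    have "x powr (a - 1 / 4) = x powr a * x powr (- (1 / 4))"
      using powr_add[of x a "- (1 / 4)"] by simp
    thus ?thesis by (simp only: powr_add) (simp add: algebra_simps)
  qed
  also have "\<dots> \<le> 4 * ((x powr (1 / 4) + x powr 3) + (x powr (1 / 4) + x powr 3))"
    using assms x by (intro mult_left_mono add_mono powr_le_powr_sum) auto
  finally show ?thesis by simp
qed simp

text \<open>Dominated convergence: for exponents in \<open>{1 / 2..2}\<close> the dominating
  function \<open>w\<close> uses only the moments of order 1/4 and 3. Where \<open>D\<close>
  vanishes, \<open>0 powr a = 0\<close> makes all terms zero.\<close>

lemma (in prob_space) powr_moment_derivative:
  fixes D :: "'a \<Rightarrow> real"
  assumes [measurable]: "D \<in> borel_measurable M" and nonneg: "\<And>x. 0 \<le> D x"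
    and int: "\<And>a. 0 < a \<Longrightarrow> integrable M (\<lambda>x. D x powr a)"
  shows "integrable M (\<lambda>x. D x * ln (D x))"
    and "(\<And>n. 1 / 2 \<le> a n) \<Longrightarrow> (\<And>n. a n \<le> 2) \<Longrightarrow> (\<And>n. a n \<noteq> 1) \<Longrightarrow> a \<longlonglongrightarrow> 1 \<Longrightarrow>
      (\<lambda>n. ((LINT x|M. D x powr a n) - (LINT x|M. D x)) / (a n - 1)) \<longlonglongrightarrow> (LINT x|M. D x * ln (D x))"
proof -
  define w where "w = (\<lambda>x. 8 * (D x powr (1 / 4) + D x powr 3))"
  have iw: "integrable M w" unfolding w_def by (intro integrable_mult_right Bochner_Integration.integrable_add int) auto
  have D1: "D x powr 1 = D x" for x using nonneg[of x] by simp
  have iD: "integrable M D" using int[of 1] by (simp only: D1)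
  have w: "\<bar>D x * ln (D x)\<bar> \<le> w x" for x
    using powr_mult_ln_bound[of "D x" 1] nonneg[of x] by (simp add: w_def)
  show I: "integrable M (\<lambda>x. D x * ln (D x))"
    by (rule Bochner_Integration.integrable_bound[OF iw])
       (use w in \<open>auto intro!: AE_I2 order_trans[OF _ abs_ge_self]\<close>)
  assume a: "\<And>n. 1 / 2 \<le> a n" "\<And>n. a n \<le> 2" "\<And>n. a n \<noteq> 1" "a \<longlonglongrightarrow> 1"
  define d where "d = (\<lambda>n x. (D x powr a n - D x) / (a n - 1))"
  have bounds: "min (D x * ln (D x)) (D x powr a n * ln (D x)) \<le> d n x \<and>
      d n x \<le> max (D x * ln (D x)) (D x powr a n * ln (D x))" for n x
  proof (cases "D x = 0")
    case False
    thus ?thesis using powr_diff_quotient_bounds[of "D x" "a n"] a(3) nonneg[of x] by (simp add: d_def)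
  qed (simp add: d_def)
  have "(\<lambda>n. LINT x|M. d n x) \<longlonglongrightarrow> (LINT x|M. D x * ln (D x))"
  proof (rule integral_dominated_convergence[where w = w])
    show "AE x in M. (\<lambda>n. d n x) \<longlonglongrightarrow> D x * ln (D x)"
    proof (intro AE_I2)
      fix x
      have "(\<lambda>n. D x powr a n * ln (D x)) \<longlonglongrightarrow> D x powr 1 * ln (D x)"
      proof (cases "D x = 0")
        case False
        thus ?thesis by (intro tendsto_intros a) auto
      qed simp
      hence lim: "(\<lambda>n. D x powr a n * ln (D x)) \<longlonglongrightarrow> D x * ln (D x)" by (simp only: D1)
      show "(\<lambda>n. d n x) \<longlonglongrightarrow> D x * ln (D x)"
        by (rule tendsto_sandwich[of "\<lambda>n. min (D x * ln (D x)) (D x powr a n * ln (D x))" _ _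
              "\<lambda>n. max (D x * ln (D x)) (D x powr a n * ln (D x))"])
           (use bounds tendsto_min[OF tendsto_const lim, of "D x * ln (D x)"]
             tendsto_max[OF tendsto_const lim, of "D x * ln (D x)"] in auto)
    qed
    show "AE x in M. norm (d n x) \<le> w x" for n
    proof (intro AE_I2)
      fix x
      have "\<bar>D x powr a n * ln (D x)\<bar> \<le> w x"
        using powr_mult_ln_bound[of "D x" "a n"] nonneg[of x] a by (simp add: w_def)
      thus "norm (d n x) \<le> w x" using bounds[of x n] w[of x] by auto
    qed
  qed (use iw in \<open>auto simp: d_def\<close>)
  moreover have "(LINT x|M. d n x) = ((LINT x|M. D x powr a n) - (LINT x|M. D x)) / (a n - 1)" for n
  proof -
    have "0 < a n" using a(1)[of n] by simp
    thus ?thesis unfolding d_def using iD int by simp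
  qed
  ultimately show "(\<lambda>n. ((LINT x|M. D x powr a n) - (LINT x|M. D x)) / (a n - 1))
      \<longlonglongrightarrow> (LINT x|M. D x * ln (D x))" by simp
qed

text \<open>Since \<open>f\<close> never takes the value \<infinity>, \<open>enn2real\<close> loses
  no information.\<close>

lemma logconc_of_ext_concave:
  fixes f :: "'v::real_vector \<Rightarrow> ereal"
  assumes "ext_concave f"
  shows "logconc (\<lambda>x. enn2real (exp_ereal (f x)))"
    and "ennreal (enn2real (exp_ereal (f x))) = exp_ereal (f x)"
proof -
  have fin: "f x \<noteq> \<infinity>" for x using assms by (simp add: ext_concave_def)
  show "ennreal (enn2real (exp_ereal (f x))) = exp_ereal (f x)"
    using fin[of x] by (simp add: exp_ereal_def)
  show "logconc (\<lambda>x. enn2real (exp_ereal (f x)))"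
    unfolding logconc_def
  proof (intro conjI allI impI)
    fix x y :: 'v and t :: real assume t: "0 < t" "t < 1"
    let ?z = "(1 - t) *\<^sub>R x + t *\<^sub>R y"
    show "enn2real (exp_ereal (f x)) powr (1 - t) * enn2real (exp_ereal (f y)) powr t
        \<le> enn2real (exp_ereal (f ?z))"
    proof (cases "f x = -\<infinity> \<or> f y = -\<infinity>")
      case True
      thus ?thesis by (auto simp: exp_ereal_def)
    next
      case False
      then obtain r s where rs: "f x = ereal r" "f y = ereal s"
        using fin by (metis ereal_cases)
      have "ereal ((1 - t) * r + t * s) \<le> f ?z"
        using assms[unfolded ext_concave_def, THEN conjunct2, rule_format, of t x y] t by (simp add: rs)
      then obtain u where u: "f ?z = ereal u" "(1 - t) * r + t * s \<le> u"
        using fin[of ?z] by (cases "f ?z") auto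
      have "exp r powr (1 - t) * exp s powr t = exp ((1 - t) * r + t * s)"
        by (simp add: powr_def exp_add)
      also have "\<dots> \<le> exp u" using u by simp
      finally show ?thesis by (simp add: exp_ereal_def rs u)
    qed
  qed simp
qed

section \<open>Translations of Gaussian measures\<close>

lemma measurable_gauss_affine [measurable]:
  fixes a :: "nat \<Rightarrow> 'v::euclidean_space"
  shows "(\<lambda>x. b + (\<Sum>i<m. x i *\<^sub>R a i)) \<in> borel_measurable (Pi\<^sub>M {..<m} (\<lambda>_. std_normal_distribution))"
proof -
  have "(\<lambda>x. x i) \<in> borel_measurable (Pi\<^sub>M {..<m} (\<lambda>_. std_normal_distribution))" if "i < m" for i
    using measurable_component_singleton[of i "{..<m}" "\<lambda>_. std_normal_distribution"] that
    by (simp cong: measurable_cong_sets)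
  thus ?thesis
    by (intro borel_measurable_add borel_measurable_const borel_measurable_sum borel_measurable_scaleR) auto
qed

lemma prob_space_std_normal_PiM: "prob_space (Pi\<^sub>M I (\<lambda>_. std_normal_distribution))"
  by (intro prob_space_PiM real_distribution.axioms(1) real_dist_normal_dist)

text \<open>The Cameron-Martin formula on the line: completing the square recentres the Gaussian
  density at \<open>k\<close>.\<close>

lemma std_normal_shift:
  fixes H :: "real \<Rightarrow> ennreal"
  assumes [measurable]: "H \<in> borel_measurable borel"
  shows "(\<integral>\<^sup>+x. H x * ennreal (exp (k * x)) \<partial>std_normal_distribution)
    = ennreal (exp (k\<^sup>2 / 2)) * (\<integral>\<^sup>+x. H (x + k) \<partial>std_normal_distribution)"
proof -
  have "(\<integral>\<^sup>+x. H x * ennreal (exp (k * x)) \<partial>std_normal_distribution)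
      = (\<integral>\<^sup>+x. ennreal (std_normal_density x) * (H x * ennreal (exp (k * x))) \<partial>lborel)"
    by (rule nn_integral_density) measurable
  also have "\<dots> = (\<integral>\<^sup>+x. ennreal (exp (k\<^sup>2 / 2)) * (ennreal (normal_density k 1 x) * H x) \<partial>lborel)"
  proof (rule nn_integral_cong)
    fix x
    have "ennreal (std_normal_density x) * ennreal (exp (k * x))
        = ennreal (exp (k\<^sup>2 / 2)) * ennreal (normal_density k 1 x)"
      by (simp only: ennreal_mult'[symmetric] exp_ge_zero normal_density_nonneg std_normal_density_exp)
    thus "ennreal (std_normal_density x) * (H x * ennreal (exp (k * x)))
        = ennreal (exp (k\<^sup>2 / 2)) * (ennreal (normal_density k 1 x) * H x)"
      by (metis mult.assoc mult.commute)
  qed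
  also have "\<dots> = ennreal (exp (k\<^sup>2 / 2)) * (\<integral>\<^sup>+x. ennreal (normal_density k 1 x) * H x \<partial>lborel)"
    by (rule nn_integral_cmult) measurable
  also have "(\<integral>\<^sup>+x. ennreal (normal_density k 1 x) * H x \<partial>lborel)
      = (\<integral>\<^sup>+x. ennreal (normal_density k 1 (k + x)) * H (k + x) \<partial>lborel)"
    using nn_integral_real_affine[of "\<lambda>x. ennreal (normal_density k 1 x) * H x" 1 k] by simp
  also have "\<dots> = (\<integral>\<^sup>+x. ennreal (std_normal_density x) * H (x + k) \<partial>lborel)"
    by (simp add: normal_density_def add.commute)
  also have "\<dots> = (\<integral>\<^sup>+x. H (x + k) \<partial>std_normal_distribution)"
    by (rule nn_integral_density[symmetric]) measurable
  finally show ?thesis .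
qed

text \<open>An exponential tilt by \<open>k\<close> shifts the coordinates by \<open>k\<close>,
  hence their image by \<open>\<Sum>i<m. k i *\<^sub>R a i\<close>. In the induction the last
  coordinate is absorbed into the base point \<open>b\<close>.\<close>

lemma PiM_std_normal_shift:
  fixes a :: "nat \<Rightarrow> 'v::euclidean_space" and \<Phi> :: "'v \<Rightarrow> ennreal"
  assumes [measurable]: "\<Phi> \<in> borel_measurable borel"
  shows "(\<integral>\<^sup>+x. \<Phi> (b + (\<Sum>i<m. x i *\<^sub>R a i)) * ennreal (exp (\<Sum>i<m. k i * x i))
      \<partial>Pi\<^sub>M {..<m} (\<lambda>_. std_normal_distribution))
    = ennreal (exp ((\<Sum>i<m. (k i)\<^sup>2) / 2)) *
      (\<integral>\<^sup>+x. \<Phi> (b + (\<Sum>i<m. k i *\<^sub>R a i) + (\<Sum>i<m. x i *\<^sub>R a i))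
      \<partial>Pi\<^sub>M {..<m} (\<lambda>_. std_normal_distribution))"
proof (induction m arbitrary: b)
  case (Suc m)
  let ?N = "std_normal_distribution"
  let ?P = "\<lambda>m. Pi\<^sub>M {..<m} (\<lambda>_ :: nat. ?N)"
  interpret product_sigma_finite "\<lambda>_ :: nat. ?N"
    by (rule product_sigma_finite_std_normal)
  interpret P: prob_space "?P m" by (rule prob_space_std_normal_PiM)
  have ins: "{..<Suc m} = insert m {..<m}" by auto
  have comp: "(\<lambda>x. x i) \<in> borel_measurable (?P n)" if "i < n" for i n
    using measurable_component_singleton[of i "{..<n}" "\<lambda>_. ?N"] that
    by (simp cong: measurable_cong_sets)
  define S where "S = (\<lambda>x. \<Sum>i<m. x i *\<^sub>R a i)"
  define K where "K = S k"
  define l where "l = (\<lambda>x. \<Sum>i<m. k i * x i)"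
  define q where "q = (\<Sum>i<m. (k i)\<^sup>2)"
  have [measurable]: "S \<in> borel_measurable (?P m)"
    unfolding S_def using measurable_gauss_affine[of 0 a m] by simp
  have [measurable]: "l \<in> borel_measurable (?P m)"
    unfolding l_def by (intro borel_measurable_sum borel_measurable_times borel_measurable_const comp) auto
  have upd: "(\<Sum>i<Suc m. (x(m := y)) i *\<^sub>R a i) = S x + y *\<^sub>R a m"
    "(\<Sum>i<Suc m. k i * (x(m := y)) i) = l x + k m * y" for x y
    by (simp_all add: S_def l_def)
  define H where "H = (\<lambda>y. \<integral>\<^sup>+x. \<Phi> (b + y *\<^sub>R a m + K + S x) \<partial>?P m)"
  have "(\<lambda>(y, x). \<Phi> (b + y *\<^sub>R a m + K + S x)) \<in> borel_measurable (borel \<Otimes>\<^sub>M ?P m)"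
    by measurable
  from P.borel_measurable_nn_integral[OF this]
  have [measurable]: "H \<in> borel_measurable borel" unfolding H_def .
  have m1: "(\<lambda>x. \<Phi> (b + (\<Sum>i<Suc m. x i *\<^sub>R a i)) * ennreal (exp (\<Sum>i<Suc m. k i * x i)))
      \<in> borel_measurable (?P (Suc m))"
    by (intro borel_measurable_times_ennreal measurable_compose[OF measurable_gauss_affine assms]
        measurable_compose[OF _ measurable_ennreal] borel_measurable_exp borel_measurable_sum
        borel_measurable_times borel_measurable_const comp) auto
  have IH: "(\<integral>\<^sup>+x. \<Phi> (c + S x) * ennreal (exp (l x)) \<partial>?P m)
      = ennreal (exp (q / 2)) * (\<integral>\<^sup>+x. \<Phi> (c + K + S x) \<partial>?P m)" for c
    using Suc.IH[of c] by (simp add: S_def l_def q_def K_def)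
  have "(\<integral>\<^sup>+x. \<Phi> (b + (\<Sum>i<Suc m. x i *\<^sub>R a i)) * ennreal (exp (\<Sum>i<Suc m. k i * x i)) \<partial>?P (Suc m))
      = (\<integral>\<^sup>+y. (\<integral>\<^sup>+x. \<Phi> (b + (S x + y *\<^sub>R a m)) * ennreal (exp (l x + k m * y)) \<partial>?P m) \<partial>?N)"
    using product_nn_integral_insert_rev[OF _ _ m1[unfolded ins], folded ins] by (simp only: upd) simp
  also have "\<dots> = (\<integral>\<^sup>+y. ennreal (exp (q / 2)) * (H y * ennreal (exp (k m * y))) \<partial>?N)"
  proof (rule nn_integral_cong)
    fix y
    have "(\<integral>\<^sup>+x. \<Phi> (b + (S x + y *\<^sub>R a m)) * ennreal (exp (l x + k m * y)) \<partial>?P m)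
        = (\<integral>\<^sup>+x. \<Phi> ((b + y *\<^sub>R a m) + S x) * ennreal (exp (l x)) * ennreal (exp (k m * y)) \<partial>?P m)"
      by (simp add: exp_add ennreal_mult' mult.assoc add_ac)
    also have "\<dots> = (\<integral>\<^sup>+x. \<Phi> ((b + y *\<^sub>R a m) + S x) * ennreal (exp (l x)) \<partial>?P m) * ennreal (exp (k m * y))"
      by (rule nn_integral_multc) measurable
    also have "\<dots> = ennreal (exp (q / 2)) * (H y * ennreal (exp (k m * y)))"
      unfolding IH H_def by (simp only: mult.assoc)
    finally show "(\<integral>\<^sup>+x. \<Phi> (b + (S x + y *\<^sub>R a m)) * ennreal (exp (l x + k m * y)) \<partial>?P m)
        = ennreal (exp (q / 2)) * (H y * ennreal (exp (k m * y)))" .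
  qed
  also have "\<dots> = ennreal (exp (q / 2)) * (\<integral>\<^sup>+y. H y * ennreal (exp (k m * y)) \<partial>?N)"
    by (rule nn_integral_cmult) measurable
  also have "\<dots> = ennreal (exp (q / 2)) * (ennreal (exp ((k m)\<^sup>2 / 2)) * (\<integral>\<^sup>+y. H (y + k m) \<partial>?N))"
    by (simp only: std_normal_shift[OF \<open>H \<in> borel_measurable borel\<close>])
  also have "\<dots> = ennreal (exp ((\<Sum>i<Suc m. (k i)\<^sup>2) / 2)) * (\<integral>\<^sup>+y. H (y + k m) \<partial>?N)"
    by (simp add: mult.assoc[symmetric] ennreal_mult'[symmetric] exp_add[symmetric] q_def add_divide_distrib)
  also have "(\<integral>\<^sup>+y. H (y + k m) \<partial>?N)
      = (\<integral>\<^sup>+x. \<Phi> (b + (\<Sum>i<Suc m. k i *\<^sub>R a i) + (\<Sum>i<Suc m. x i *\<^sub>R a i)) \<partial>?P (Suc m))"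
  proof -
    have m2: "(\<lambda>x. \<Phi> (b + (\<Sum>i<Suc m. k i *\<^sub>R a i) + (\<Sum>i<Suc m. x i *\<^sub>R a i))) \<in> borel_measurable (?P (Suc m))"
      by (rule measurable_compose[OF measurable_gauss_affine assms])
    have "(\<integral>\<^sup>+x. \<Phi> (b + (\<Sum>i<Suc m. k i *\<^sub>R a i) + (\<Sum>i<Suc m. x i *\<^sub>R a i)) \<partial>?P (Suc m))
        = (\<integral>\<^sup>+y. (\<integral>\<^sup>+x. \<Phi> (b + (\<Sum>i<Suc m. k i *\<^sub>R a i) + (S x + y *\<^sub>R a m)) \<partial>?P m) \<partial>?N)"
      using product_nn_integral_insert_rev[OF _ _ m2[unfolded ins], folded ins] by (simp only: upd) simp
    also have "\<dots> = (\<integral>\<^sup>+y. H (y + k m) \<partial>?N)"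
      unfolding H_def K_def S_def by (simp add: scaleR_left_distrib add_ac)
    finally show ?thesis ..
  qed
  finally show ?case .
qed (simp add: space_PiM_empty)

lemma distr_gauss_translate_emeasure:
  fixes a :: "nat \<Rightarrow> 'v::euclidean_space" and b :: 'v and m :: nat
  defines "P \<equiv> Pi\<^sub>M {..<m} (\<lambda>_. std_normal_distribution)"
  assumes B: "B \<in> sets borel"
  shows "emeasure (distr (distr P borel (\<lambda>x. b + (\<Sum>i<m. x i *\<^sub>R a i))) borel (\<lambda>x. x + v)) B
    = (\<integral>\<^sup>+x. indicator B (b + v + (\<Sum>i<m. x i *\<^sub>R a i)) \<partial>P)"
proof -
  have T: "(\<lambda>x. c + (\<Sum>i<m. x i *\<^sub>R a i)) \<in> borel_measurable P" for c
    unfolding P_def by (rule measurable_gauss_affine)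
  have "emeasure (distr (distr P borel (\<lambda>x. b + (\<Sum>i<m. x i *\<^sub>R a i))) borel (\<lambda>x. x + v)) B
      = emeasure (distr P borel (\<lambda>x. (b + v) + (\<Sum>i<m. x i *\<^sub>R a i))) B"
    using T by (subst distr_distr) (auto simp: comp_def add_ac)
  also have "\<dots> = (\<integral>\<^sup>+x. indicator B x \<partial>distr P borel (\<lambda>x. (b + v) + (\<Sum>i<m. x i *\<^sub>R a i)))"
    using B by simp
  also have "\<dots> = (\<integral>\<^sup>+x. indicator B (b + v + (\<Sum>i<m. x i *\<^sub>R a i)) \<partial>P)"
    using B by (intro nn_integral_distr T) auto
  finally show ?thesis .
qed

text \<open>The density has to be a function of the point \<open>x\<close>, whose coordinates need
  not be unique. Tilts of the form \<open>k i = a i \<bullet> w\<close> achieve this, because then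
  \<open>\<Sum>i<m. k i * x i\<close> is the inner product of \<open>w\<close> with the centred
  point.\<close>

lemma gauss_translate_density:
  fixes a :: "nat \<Rightarrow> 'v::euclidean_space" and b :: 'v and m :: nat
  defines "\<gamma> \<equiv> distr (Pi\<^sub>M {..<m} (\<lambda>_. std_normal_distribution)) borel (\<lambda>x. b + (\<Sum>i<m. x i *\<^sub>R a i))"
  shows "density \<gamma> (\<lambda>x. ennreal (exp ((x - b) \<bullet> w - (\<Sum>i<m. (a i \<bullet> w)\<^sup>2) / 2)))
    = distr \<gamma> borel (\<lambda>x. x + (\<Sum>i<m. (a i \<bullet> w) *\<^sub>R a i))"
proof (rule measure_eqI)
  let ?P = "Pi\<^sub>M {..<m} (\<lambda>_ :: nat. std_normal_distribution)"
  let ?T = "\<lambda>x. b + (\<Sum>i<m. x i *\<^sub>R a i)"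
  define q where "q = (\<Sum>i<m. (a i \<bullet> w)\<^sup>2)"
  show "sets (density \<gamma> (\<lambda>x. ennreal (exp ((x - b) \<bullet> w - (\<Sum>i<m. (a i \<bullet> w)\<^sup>2) / 2))))
      = sets (distr \<gamma> borel (\<lambda>x. x + (\<Sum>i<m. (a i \<bullet> w) *\<^sub>R a i)))"
    by (simp add: \<gamma>_def)
  fix B assume "B \<in> sets (density \<gamma> (\<lambda>x. ennreal (exp ((x - b) \<bullet> w - (\<Sum>i<m. (a i \<bullet> w)\<^sup>2) / 2))))"
  hence B [measurable]: "B \<in> sets borel" by (simp add: \<gamma>_def)
  have "emeasure (density \<gamma> (\<lambda>x. ennreal (exp ((x - b) \<bullet> w - q / 2)))) B
      = (\<integral>\<^sup>+x. ennreal (exp ((x - b) \<bullet> w - q / 2)) * indicator B x \<partial>\<gamma>)"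
    by (rule emeasure_density) (simp_all add: \<gamma>_def)
  also have "\<dots> = (\<integral>\<^sup>+x. ennreal (exp ((?T x - b) \<bullet> w - q / 2)) * indicator B (?T x) \<partial>?P)"
    unfolding \<gamma>_def by (rule nn_integral_distr) measurable
  also have "\<dots> = (\<integral>\<^sup>+x. ennreal (exp (- q / 2)) *
      (indicator B (?T x) * ennreal (exp (\<Sum>i<m. (a i \<bullet> w) * x i))) \<partial>?P)"
  proof (rule nn_integral_cong)
    fix x :: "nat \<Rightarrow> real"
    have "(?T x - b) \<bullet> w - q / 2 = - q / 2 + (\<Sum>i<m. (a i \<bullet> w) * x i)"
      by (simp add: inner_sum_left mult.commute)
    hence "ennreal (exp ((?T x - b) \<bullet> w - q / 2))
        = ennreal (exp (- q / 2)) * ennreal (exp (\<Sum>i<m. (a i \<bullet> w) * x i))"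
      by (simp only: exp_add) (simp add: ennreal_mult')
    thus "ennreal (exp ((?T x - b) \<bullet> w - q / 2)) * indicator B (?T x)
        = ennreal (exp (- q / 2)) * (indicator B (?T x) * ennreal (exp (\<Sum>i<m. (a i \<bullet> w) * x i)))"
      by (simp only: mult_ac)
  qed
  also have "\<dots> = ennreal (exp (- q / 2)) *
      (\<integral>\<^sup>+x. indicator B (?T x) * ennreal (exp (\<Sum>i<m. (a i \<bullet> w) * x i)) \<partial>?P)"
  proof (rule nn_integral_cmult)
    have comp: "(\<lambda>x. x i) \<in> borel_measurable ?P" if "i < m" for i
      using measurable_component_singleton[of i "{..<m}" "\<lambda>_. std_normal_distribution"] that
      by (simp cong: measurable_cong_sets)
    show "(\<lambda>x. indicator B (?T x) * ennreal (exp (\<Sum>i<m. (a i \<bullet> w) * x i))) \<in> borel_measurable ?P"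
      by (intro borel_measurable_times_ennreal measurable_compose[OF measurable_gauss_affine borel_measurable_indicator]
          measurable_compose[OF _ measurable_ennreal] borel_measurable_exp borel_measurable_sum
          borel_measurable_times borel_measurable_const comp B) auto
  qed
  also have "\<dots> = ennreal (exp (- q / 2)) * (ennreal (exp (q / 2)) *
      (\<integral>\<^sup>+x. indicator B (b + (\<Sum>i<m. (a i \<bullet> w) *\<^sub>R a i) + (\<Sum>i<m. x i *\<^sub>R a i)) \<partial>?P))"
    unfolding q_def by (subst PiM_std_normal_shift) auto
  also have "\<dots> = (\<integral>\<^sup>+x. indicator B (b + (\<Sum>i<m. (a i \<bullet> w) *\<^sub>R a i) + (\<Sum>i<m. x i *\<^sub>R a i)) \<partial>?P)"
    by (simp add: mult.assoc[symmetric] ennreal_mult'[symmetric] exp_add[symmetric])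
  also have "\<dots> = emeasure (distr \<gamma> borel (\<lambda>x. x + (\<Sum>i<m. (a i \<bullet> w) *\<^sub>R a i))) B"
    unfolding \<gamma>_def by (rule distr_gauss_translate_emeasure[OF B, symmetric])
  finally show "emeasure (density \<gamma> (\<lambda>x. ennreal (exp ((x - b) \<bullet> w - (\<Sum>i<m. (a i \<bullet> w)\<^sup>2) / 2)))) B
      = emeasure (distr \<gamma> borel (\<lambda>x. x + (\<Sum>i<m. (a i \<bullet> w) *\<^sub>R a i))) B"
    unfolding q_def .
qed

text \<open>\<open>L\<close> is the covariance operator, and its range is the whole column span: if
  \<open>z\<close> is orthogonal to the range, then \<open>z \<bullet> L z\<close> is the sum of the
  squares of \<open>a i \<bullet> z\<close>, so \<open>z\<close> is orthogonal to every
  column.\<close>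

lemma span_columns_imp_range:
  fixes a :: "nat \<Rightarrow> 'v::euclidean_space"
  assumes "v \<in> span (a ` {..<m})"
  obtains w where "v = (\<Sum>i<m. (a i \<bullet> w) *\<^sub>R a i)"
proof -
  define L where "L = (\<lambda>w. \<Sum>i<m. (a i \<bullet> w) *\<^sub>R a i)"
  have "linear L"
    unfolding L_def by (intro linearI) (simp_all add: inner_right_distrib scaleR_left_distrib sum.distrib scaleR_sum_right)
  hence "subspace (range L)" by (intro linear_subspace_image) auto
  hence sp: "span (range L) = range L" by simp
  obtain y z where yz: "y \<in> span (range L)" "\<And>w. w \<in> span (range L) \<Longrightarrow> orthogonal z w" "v = y + z"
    using orthogonal_subspace_decomp_exists[of "range L" v] by blast
  have "z \<bullet> L z = 0" using yz(2)[of "L z"] sp by (simp add: orthogonal_def)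
  hence "(\<Sum>i<m. (a i \<bullet> z)\<^sup>2) = 0"
    by (simp add: L_def inner_sum_right inner_commute power2_eq_square)
  hence az: "a i \<bullet> z = 0" if "i < m" for i
    using that by (simp add: sum_nonneg_eq_0_iff)
  have zs: "orthogonal z x" if "x \<in> span (a ` {..<m})" for x
    using that az by (intro orthogonal_to_span[OF that]) (auto simp: orthogonal_def inner_commute)
  obtain w where w: "y = L w" using yz(1) sp by auto
  have "y \<in> span (a ` {..<m})"
    unfolding w L_def by (intro span_sum span_scale span_base) auto
  hence "z \<in> span (a ` {..<m})" using assms yz(3) span_diff[of v _ y] by simp
  hence "z = 0" using zs[of z] by (simp add: orthogonal_def)
  thus ?thesis using that[of w] yz(3) w by (simp add: L_def)
qed

text \<open>The measure lives on the affine subspace through \<open>b\<close> in the directions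
  \<open>V\<close>, and absolute continuity forces the translate to live there as well. So some
  \<open>x\<close> has both \<open>x\<close> and \<open>x + v\<close> in it.\<close>

lemma gauss_translate_in_span:
  fixes a :: "nat \<Rightarrow> 'v::euclidean_space" and b :: 'v and m :: nat
  defines "\<gamma> \<equiv> distr (Pi\<^sub>M {..<m} (\<lambda>_. std_normal_distribution)) borel (\<lambda>x. b + (\<Sum>i<m. x i *\<^sub>R a i))"
  assumes ac: "absolutely_continuous \<gamma> (distr \<gamma> borel (\<lambda>x. x + v))"
  shows "v \<in> span (a ` {..<m})"
proof -
  interpret P: prob_space "Pi\<^sub>M {..<m} (\<lambda>_ :: nat. std_normal_distribution)"
    by (rule prob_space_std_normal_PiM)
  interpret prob_space \<gamma> unfolding \<gamma>_def by (rule P.prob_space_distr) measurable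
  define V where "V = span (a ` {..<m})"
  have [measurable]: "{x. x - b \<in> V} \<in> sets borel"
  proof -
    have "{x. x - b \<in> V} = (\<lambda>x. x - b) -` V" by auto
    moreover have "closed ((\<lambda>x. x - b) -` V)"
      by (intro closed_vimage continuous_intros) (simp add: V_def closed_span)
    ultimately show ?thesis by simp
  qed
  have 1: "AE x in \<gamma>. x - b \<in> V"
  proof -
    have "(\<Sum>i<m. x i *\<^sub>R a i) \<in> V" for x :: "nat \<Rightarrow> real"
      unfolding V_def by (intro span_sum span_scale span_base) auto
    thus ?thesis unfolding \<gamma>_def by (subst AE_distr_iff) auto
  qed
  have "AE x in distr \<gamma> borel (\<lambda>x. x + v). x - b \<in> V"
    using ac 1 by (intro absolutely_continuous_AE[of "distr \<gamma> borel (\<lambda>x. x + v)" \<gamma>]) (auto simp: \<gamma>_def)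
  hence 2: "AE x in \<gamma>. x + v - b \<in> V"
    by (subst (asm) AE_distr_iff) (auto simp: \<gamma>_def)
  have "AE x in \<gamma>. v \<in> V"
    using 1 2
  proof eventually_elim
    fix x assume "x - b \<in> V" "x + v - b \<in> V"
    hence "(x + v - b) - (x - b) \<in> V" unfolding V_def by (rule span_diff[rotated])
    thus "v \<in> V" by simp
  qed
  thus ?thesis by (simp add: V_def)
qed

section \<open>Renyi divergences from a Gaussian measure\<close>

lemma renyi_divergence_eq_moment:
  assumes "\<alpha> \<noteq> 1" "0 < c"
    and "(\<integral>\<^sup>+x. ennreal (enn2real (RN_deriv \<nu> \<mu> x) powr \<alpha>) \<partial>\<nu>) = ennreal c"
  shows "renyi_divergence \<alpha> \<mu> \<nu> = ereal (ln c / (\<alpha> - 1))"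
  unfolding renyi_divergence_def assms(3) using assms(1,2) by (simp add: ln_ennreal_def)

text \<open>A power of the density is again a tilt: up to the factor
  \<open>exp (\<alpha> * (\<alpha> - 1) * q / 2)\<close> it is the density for
  \<open>\<alpha> *\<^sub>R w\<close> in place of \<open>w\<close>, which has integral one.\<close>

lemma gaussian_translate_renyi:
  fixes \<gamma> :: "(real^'n) measure"
  assumes "gaussian_measure \<gamma>" and ac: "absolutely_continuous \<gamma> (distr \<gamma> borel (\<lambda>x. x + v))"
  obtains c where "\<And>\<alpha>. 0 < \<alpha> \<Longrightarrow> \<alpha> \<noteq> 1 \<Longrightarrow>
    renyi_divergence \<alpha> (distr \<gamma> borel (\<lambda>x. x + v)) \<gamma> = ereal (\<alpha> * c)"
proof -
  obtain m :: nat and a :: "nat \<Rightarrow> real^'n" and b where \<gamma>: "\<gamma> = distr (Pi\<^sub>M {..<m} (\<lambda>_. std_normal_distribution)) borel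
      (\<lambda>x. b + (\<Sum>i<m. x i *\<^sub>R a i))"
    using assms(1) unfolding gaussian_measure_def by blast
  let ?\<mu> = "distr \<gamma> borel (\<lambda>x. x + v)"
  interpret P: prob_space "Pi\<^sub>M {..<m} (\<lambda>_ :: nat. std_normal_distribution)"
    by (rule prob_space_std_normal_PiM)
  interpret prob_space \<gamma> unfolding \<gamma> by (rule P.prob_space_distr) measurable
  obtain w where v: "v = (\<Sum>i<m. (a i \<bullet> w) *\<^sub>R a i)"
    using gauss_translate_in_span[OF ac[unfolded \<gamma>]] by (rule span_columns_imp_range)
  define q where "q = (\<Sum>i<m. (a i \<bullet> w)\<^sup>2)"
  define d where "d = (\<lambda>x. exp ((x - b) \<bullet> w - q / 2))"
  have dens: "density \<gamma> (\<lambda>x. ennreal (d x)) = ?\<mu>"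
    unfolding d_def q_def \<gamma> v by (rule gauss_translate_density)
  have [measurable]: "(\<lambda>x. ennreal (d x)) \<in> borel_measurable \<gamma>" by (simp add: d_def \<gamma>)
  have RN: "AE x in \<gamma>. ennreal (d x) = RN_deriv \<gamma> ?\<mu> x"
    by (rule RN_deriv_unique[OF _ dens]) measurable
  have "renyi_divergence \<alpha> ?\<mu> \<gamma> = ereal (\<alpha> * (q / 2))" if \<alpha>: "0 < \<alpha>" "\<alpha> \<noteq> 1" for \<alpha>
  proof -
    define q' where "q' = (\<Sum>i<m. (a i \<bullet> (\<alpha> *\<^sub>R w))\<^sup>2)"
    have q': "q' = \<alpha>\<^sup>2 * q" by (simp add: q'_def q_def sum_distrib_left power_mult_distrib)
    have one: "(\<integral>\<^sup>+x. ennreal (exp ((x - b) \<bullet> (\<alpha> *\<^sub>R w) - q' / 2)) \<partial>\<gamma>) = 1"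
    proof -
      have "(\<integral>\<^sup>+x. ennreal (exp ((x - b) \<bullet> (\<alpha> *\<^sub>R w) - q' / 2)) \<partial>\<gamma>)
          = emeasure (density \<gamma> (\<lambda>x. ennreal (exp ((x - b) \<bullet> (\<alpha> *\<^sub>R w) - q' / 2)))) (space \<gamma>)"
        by (subst emeasure_density) (auto simp: \<gamma> intro!: nn_integral_cong)
      also have "density \<gamma> (\<lambda>x. ennreal (exp ((x - b) \<bullet> (\<alpha> *\<^sub>R w) - q' / 2)))
          = distr \<gamma> borel (\<lambda>x. x + (\<Sum>i<m. (a i \<bullet> (\<alpha> *\<^sub>R w)) *\<^sub>R a i))"
        unfolding q'_def \<gamma> by (rule gauss_translate_density)
      also have "emeasure \<dots> (space \<gamma>) = 1"
        using prob_space.emeasure_space_1[OF prob_space_distr, of "\<lambda>x. x + (\<Sum>i<m. (a i \<bullet> (\<alpha> *\<^sub>R w)) *\<^sub>R a i)" borel]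
        by (simp add: \<gamma>)
      finally show ?thesis .
    qed
    have "(\<integral>\<^sup>+x. ennreal (enn2real (RN_deriv \<gamma> ?\<mu> x) powr \<alpha>) \<partial>\<gamma>)
        = (\<integral>\<^sup>+x. ennreal (exp (\<alpha> * (\<alpha> - 1) * q / 2)) *
            ennreal (exp ((x - b) \<bullet> (\<alpha> *\<^sub>R w) - q' / 2)) \<partial>\<gamma>)"
    proof (rule nn_integral_cong_AE)
      show "AE x in \<gamma>. ennreal (enn2real (RN_deriv \<gamma> ?\<mu> x) powr \<alpha>)
          = ennreal (exp (\<alpha> * (\<alpha> - 1) * q / 2)) * ennreal (exp ((x - b) \<bullet> (\<alpha> *\<^sub>R w) - q' / 2))"
        using RN
      proof eventually_elim
        fix x assume "ennreal (d x) = RN_deriv \<gamma> ?\<mu> x"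
        hence "enn2real (RN_deriv \<gamma> ?\<mu> x) = d x" by (metis d_def enn2real_ennreal exp_ge_zero)
        moreover have "d x powr \<alpha> = exp (\<alpha> * (\<alpha> - 1) * q / 2) * exp ((x - b) \<bullet> (\<alpha> *\<^sub>R w) - q' / 2)"
          by (simp add: d_def powr_def exp_add[symmetric] q' power2_eq_square field_simps)
        ultimately show "ennreal (enn2real (RN_deriv \<gamma> ?\<mu> x) powr \<alpha>)
          = ennreal (exp (\<alpha> * (\<alpha> - 1) * q / 2)) * ennreal (exp ((x - b) \<bullet> (\<alpha> *\<^sub>R w) - q' / 2))"
          by (simp add: ennreal_mult')
      qed
    qed
    also have "\<dots> = ennreal (exp (\<alpha> * (\<alpha> - 1) * q / 2)) *
        (\<integral>\<^sup>+x. ennreal (exp ((x - b) \<bullet> (\<alpha> *\<^sub>R w) - q' / 2)) \<partial>\<gamma>)"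
      by (rule nn_integral_cmult) (simp add: \<gamma>)
    also have "\<dots> = ennreal (exp (\<alpha> * (\<alpha> - 1) * q / 2))" unfolding one by simp
    finally have "renyi_divergence \<alpha> ?\<mu> \<gamma> = ereal (ln (exp (\<alpha> * (\<alpha> - 1) * q / 2)) / (\<alpha> - 1))"
      using \<alpha> by (intro renyi_divergence_eq_moment) auto
    also have "\<alpha> * (\<alpha> - 1) * q / 2 = \<alpha> * (q / 2) * (\<alpha> - 1)" by simp
    also have "ln (exp \<dots>) / (\<alpha> - 1) = \<alpha> * (q / 2)" unfolding ln_exp
      by (rule nonzero_mult_div_cancel_right) (use \<alpha> in simp)
    finally show ?thesis .
  qed
  thus ?thesis by (rule that)
qed

text \<open>For the quotient \<open>\<rho>\<close> of divergence and exponent the claim is plain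
  monotonicity. Its being real-valued records that all the divergences are finite, because
  log-concave functions have Gaussian moments of every positive order.\<close>

lemma gaussian_log_concave_profile:
  fixes \<gamma> \<mu> :: "(real^'n) measure"
  assumes "gaussian_measure \<gamma>" and \<mu>: "prob_space \<mu>" and lc: "log_concave_density \<gamma> \<mu>"
  obtains \<rho> :: "real \<Rightarrow> real"
  where "\<And>\<alpha>. 0 < \<alpha> \<Longrightarrow> renyi_divergence \<alpha> \<mu> \<gamma> = ereal (\<alpha> * \<rho> \<alpha>)"
    and "\<And>\<alpha> \<beta>. 0 < \<alpha> \<Longrightarrow> \<alpha> < \<beta> \<Longrightarrow> \<rho> \<beta> \<le> \<rho> \<alpha>"
    and "\<And>\<alpha> \<beta>. 0 < \<alpha> \<Longrightarrow> \<alpha> < \<beta> \<Longrightarrow> \<rho> \<beta> = \<rho> \<alpha> \<Longrightarrow> \<exists>v. \<mu> = distr \<gamma> borel (\<lambda>x. x + v)"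
proof -
  obtain m :: nat and a :: "nat \<Rightarrow> real^'n" and b where \<gamma>: "\<gamma> = distr (Pi\<^sub>M {..<m} (\<lambda>_. std_normal_distribution)) borel
      (\<lambda>x. b + (\<Sum>i<m. x i *\<^sub>R a i))"
    using assms(1) unfolding gaussian_measure_def by blast
  let ?P = "Pi\<^sub>M {..<m} (\<lambda>_ :: nat. std_normal_distribution)"
  let ?T = "\<lambda>x. b + (\<Sum>i<m. x i *\<^sub>R a i)"
  interpret P: prob_space ?P by (rule prob_space_std_normal_PiM)
  interpret prob_space \<gamma> unfolding \<gamma> by (rule P.prob_space_distr) measurable
  interpret \<mu>: prob_space \<mu> by (rule \<mu>)
  have sets\<gamma> [measurable_cong, simp]: "sets \<gamma> = sets borel" by (simp add: \<gamma>)
  have nn_T: "(\<integral>\<^sup>+x. F x \<partial>\<gamma>) = (\<integral>\<^sup>+x. F (?T x) \<partial>?P)"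
    if "F \<in> borel_measurable borel" for F :: "real^'n \<Rightarrow> ennreal"
    unfolding \<gamma> by (rule nn_integral_distr[OF measurable_gauss_affine]) (simp add: that)
  have AE_T: "AE x in ?P. Q (?T x)" if "AE x in \<gamma>. Q x" for Q
    using that unfolding \<gamma> by (rule AE_distrD[OF measurable_gauss_affine])
  have sets\<mu>: "sets \<mu> = sets \<gamma>" and ac: "absolutely_continuous \<gamma> \<mu>"
    using lc by (auto simp: log_concave_density_def)
  obtain f where f: "ext_concave f" "AE x in \<gamma>. RN_deriv \<gamma> \<mu> x = exp_ereal (f x)"
    using lc unfolding log_concave_density_def by blast
  define g where "g = (\<lambda>x. enn2real (exp_ereal (f x)))"
  have g: "logconc g" unfolding g_def by (rule logconc_of_ext_concave(1)[OF f(1)])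
  have g_eq: "ennreal (g x) = exp_ereal (f x)" for x
    unfolding g_def by (rule logconc_of_ext_concave(2)[OF f(1)])
  have g0: "0 \<le> g x" for x by (rule logconc_nonneg[OF g])
  define D where "D = (\<lambda>x. enn2real (RN_deriv \<gamma> \<mu> x))"
  have D0: "0 \<le> D x" for x by (simp add: D_def)
  have [measurable]: "D \<in> borel_measurable borel"
    unfolding D_def using borel_measurable_RN_deriv[of \<gamma> \<mu>] by simp
  have RNg: "AE x in \<gamma>. RN_deriv \<gamma> \<mu> x = ennreal (g x)" using f(2) by (simp add: g_eq)
  have RND: "AE x in \<gamma>. RN_deriv \<gamma> \<mu> x = ennreal (D x)"
    using RNg by eventually_elim (simp add: D_def g0)
  have \<mu>_eq: "density \<gamma> (RN_deriv \<gamma> \<mu>) = \<mu>"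
    using ac sets\<mu> by (rule density_RN_deriv)
  define R where "R = (\<lambda>\<alpha>. gauss_mean_iter \<alpha> a m g b)"
  have Rnn: "0 \<le> R \<alpha>" if "0 < \<alpha>" for \<alpha>
    unfolding R_def by (rule gauss_mean_iter_nonneg[OF g that])
  have mom: "(\<integral>\<^sup>+x. ennreal (D x powr \<alpha>) \<partial>\<gamma>) = ennreal (R \<alpha> powr \<alpha>)" if "0 < \<alpha>" for \<alpha>
  proof -
    have m: "(\<lambda>x. ennreal (D x powr \<alpha>)) \<in> borel_measurable borel" by measurable
    have "(\<integral>\<^sup>+x. ennreal (D x powr \<alpha>) \<partial>\<gamma>) = (\<integral>\<^sup>+x. ennreal (D (?T x) powr \<alpha>) \<partial>?P)"
      by (rule nn_T[OF m])
    also have "\<dots> = ennreal (R \<alpha> powr \<alpha>)"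
      unfolding R_def
    proof (rule gauss_mean_iter_nn_integral[OF g that])
      show "(\<lambda>x. ennreal (D (?T x) powr \<alpha>)) \<in> borel_measurable ?P"
        by (rule measurable_compose[OF measurable_gauss_affine m])
      have "AE x in \<gamma>. D x = g x" using RNg by eventually_elim (simp add: D_def g0)
      hence "AE x in ?P. D (?T x) = g (?T x)" by (rule AE_T)
      thus "AE x in ?P. ennreal (D (?T x) powr \<alpha>) = ennreal (g (?T x) powr \<alpha>)"
        by eventually_elim simp
    qed
    finally show ?thesis .
  qed
  define M where "M = (\<lambda>\<alpha>. LINT x|\<gamma>. D x powr \<alpha>)"
  have intD: "integrable \<gamma> (\<lambda>x. D x powr \<alpha>)" if "0 < \<alpha>" for \<alpha>
    using mom[OF that] by (intro integrableI_nonneg) auto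
  have M: "M \<alpha> = R \<alpha> powr \<alpha>" if "0 < \<alpha>" for \<alpha>
    using nn_integral_eq_integral[OF intD[OF that]] mom[OF that] by (simp add: M_def)
  have total: "(\<integral>\<^sup>+x. ennreal (D x) \<partial>\<gamma>) = 1"
  proof -
    have "(\<integral>\<^sup>+x. ennreal (D x) \<partial>\<gamma>) = (\<integral>\<^sup>+x. RN_deriv \<gamma> \<mu> x \<partial>\<gamma>)"
      using RND by (intro nn_integral_cong_AE) auto
    also have "\<dots> = emeasure (density \<gamma> (RN_deriv \<gamma> \<mu>)) (space \<gamma>)"
      by (subst emeasure_density) (auto simp: sets_eq_imp_space_eq[OF sets\<gamma>] intro!: nn_integral_cong)
    also have "\<dots> = 1"
      unfolding \<mu>_eq using \<mu>.emeasure_space_1 sets_eq_imp_space_eq[OF sets\<mu>] by simp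
    finally show ?thesis .
  qed
  have R1: "R 1 = 1"
    using mom[of 1] total Rnn[of 1] D0 by simp
  have Rpos: "0 < R \<alpha>" if "0 < \<alpha>" for \<alpha>
  proof (rule ccontr)
    assume "\<not> 0 < R \<alpha>"
    hence "(\<integral>\<^sup>+x. ennreal (D x powr \<alpha>) \<partial>\<gamma>) = 0" using mom[OF that] Rnn[OF that] by simp
    hence "AE x in \<gamma>. ennreal (D x powr \<alpha>) = 0" by (subst (asm) nn_integral_0_iff_AE) auto
    hence "AE x in \<gamma>. ennreal (D x) = 0" by eventually_elim (simp add: D0)
    hence "(\<integral>\<^sup>+x. ennreal (D x) \<partial>\<gamma>) = 0" by (subst nn_integral_0_iff_AE) auto
    thus False using total by simp
  qed
  define G where "G = (\<lambda>\<alpha>. ln (R \<alpha>))"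
  have G1: "G 1 = 0" by (simp add: G_def R1)
  have lnM: "ln (M \<alpha>) = \<alpha> * G \<alpha>" "0 < M \<alpha>" if "0 < \<alpha>" for \<alpha>
    using Rpos[OF that] M[OF that] by (simp_all add: G_def ln_powr)
  have lc_le: "g x powr p * g y powr q \<le> g (p *\<^sub>R x + q *\<^sub>R y)"
    if "0 < p" "0 < q" "p + q = 1" for p q x y
    using logconcD[OF g, of q x y] that by (simp add: eq_diff_eq[symmetric, of p q 1])
  have bb: "p *\<^sub>R b + q *\<^sub>R b = b" if "p + q = 1" for p q :: real
    using that by (simp add: scaleR_left_distrib[symmetric])
  have conc: "concave_on {0<..} G"
    unfolding concave_on_def
  proof (rule convex_onI)
    fix t x y :: real assume t: "0 < t" "t < 1" and xy: "x \<in> {0<..}" "y \<in> {0<..}"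
    have pos: "0 < (1 - t) * x + t * y" using t xy by (simp add: add_pos_pos)
    have "R x powr (1 - t) * R y powr t \<le> R ((1 - t) * x + t * y)"
      using prekopa_iter[OF g g g, of "1 - t" t x y a m b b] t xy lc_le[of "1 - t" t] bb[of "1 - t" t]
      by (simp add: R_def)
    moreover have Rxy: "0 < R x" "0 < R y" using Rpos[of x] Rpos[of y] xy by auto
    moreover from this have "0 < R x powr (1 - t) * R y powr t" by simp
    ultimately have "ln (R x powr (1 - t) * R y powr t) \<le> ln (R ((1 - t) * x + t * y))"
      using Rpos[OF pos] by (simp only: ln_le_cancel_iff)
    moreover have "ln (R x powr (1 - t) * R y powr t) = (1 - t) * ln (R x) + t * ln (R y)"
      using Rxy by (simp add: ln_mult ln_powr)
    ultimately show "- G ((1 - t) *\<^sub>R x + t *\<^sub>R y) \<le> (1 - t) * - G x + t * - G y"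
      by (simp add: G_def)
  qed simp
  define E where "E \<longleftrightarrow> (\<exists>x y p q. 0 < x \<and> 0 < y \<and> x \<noteq> y \<and> 0 < p \<and> 0 < q \<and> p + q = 1 \<and>
      p * G x + q * G y = G (p * x + q * y))"
  have translate: "\<exists>v. \<mu> = distr \<gamma> borel (\<lambda>x. x + v)" if e: E
  proof -
    obtain x y p q where xy: "0 < x" "0 < y" "x \<noteq> y" and pq: "0 < p" "0 < q" "p + q = 1"
      and eq: "p * G x + q * G y = G (p * x + q * y)"
      using e unfolding E_def by blast
    have pos: "0 < p * x + q * y" using pq xy by (simp add: add_pos_pos)
    have "R x powr p * R y powr q = exp (p * G x + q * G y)"
      using Rpos[OF xy(1)] Rpos[OF xy(2)] by (simp add: powr_def exp_add G_def)
    also have "\<dots> = R (p * x + q * y)" unfolding eq using Rpos[OF pos] by (simp add: G_def)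
    finally obtain k d where kd: "\<And>x. g (?T x) = exp ((\<Sum>i<m. k i * x i) + d)"
      using prekopa_iter_eq[OF g g g pq xy lc_le[OF pq], of a m b] Rpos[OF xy(1)] Rpos[OF xy(2)]
      unfolding R_def by blast
    define v where "v = (\<Sum>i<m. k i *\<^sub>R a i)"
    \<comment> \<open>The constant is not evaluated: \<open>\<mu>\<close> and the translate both
      have total mass one, which forces it to be 1.\<close>
    define c where "c = ennreal (exp d) * ennreal (exp ((\<Sum>i<m. (k i)\<^sup>2) / 2))"
    let ?\<nu> = "distr \<gamma> borel (\<lambda>x. x + v)"
    have em: "emeasure \<mu> B = c * emeasure ?\<nu> B" if B [measurable]: "B \<in> sets borel" for B
    proof -
      have "emeasure \<mu> B = emeasure (density \<gamma> (RN_deriv \<gamma> \<mu>)) B" by (simp add: \<mu>_eq)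
      also have "\<dots> = (\<integral>\<^sup>+x. RN_deriv \<gamma> \<mu> x * indicator B x \<partial>\<gamma>)"
        by (rule emeasure_density) auto
      also have "\<dots> = (\<integral>\<^sup>+x. RN_deriv \<gamma> \<mu> (?T x) * indicator B (?T x) \<partial>?P)"
      proof -
        have "(\<lambda>x. RN_deriv \<gamma> \<mu> x * indicator B x) \<in> borel_measurable borel"
          using borel_measurable_RN_deriv[of \<gamma> \<mu>] B by (simp add: measurable_cong_sets[OF sets\<gamma> refl])
        thus ?thesis by (rule nn_T)
      qed
      also have "\<dots> = (\<integral>\<^sup>+x. ennreal (exp d) * (indicator B (?T x) * ennreal (exp (\<Sum>i<m. k i * x i))) \<partial>?P)"
      proof (rule nn_integral_cong_AE)
        have "AE x in ?P. RN_deriv \<gamma> \<mu> (?T x) = ennreal (g (?T x))"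
          by (rule AE_T[OF RNg])
        thus "AE x in ?P. RN_deriv \<gamma> \<mu> (?T x) * indicator B (?T x)
            = ennreal (exp d) * (indicator B (?T x) * ennreal (exp (\<Sum>i<m. k i * x i)))"
        proof eventually_elim
          fix x assume "RN_deriv \<gamma> \<mu> (?T x) = ennreal (g (?T x))"
          also have "\<dots> = ennreal (exp d) * ennreal (exp (\<Sum>i<m. k i * x i))"
            unfolding kd by (simp add: exp_add ennreal_mult' mult.commute)
          finally show "RN_deriv \<gamma> \<mu> (?T x) * indicator B (?T x)
            = ennreal (exp d) * (indicator B (?T x) * ennreal (exp (\<Sum>i<m. k i * x i)))"
            by (simp only: mult_ac)
        qed
      qed
      also have "\<dots> = ennreal (exp d) * (\<integral>\<^sup>+x. indicator B (?T x) * ennreal (exp (\<Sum>i<m. k i * x i)) \<partial>?P)"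
      proof (rule nn_integral_cmult)
        have comp: "(\<lambda>x. x i) \<in> borel_measurable ?P" if "i < m" for i
          using measurable_component_singleton[of i "{..<m}" "\<lambda>_. std_normal_distribution"] that
          by (simp cong: measurable_cong_sets)
        show "(\<lambda>x. indicator B (?T x) * ennreal (exp (\<Sum>i<m. k i * x i))) \<in> borel_measurable ?P"
          by (intro borel_measurable_times_ennreal measurable_compose[OF measurable_gauss_affine borel_measurable_indicator]
              measurable_compose[OF _ measurable_ennreal] borel_measurable_exp borel_measurable_sum
              borel_measurable_times borel_measurable_const comp B) auto
      qed
      also have "(\<integral>\<^sup>+x. indicator B (?T x) * ennreal (exp (\<Sum>i<m. k i * x i)) \<partial>?P)
          = ennreal (exp ((\<Sum>i<m. (k i)\<^sup>2) / 2)) * (\<integral>\<^sup>+x. indicator B (b + v + (\<Sum>i<m. x i *\<^sub>R a i)) \<partial>?P)"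
        unfolding v_def by (rule PiM_std_normal_shift) simp
      also have "(\<integral>\<^sup>+x. indicator B (b + v + (\<Sum>i<m. x i *\<^sub>R a i)) \<partial>?P) = emeasure ?\<nu> B"
        unfolding \<gamma> by (rule distr_gauss_translate_emeasure[OF B, symmetric])
      finally show ?thesis by (simp add: c_def mult.assoc)
    qed
    interpret \<nu>: prob_space ?\<nu> by (rule prob_space_distr) simp
    have "emeasure \<mu> UNIV = 1"
      using \<mu>.emeasure_space_1 sets_eq_imp_space_eq[OF sets\<mu>] sets_eq_imp_space_eq[OF sets\<gamma>] by simp
    moreover have "emeasure ?\<nu> UNIV = 1" using \<nu>.emeasure_space_1 by simp
    ultimately have "c = 1" using em[of UNIV] by simp
    hence "\<mu> = ?\<nu>" using em sets\<mu> by (intro measure_eqI) auto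
    thus ?thesis by blast
  qed
  define \<kappa> where "\<kappa> = (LINT x|\<gamma>. D x * ln (D x))"
  note slope = concave_slope_antimono[OF conc G1, folded E_def]
  have D\<gamma>: "D \<in> borel_measurable \<gamma>" by simp
  note deriv = powr_moment_derivative[OF D\<gamma> D0 intD]
  have LD: "(LINT x|\<gamma>. D x) = 1" using M[of 1] R1 D0 by (simp add: M_def)
  \<comment> \<open>By \<open>ln t \<le> t - 1\<close>, \<open>X\<close> bounds the slope of
    \<open>G\<close> from above for exponents greater than 1 and from below for smaller ones, and it
    tends to \<open>\<kappa>\<close>. On each side this one bound suffices, without differentiating
    \<open>G\<close>.\<close>
  define X where "X = (\<lambda>\<alpha>. inverse \<alpha> * ((M \<alpha> - 1) / (\<alpha> - 1)))"
  have GX: "(1 < \<alpha> \<longrightarrow> G \<alpha> / (\<alpha> - 1) \<le> X \<alpha>) \<and> (\<alpha> < 1 \<longrightarrow> X \<alpha> \<le> G \<alpha> / (\<alpha> - 1))"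
    if \<alpha>: "0 < \<alpha>" for \<alpha>
  proof -
    have "\<alpha> * G \<alpha> \<le> M \<alpha> - 1" using ln_le_minus_one[OF lnM(2)[OF \<alpha>]] lnM(1)[OF \<alpha>] by simp
    hence "G \<alpha> \<le> inverse \<alpha> * (M \<alpha> - 1)" using \<alpha> by (simp add: field_simps)
    thus ?thesis unfolding X_def times_divide_eq_right
      by (auto intro: divide_right_mono divide_right_mono_neg)
  qed
  have XK: "(\<lambda>n. X (s n)) \<longlonglongrightarrow> \<kappa>"
    if s: "\<And>n. 1 / 2 \<le> s n" "\<And>n. s n \<le> 2" "\<And>n. s n \<noteq> 1" "s \<longlonglongrightarrow> 1" for s
  proof -
    have "(\<lambda>n. (M (s n) - 1) / (s n - 1)) \<longlonglongrightarrow> \<kappa>"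
      using deriv(2)[OF _ s] by (simp only: LD M_def \<kappa>_def)
    from tendsto_mult[OF tendsto_inverse[OF s(4)] this] show ?thesis by (simp add: X_def)
  qed
  have lim: "(\<lambda>n. 1 + e * inverse (real (Suc n))) \<longlonglongrightarrow> 1" for e :: real
    using tendsto_add[OF tendsto_const[of 1] tendsto_mult[OF tendsto_const[of e] LIMSEQ_inverse_real_of_nat]] by simp
  have inv1: "0 < inverse (real (Suc n))" "inverse (real (Suc n)) \<le> 1" for n
    by (simp_all add: inverse_eq_divide)
  have above: "G \<beta> / (\<beta> - 1) \<le> \<kappa>" if \<beta>: "1 < \<beta>" for \<beta>
  proof -
    \<comment> \<open>The cap keeps the sequence inside the range \<open>{1 / 2..2}\<close> required
      for the limit, and \<open>s n\<close> below or at \<open>\<beta>\<close>; equality is possible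
      for \<open>n = 0\<close>.\<close>
    define e where "e = min 1 (\<beta> - 1)"
    have e: "0 < e" "e \<le> 1" "1 + e \<le> \<beta>" using \<beta> by (auto simp: e_def)
    define s where "s = (\<lambda>n. 1 + e * inverse (real (Suc n)))"
    have s: "1 < s n" "s n \<le> 1 + e" for n
      using inv1[of n] e by (auto simp: s_def mult_left_le)
    have sX: "(\<lambda>n. X (s n)) \<longlonglongrightarrow> \<kappa>"
    proof (rule XK)
      show "1 / 2 \<le> s n" "s n \<le> 2" "s n \<noteq> 1" for n using s[of n] e by auto
      show "s \<longlonglongrightarrow> 1" unfolding s_def by (rule lim)
    qed
    have "G \<beta> / (\<beta> - 1) \<le> X (s n)" for n
    proof -
      have "G \<beta> / (\<beta> - 1) \<le> G (s n) / (s n - 1)"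
      proof (cases "s n = \<beta>")
        case False
        hence "s n < \<beta>" using s[of n] e by simp
        thus ?thesis using s[of n] \<beta> by (intro slope(1)) auto
      qed simp
      also have "\<dots> \<le> X (s n)" using GX[of "s n"] s[of n] by simp
      finally show ?thesis .
    qed
    thus ?thesis by (intro LIMSEQ_le_const[OF sX]) blast
  qed
  have below: "\<kappa> \<le> G \<alpha> / (\<alpha> - 1)" if \<alpha>: "0 < \<alpha>" "\<alpha> < 1" for \<alpha>
  proof -
    define e where "e = min (1 / 2) (1 - \<alpha>)"
    have e: "0 < e" "e \<le> 1 / 2" "\<alpha> \<le> 1 - e" using \<alpha> by (auto simp: e_def min_def)
    define s where "s = (\<lambda>n. 1 + (- e) * inverse (real (Suc n)))"
    have s: "s n < 1" "1 - e \<le> s n" for n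
      using inv1[of n] e by (auto simp: s_def mult_left_le)
    have sX: "(\<lambda>n. X (s n)) \<longlonglongrightarrow> \<kappa>"
    proof (rule XK)
      show "1 / 2 \<le> s n" "s n \<le> 2" "s n \<noteq> 1" for n using s[of n] e by auto
      show "s \<longlonglongrightarrow> 1" unfolding s_def by (rule lim)
    qed
    have "X (s n) \<le> G \<alpha> / (\<alpha> - 1)" for n
    proof -
      have "X (s n) \<le> G (s n) / (s n - 1)" using GX[of "s n"] s[of n] e \<alpha> by simp
      also have "\<dots> \<le> G \<alpha> / (\<alpha> - 1)"
      proof (cases "s n = \<alpha>")
        case False
        hence "\<alpha> < s n" using s[of n] e by simp
        thus ?thesis using s[of n] \<alpha> by (intro slope(1)) auto
      qed simp
      finally show ?thesis .
    qed
    thus ?thesis by (intro LIMSEQ_le_const2[OF sX]) blast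
  qed
  define \<rho> where "\<rho> = (\<lambda>\<alpha>. if \<alpha> = 1 then \<kappa> else G \<alpha> / (\<alpha> - 1))"
  have mono: "\<rho> \<beta> \<le> \<rho> \<alpha> \<and> (\<rho> \<beta> = \<rho> \<alpha> \<longrightarrow> E)" if ab: "0 < \<alpha>" "\<alpha> < \<beta>" for \<alpha> \<beta>
  proof -
    consider "\<alpha> \<noteq> 1" "\<beta> \<noteq> 1" | "\<alpha> = 1" | "\<beta> = 1" by blast
    thus ?thesis
    proof cases
      case 1
      thus ?thesis using slope[OF ab 1] by (auto simp: \<rho>_def)
    next
      case 2
      \<comment> \<open>An exponent strictly between 1 and \<open>\<beta>\<close> carries the
        strictness over to 1: if \<open>G \<beta> / (\<beta> - 1)\<close> equals
        \<open>\<kappa>\<close>, it also equals the slope at \<open>c\<close>, which lies between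
        them.\<close>
      define c where "c = (1 + \<beta>) / 2"
      have c: "0 < c" "1 < c" "c < \<beta>" "c \<noteq> 1" "\<beta> \<noteq> 1" using 2 ab by (auto simp: c_def)
      show ?thesis using slope[OF c(1,3-5)] above[OF c(2)] 2 c by (auto simp: \<rho>_def)
    next
      case 3
      define c where "c = (1 + \<alpha>) / 2"
      have c: "\<alpha> < c" "\<alpha> \<noteq> 1" "c \<noteq> 1" "0 < c" "c < 1" using 3 ab by (auto simp: c_def)
      show ?thesis using slope[OF ab(1) c(1-3)] below[OF c(4,5)] 3 c by (auto simp: \<rho>_def)
    qed
  qed
  have val: "renyi_divergence \<alpha> \<mu> \<gamma> = ereal (\<alpha> * \<rho> \<alpha>)" if \<alpha>: "0 < \<alpha>" for \<alpha>
  proof (cases "\<alpha> = 1")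
    case True
    have ed: "entropy_density (exp 1) \<gamma> \<mu> = (\<lambda>x. ln (D x))"
      by (simp add: entropy_density_def D_def log_def fun_eq_iff)
    have \<mu>D: "\<mu> = density \<gamma> (\<lambda>x. ennreal (D x))"
    proof -
      have "density \<gamma> (RN_deriv \<gamma> \<mu>) = density \<gamma> (\<lambda>x. ennreal (D x))"
        using RND by (intro density_cong) auto
      thus ?thesis by (simp only: \<mu>_eq)
    qed
    have "integrable \<mu> (\<lambda>x. ln (D x))"
      unfolding \<mu>D using deriv(1) D0 by (subst integrable_density) auto
    moreover have "(LINT x|\<mu>. ln (D x)) = \<kappa>"
      unfolding \<mu>D \<kappa>_def using D0 by (subst integral_density) auto
    ultimately show ?thesis using True by (simp add: renyi_divergence_def KL_divergence_def ed \<rho>_def)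
  next
    case False
    have "renyi_divergence \<alpha> \<mu> \<gamma> = ereal (ln (M \<alpha>) / (\<alpha> - 1))"
      using False lnM(2)[OF \<alpha>] mom[OF \<alpha>] M[OF \<alpha>] unfolding D_def
      by (intro renyi_divergence_eq_moment) auto
    thus ?thesis using False by (simp add: lnM(1)[OF \<alpha>] \<rho>_def)
  qed
  show ?thesis
    by (rule that[of \<rho>]) (use val mono translate in blast)+
qed

theorem theorem1p2:
  fixes \<alpha> \<beta> :: real
    and \<gamma> :: "(real^'n) measure"
    and M :: "'a measure" and X :: "'a \<Rightarrow> real^'n"
    and N :: "'b measure" and Z :: "'b \<Rightarrow> real^'n"
  assumes "0 < \<alpha>" and "\<alpha> < \<beta>"
    and "gaussian_measure \<gamma>"
    and "prob_space M" and "X \<in> borel_measurable M"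
    and "log_concave_density \<gamma> (distr M borel X)"
    and "prob_space N" and "Z \<in> borel_measurable N"
    and "distr N borel Z = \<gamma>"
  shows "renyi_divergence \<beta> (distr M borel X) (distr N borel Z)
           \<le> ereal (\<beta> / \<alpha>) * renyi_divergence \<alpha> (distr M borel X) (distr N borel Z)
       \<and> (renyi_divergence \<beta> (distr M borel X) (distr N borel Z)
             = ereal (\<beta> / \<alpha>) * renyi_divergence \<alpha> (distr M borel X) (distr N borel Z)
           \<longleftrightarrow> (\<exists>v. distr M borel X = distr N borel (\<lambda>\<omega>. Z \<omega> + v)))"
proof -
  define \<mu> where "\<mu> = distr M borel X"
  have "prob_space \<mu>" unfolding \<mu>_def using assms(4,5) by (rule prob_space.prob_space_distr)
  then obtain \<rho> where \<rho>: "\<And>\<alpha>. 0 < \<alpha> \<Longrightarrow> renyi_divergence \<alpha> \<mu> \<gamma> = ereal (\<alpha> * \<rho> \<alpha>)"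
    "\<And>\<alpha> \<beta>. 0 < \<alpha> \<Longrightarrow> \<alpha> < \<beta> \<Longrightarrow> \<rho> \<beta> \<le> \<rho> \<alpha>"
    "\<And>\<alpha> \<beta>. 0 < \<alpha> \<Longrightarrow> \<alpha> < \<beta> \<Longrightarrow> \<rho> \<beta> = \<rho> \<alpha> \<Longrightarrow> \<exists>v. \<mu> = distr \<gamma> borel (\<lambda>x. x + v)"
    using gaussian_log_concave_profile[OF assms(3) _ assms(6)[folded \<mu>_def]] by blast
  have \<beta>: "0 < \<beta>" using assms(1,2) by simp
  have tr: "distr N borel (\<lambda>\<omega>. Z \<omega> + v) = distr \<gamma> borel (\<lambda>x. x + v)" for v
    using assms(8) unfolding assms(9)[symmetric] by (subst distr_distr) (auto simp: comp_def)
  have rhs: "ereal (\<beta> / \<alpha>) * renyi_divergence \<alpha> \<mu> \<gamma> = ereal (\<beta> * \<rho> \<alpha>)"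
    using \<rho>(1)[OF assms(1)] assms(1) by simp
  have const: "\<rho> \<beta> = \<rho> \<alpha>" if v: "\<mu> = distr \<gamma> borel (\<lambda>x. x + v)" for v
  proof -
    have "absolutely_continuous \<gamma> (distr \<gamma> borel (\<lambda>x. x + v))"
      using assms(6) unfolding log_concave_density_def \<mu>_def[symmetric] v by blast
    then obtain c where c: "\<And>\<alpha>. 0 < \<alpha> \<Longrightarrow> \<alpha> \<noteq> 1 \<Longrightarrow> renyi_divergence \<alpha> \<mu> \<gamma> = ereal (\<alpha> * c)"
      using gaussian_translate_renyi[OF assms(3)] unfolding v by metis
    have \<rho>c: "\<rho> t = c" if "0 < t" "t \<noteq> 1" for t
      using c[OF that] \<rho>(1)[OF that(1)] that by simp
    \<comment> \<open>The monotonicity of \<open>\<rho>\<close> squeezes its value at 1, so the Kullback-Leibler divergence of a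
      translation need not be computed.\<close>
    have "\<rho> 1 = c"
      using \<rho>(2)[of 1 2] \<rho>(2)[of "1 / 2" 1] \<rho>c[of 2] \<rho>c[of "1 / 2"] by simp
    thus ?thesis using \<rho>c \<beta> assms(1) by metis
  qed
  have "\<beta> * \<rho> \<beta> \<le> \<beta> * \<rho> \<alpha>" using \<rho>(2)[OF assms(1,2)] \<beta> by simp
  moreover have "\<beta> * \<rho> \<beta> = \<beta> * \<rho> \<alpha> \<longleftrightarrow> (\<exists>v. \<mu> = distr \<gamma> borel (\<lambda>x. x + v))"
    using \<rho>(3)[OF assms(1,2)] const \<beta> by auto
  ultimately show ?thesis
    unfolding \<mu>_def[symmetric] assms(9) tr rhs \<rho>(1)[OF \<beta>] by simp
qed

end
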